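(* Let $I \subset \mathbb{T}$ be a nonempty open set such that $\sigma(\bar{I}) < 1$ and $\sigma(E) = 0$, where $E$ denotes the relative boundary of $I$ in $\mathbb{T}$. Let $p = (z_0,0) \in \mathbb{D} \times \{0\}$. Let $g \colon \mathbb{D} \to \mathbb{D}$ be a holomorphic function such that $g$ extends continuously to $\bar{\mathbb{D}} \setminus E$ and such that (for this extension) $|g| = 1$ on $I$ and $|g| < 1$ on $\mathbb{T} \setminus \bar{I}$. Define $\tilde{f}_\nu(\zeta) = (\zeta, g^\nu(\zeta))$, where $g^\nu$ denotes the $\nu$-th power of $g$. Then for every sequence $\{r_\nu\}_{\nu=1}^\infty \subset (0,1)$ converging to $1$ fast enough (that is, there exists a sequence $\{\delta_\nu\}_{\nu=1}^\infty \subset (0,1)$ such that for every sequence $\{r_\nu\}_{\nu=1}^\infty$ with $r_\nu \to 1$ and $1-\delta_\nu < r_\nu < 1$ for all $\nu$), and for $\tau_\nu(\zeta) = r_\nu \zeta$, the holomorphic maps $f_\nu \colon \bar{\mathbb{D}} \to \mathbb{C}^2$ given by $f_\nu = \tilde{f}_\nu \circ \tau_\nu \circ \varphi_{z_0}$ have the property that the sequence $\{(f_\nu)_\ast G\}$ converges weakly to $$T = (\imath_0)_\ast G_{z_0} + \int_I (\jmath_\zeta)_\ast G \, d\omega_{\mathbb{D}}(z_0,\zeta),$$ where $\imath_0 \colon \mathbb{D} \hookrightarrow \mathbb{D} \times \{0\}$ and $\jmath_\zeta \colon \mathbb{D} \hookrightarrow \{\zeta\} \times \mathbb{D}$ are the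 natural inclusions, i.e., $$\langle T,\alpha\rangle = \int_{\mathbb{D} \times \{0\}} g_{\mathbb{D}}(z_0,\,\cdot\,)\,\alpha + \int_I \left( \int_{\{\zeta\} \times \mathbb{D}} g_{\mathbb{D}}(0,\,\cdot\,)\,\alpha \right) d\omega_{\mathbb{D}}(z_0,\zeta), \qquad \alpha \in \mathcal{E}^{1,1}(\mathbb{C}^2).$$
   Context: $\mathbb{D} = \{\zeta \in \mathbb{C} : |\zeta| < 1\}$, $\mathbb{T} = \{\zeta \in \mathbb{C} : |\zeta| = 1\}$, and $\sigma$ is normalized arclength measure on $\mathbb{T}$, $\sigma(\mathbb{T}) = 1$. For $z_0 \in \mathbb{D}$, $\varphi_{z_0}(\zeta) = \dfrac{z_0 - \zeta}{1 - \bar{z}_0 \zeta}$; $g_{\mathbb{D}}(z_0,\zeta) = -\log|\varphi_{z_0}(\zeta)|$ is the Green's function of $\mathbb{D}$; and $d\omega_{\mathbb{D}}(z_0,\zeta) = \dfrac{1-|z_0|^2}{|\zeta - z_0|^2}\, d\sigma(\zeta)$ is the harmonic measure on $\mathbb{T}$. $\mathcal{E}^{1,1}(X)$ denotes the smooth $(1,1)$-forms on $X$. The Green current with respect to $z_0$ is $\langle G_{z_0}, \alpha\rangle = \int_{\mathbb{D}} g_{\mathbb{D}}(z_0,\,\cdot\,)\,\alpha$ for $\alpha \in \mathcal{E}^{1,1}(\bar{\mathbb{D}})$, and $G = G_0$, i.e. $\langle G,\alpha\rangle = -\int_{\mathbb{D}} \log|\zeta| \cdot \alpha$. Pushforward is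 defined by $\langle f_\ast G, \alpha\rangle = \langle G, f^\ast\alpha\rangle$ for $\alpha \in \mathcal{E}^{1,1}(\mathbb{C}^2)$ (and likewise for $G_{z_0}$), with $\imath_0(\xi) = (\xi,0)$ and $\jmath_\zeta(\xi) = (\zeta,\xi)$. In the integrals over $\mathbb{D}\times\{0\}$ and $\{\zeta\}\times\mathbb{D}$, these discs are identified with $\mathbb{D}$ via $\imath_0$ and $\jmath_\zeta$. Weak convergence of $(f_\nu)_\ast G$ to $T$ means $\langle (f_\nu)_\ast G,\alpha\rangle \to \langle T,\alpha\rangle$ for every $\alpha \in \mathcal{E}^{1,1}(\mathbb{C}^2)$. A map on $\bar{\mathbb{D}}$ is called holomorphic if it is holomorphic in a neighborhood of $\bar{\mathbb{D}}$. *)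

theory Defs
  imports "HOL-Complex_Analysis.Complex_Analysis"
begin

definition disc_aut :: "complex \<Rightarrow> complex \<Rightarrow> complex" where
  "disc_aut z0 \<zeta> = (z0 - \<zeta>) / (1 - cnj z0 * \<zeta>)"

definition green :: "complex \<Rightarrow> complex \<Rightarrow> real" where
  "green z0 \<zeta> = - ln (norm (disc_aut z0 \<zeta>))"

definition arclength :: "complex measure" where
  "arclength =
     distr (uniform_measure lborel {0..<2 * pi}) (restrict_space borel (sphere 0 1)) cis"

definition harmonic_measure :: "complex \<Rightarrow> complex measure" where
  "harmonic_measure z0 =
     density arclength (\<lambda>\<zeta>. ennreal ((1 - (norm z0)\<^sup>2) / (norm (\<zeta> - z0))\<^sup>2))"

lemma space_arclength [simp]: "space arclength = sphere 0 1"
  by (simp add: arclength_def space_restrict_space)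

lemma emeasure_arclength_sphere: "emeasure arclength (sphere 0 1) = 1"
proof -
  have "cis \<in> uniform_measure lborel {0..<2 * pi} \<rightarrow>\<^sub>M restrict_space borel (sphere 0 1)"
    using borel_measurable_continuous_onI[of cis, OF continuous_on_cis[OF continuous_on_id]]
    by (intro measurable_restrict_space2) (auto simp: measurable_def)
  then have "emeasure arclength (sphere 0 1) =
      emeasure (uniform_measure lborel {0..<2 * pi}) (cis -` sphere 0 1 \<inter> UNIV)"
    unfolding arclength_def
    by (subst emeasure_distr) (auto simp: sets_restrict_space)
  also have "cis -` sphere 0 1 \<inter> UNIV = UNIV"
    by auto
  finally show ?thesis
    by (simp add: emeasure_uniform_measure divide_ennreal)
qed

text \<open>Real \<open>C\<^sup>k\<close>- and smoothness on the whole space. All spaces used here are finite-dimensional,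
  so it suffices to iterate directional derivatives.\<close>

primrec C_diff :: "nat \<Rightarrow> ('a::euclidean_space \<Rightarrow> 'b::real_normed_vector) \<Rightarrow> bool" where
  "C_diff 0 f \<longleftrightarrow> continuous_on UNIV f"
| "C_diff (Suc k) f \<longleftrightarrow>
     (\<forall>x. f differentiable (at x)) \<and> (\<forall>v. C_diff k (\<lambda>x. frechet_derivative f (at x) v))"

definition smooth :: "('a::euclidean_space \<Rightarrow> 'b::real_normed_vector) \<Rightarrow> bool" where
  "smooth f \<longleftrightarrow> (\<forall>k. C_diff k f)"

text \<open>A complex-valued \<open>2\<close>-form maps a point and two (real) tangent vectors to a complex number.\<close>

type_synonym 'a form2 = "'a \<Rightarrow> 'a \<Rightarrow> 'a \<Rightarrow> complex"

definition wedge :: "('a \<Rightarrow> complex) \<Rightarrow> ('a \<Rightarrow> complex) \<Rightarrow> 'a \<Rightarrow> 'a \<Rightarrow> complex" where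
  "wedge a b u v = a u * b v - a v * b u"

text \<open>The covectors \<open>dz\<^sub>1, dz\<^sub>2\<close> are \<^const>\<open>fst\<close> and \<^const>\<open>snd\<close>; composing with \<^const>\<open>cnj\<close> gives their
  conjugates. A form belongs to the following set iff it is
  \<open>\<Sum>j,k. a\<^sub>j\<^sub>k dz\<^sub>j \<and> d(cnj z\<^sub>k)\<close> with smooth coefficients.\<close>

definition smooth_forms11 :: "(complex \<times> complex) form2 set" where
  "smooth_forms11 = {\<alpha>. \<exists>a11 a12 a21 a22.
     smooth a11 \<and> smooth a12 \<and> smooth a21 \<and> smooth a22 \<and>
     \<alpha> = (\<lambda>x u v. a11 x * wedge fst (cnj \<circ> fst) u v + a12 x * wedge fst (cnj \<circ> snd) u v +
                   a21 x * wedge snd (cnj \<circ> fst) u v + a22 x * wedge snd (cnj \<circ> snd) u v)}"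

definition pullback ::
  "('a::real_normed_vector \<Rightarrow> 'b::real_normed_vector) \<Rightarrow> 'b form2 \<Rightarrow> 'a form2" where
  "pullback f \<alpha> =
     (\<lambda>x u v. \<alpha> (f x) (frechet_derivative f (at x) u) (frechet_derivative f (at x) v))"

text \<open>A \<open>2\<close>-form \<open>\<beta>\<close> on the plane equals \<open>\<beta>(1, \<i>) dx \<and> dy\<close>, so its integral over
  the disc is that of \<open>\<beta>(1, \<i>)\<close> against Lebesgue measure.\<close>

definition green_current :: "complex \<Rightarrow> complex form2 \<Rightarrow> complex" where
  "green_current z0 \<beta> =
     (LINT \<zeta>:ball 0 1|lborel. complex_of_real (green z0 \<zeta>) * \<beta> \<zeta> 1 \<i>)"

definition pushforward ::
  "('a::real_normed_vector \<Rightarrow> 'b::real_normed_vector) \<Rightarrow> ('a form2 \<Rightarrow> complex) \<Rightarrow>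
   'b form2 \<Rightarrow> complex" where
  "pushforward f S \<alpha> = S (pullback f \<alpha>)"

definition weakly_converges ::
  "(nat \<Rightarrow> (complex \<times> complex) form2 \<Rightarrow> complex) \<Rightarrow> ((complex \<times> complex) form2 \<Rightarrow> complex) \<Rightarrow> bool"
  where "weakly_converges S T \<longleftrightarrow> (\<forall>\<alpha>\<in>smooth_forms11. (\<lambda>\<nu>. S \<nu> \<alpha>) \<longlonglongrightarrow> T \<alpha>)"

definition holomorphic_near :: "(complex \<Rightarrow> complex \<times> complex) \<Rightarrow> complex set \<Rightarrow> bool" where
  "holomorphic_near f K \<longleftrightarrow>
     (\<exists>U. open U \<and> K \<subseteq> U \<and> (fst \<circ> f) holomorphic_on U \<and> (snd \<circ> f) holomorphic_on U)"

end

theory Submission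
  imports Defs "HOL-Real_Asymp.Real_Asymp"
begin

text \<open>Put \<open>h\<^sub>\<nu>(w) = g(r\<^sub>\<nu> w)\<^sup>\<nu>\<close>. The substitution \<open>w = disc_aut z0 \<zeta>\<close> carries \<open>green 0\<close> to \<open>green z0\<close>, so pairing
the pushforward with a form with coefficients \<open>a\<^sub>j\<^sub>k\<close> gives \<open>-2\<i>\<close> times the integral over the disc of
\<open>green z0\<close> times \<open>a\<^sub>1\<^sub>1 r\<^sup>2 + a\<^sub>1\<^sub>2 r cnj h' + a\<^sub>2\<^sub>1 r h' + a\<^sub>2\<^sub>2 \<bar>h'\<bar>\<^sup>2\<close>, the coefficients being taken at
\<open>(r w, h w)\<close>. Inside the disc \<open>\<bar>g\<bar> < 1\<close>, so \<open>h\<close> and \<open>h'\<close> tend to \<open>0\<close> pointwise, while Cauchy's estimate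
\<open>\<bar>h'(w)\<bar> \<le> C / (1 - \<bar>w\<bar>)\<close> and the vanishing of \<open>green z0\<close> on the circle provide a dominating function.
Hence the first term converges to the integral over the horizontal disc and the mixed terms to \<open>0\<close>.

The last term keeps a mass of fixed size that moves to the circle. There \<open>green z0\<close> may be replaced by
half of \<open>1 - \<bar>w\<bar>\<^sup>2\<close> times the Poisson kernel, as the difference is of second order and is again dominated
(\<open>LINT_green_energy_tendsto\<close>). What is left is the limit of \<open>\<integral> (1 - \<bar>w\<bar>\<^sup>2) \<Psi>(w, h w) \<bar>h'\<bar>\<^sup>2\<close> for a continuous
\<open>\<Psi>\<close> on the bidisc. The total mass of \<open>(1 - \<bar>w\<bar>\<^sup>2) \<bar>h'\<bar>\<^sup>2\<close> is at most \<open>\<pi>\<close>, so the Stone-Weierstrass theorem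
reduces this to monomials \<open>w\<^sup>a cnj w\<^sup>b \<xi>\<^sup>c cnj \<xi>\<^sup>d\<close>. For a monomial the integrand is, up to a constant and
dominated lower-order terms, \<open>(1 - \<bar>w\<bar>\<^sup>2) P' cnj Q'\<close> with \<open>P = w\<^sup>a h\<^sup>c\<^sup>+\<^sup>1\<close> and \<open>Q = w\<^sup>b h\<^sup>d\<^sup>+\<^sup>1\<close>, and the identity
\<open>green_identity_disc\<close>, namely \<open>\<integral> (1 - \<bar>w\<bar>\<^sup>2) P' cnj Q' + P cnj Q = \<pi> \<integral> P cnj Q d\<sigma>\<close> with the left integral over
the disc and the right one over the circle, leaves only \<open>\<integral> P cnj Q d\<sigma>\<close>.

If the radii tend to \<open>1\<close> fast enough, then \<open>\<bar>h\<bar>\<^sup>2\<close> tends in \<open>L\<^sup>1(\<sigma>)\<close> to the indicator of \<open>I\<close>. So for \<open>c = d\<close> the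
limit is \<open>\<integral>\<^sub>I w\<^sup>a cnj w\<^sup>b d\<sigma>\<close>. For \<open>c \<noteq> d\<close> it is \<open>0\<close>, because powers of \<open>h\<close> converge weakly to \<open>0\<close> on the
circle, even after multiplication by the indicator of \<open>I\<close>: the indicator is \<open>L\<^sup>1\<close>-close to \<open>h\<^sub>m cnj h\<^sub>m\<close> with
\<open>m\<close> fixed, and the same identity applies (\<open>circle_moments_tendsto\<close>). These values agree with the
integrals of the monomials against \<open>green 0\<close> on the vertical discs over \<open>I\<close>.\<close>

section \<open>Change of variables under injective holomorphic maps\<close>

text \<open>The change-of-variables theorem for Lebesgue measure is stated for \<open>real^'n\<close>; this map and its inverse,
both isometries, transport it to the complex plane.\<close>

definition complex_of_vec :: "real^2 \<Rightarrow> complex" where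
  "complex_of_vec x = Complex (x $ 1) (x $ 2)"

definition vec_of_complex :: "complex \<Rightarrow> real^2" where
  "vec_of_complex z = vector [Re z, Im z]"

lemma complex_of_vec_of_complex [simp]: "complex_of_vec (vec_of_complex z) = z"
  by (simp add: complex_of_vec_def vec_of_complex_def)

lemma vec_of_complex_of_vec [simp]: "vec_of_complex (complex_of_vec x) = x"
  by (simp add: complex_of_vec_def vec_of_complex_def vec_eq_iff forall_2)

lemma bounded_linear_complex_of_vec: "bounded_linear complex_of_vec"
  by (intro linear_conv_bounded_linear[THEN iffD1] linearI)
     (auto simp: complex_of_vec_def complex_eq_iff)

lemma bounded_linear_vec_of_complex: "bounded_linear vec_of_complex"
  by (intro linear_conv_bounded_linear[THEN iffD1] linearI)
     (auto simp: vec_of_complex_def vec_eq_iff forall_2)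

lemma measurable_complex_of_vec [measurable]: "complex_of_vec \<in> borel \<rightarrow>\<^sub>M borel"
  by (intro borel_measurable_continuous_onI linear_continuous_on bounded_linear_complex_of_vec)

lemma lborel_eq_distr_complex_of_vec: "(lborel :: complex measure) = distr lborel borel complex_of_vec"
proof (rule lborel_eqI)
  fix l u :: complex assume le: "\<And>b. b \<in> Basis \<Longrightarrow> l \<bullet> b \<le> u \<bullet> b"
  have "Re l \<le> Re u" "Im l \<le> Im u"
    using le[of 1] le[of \<i>] by (auto simp: Basis_complex_def)
  moreover have "complex_of_vec -` box l u = box (vec_of_complex l) (vec_of_complex u)"
    by (auto simp: box_def Basis_complex_def complex_of_vec_def vec_of_complex_def Basis_vec_def
        inner_axis forall_2)
  moreover have Basis2: "(Basis :: (real^2) set) = {axis 1 1, axis 2 1}"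
    by (auto simp: Basis_vec_def UNIV_2)
  moreover have "axis 1 1 \<noteq> (axis 2 1 :: real^2)"
    by (simp add: axis_eq_axis)
  ultimately have "emeasure lborel (complex_of_vec -` box l u) = (\<Prod>b\<in>Basis. (u - l) \<bullet> b)"
    by (simp add: emeasure_lborel_box_eq inner_axis vec_of_complex_def Basis_complex_def Basis2)
  then show "emeasure (distr lborel borel complex_of_vec) (box l u) = (\<Prod>b\<in>Basis. (u - l) \<bullet> b)"
    by (simp add: emeasure_distr)
qed simp

text \<open>As a real map, a holomorphic \<open>\<phi>\<close> acts on tangent vectors by multiplication by \<open>deriv \<phi>\<close>, and
multiplication by \<open>d\<close> has determinant \<open>\<bar>d\<bar>\<^sup>2\<close>.\<close>

lemma emeasure_holomorphic_image:
  assumes S: "open S" and holo: "\<phi> holomorphic_on S" and inj: "inj_on \<phi> S"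
    and fin: "emeasure lborel (\<phi> ` S) < \<infinity>" and B: "B \<in> sets borel"
  shows "emeasure lborel (B \<inter> \<phi> ` S) =
           (\<integral>\<^sup>+z. ennreal (indicator S z * (norm (deriv \<phi> z))\<^sup>2) * indicator B (\<phi> z) \<partial>lborel)"
proof -
  have cont: "continuous_on S \<phi>" by (rule holomorphic_on_imp_continuous_on[OF holo])
  have "\<phi> -` B \<inter> S \<in> sets borel"
    using S borel_measurable_continuous_on_restrict[OF cont] B
    by (auto simp: measurable_def space_restrict_space sets_restrict_space_iff)
  define A where "A = \<phi> -` B \<inter> S"
  have A: "A \<in> sets borel" unfolding A_def by fact
  have img: "\<phi> ` A = B \<inter> \<phi> ` S" by (auto simp: A_def)
  have "open (\<phi> ` S)"
    using open_mapping_thm3[OF holo S inj] .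
  then have BS: "B \<inter> \<phi> ` S \<in> sets borel" using B by auto
  have finB: "emeasure lborel (B \<inter> \<phi> ` S) < \<infinity>"
    using fin by (rule le_less_trans[rotated]) (rule emeasure_mono, use \<open>open (\<phi> ` S)\<close> in auto)
  define \<psi> where "\<psi> = vec_of_complex \<circ> \<phi> \<circ> complex_of_vec"
  define A2 where "A2 = complex_of_vec -` A"
  have A2: "A2 \<in> sets borel"
    using measurable_sets[OF measurable_complex_of_vec A] by (simp add: A2_def)
  define \<psi>' where "\<psi>' = (\<lambda>x v. vec_of_complex (deriv \<phi> (complex_of_vec x) * complex_of_vec v))"
  have der: "(\<psi> has_derivative \<psi>' x) (at x within A2)" if "x \<in> A2" for x
  proof -
    have "complex_of_vec x \<in> S" using that by (auto simp: A2_def A_def)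
    then have "(\<phi> has_field_derivative deriv \<phi> (complex_of_vec x)) (at (complex_of_vec x))"
      using S holo holomorphic_derivI by blast
    then have "(\<phi> has_derivative (*) (deriv \<phi> (complex_of_vec x))) (at (complex_of_vec x))"
      by (simp add: has_field_derivative_def)
    moreover have "(complex_of_vec has_derivative complex_of_vec) (at x)"
      by (rule bounded_linear_imp_has_derivative[OF bounded_linear_complex_of_vec])
    moreover have "(vec_of_complex has_derivative vec_of_complex) (at (\<phi> (complex_of_vec x)))"
      by (rule bounded_linear_imp_has_derivative[OF bounded_linear_vec_of_complex])
    ultimately have "(\<psi> has_derivative vec_of_complex \<circ> ((*) (deriv \<phi> (complex_of_vec x)) \<circ> complex_of_vec)) (at x)"
      unfolding \<psi>_def o_assoc[symmetric] by (intro diff_chain_at) (auto simp: o_def)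
    then show ?thesis
      by (auto simp: \<psi>'_def o_def intro: has_derivative_at_withinI)
  qed
  have det: "\<bar>det (matrix (\<psi>' x))\<bar> = (norm (deriv \<phi> (complex_of_vec x)))\<^sup>2" for x
    by (simp add: det_2 matrix_def \<psi>'_def vec_of_complex_def complex_of_vec_def axis_def cmod_power2)
       (simp add: power2_eq_square)
  have inj2: "inj_on \<psi> A2"
    using inj by (auto simp: inj_on_def \<psi>_def A2_def A_def)
      (metis complex_of_vec_of_complex vec_of_complex_of_vec)+
  have img2: "\<psi> ` A2 = complex_of_vec -` (B \<inter> \<phi> ` S)"
  proof -
    have "\<psi> ` A2 = vec_of_complex ` \<phi> ` A"
      unfolding \<psi>_def A2_def by (metis (no_types, lifting) complex_of_vec_of_complex image_comp surjI surj_image_vimage_eq)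
    also have "\<dots> = complex_of_vec -` (\<phi> ` A)"
      by (force simp: image_iff intro: vec_of_complex_of_vec[symmetric])
    finally show ?thesis using img by simp
  qed
  have em: "emeasure lborel (\<psi> ` A2) = emeasure lborel (B \<inter> \<phi> ` S)"
    unfolding img2 using BS
    by (subst lborel_eq_distr_complex_of_vec) (simp add: emeasure_distr)
  have bor: "\<psi> ` A2 \<in> sets borel"
    unfolding img2 using measurable_sets[OF measurable_complex_of_vec BS] by simp
  have "((\<lambda>x. \<bar>det (matrix (\<psi>' x))\<bar>) has_integral measure lebesgue (\<psi> ` A2)) A2"
    using bor em finB
    by (subst has_measure_differentiable_image[symmetric, OF _ der inj2])
       (auto simp: fmeasurable_def A2)
  then have "(\<integral>\<^sup>+x. indicator A2 x * ennreal ((norm (deriv \<phi> (complex_of_vec x)))\<^sup>2) \<partial>lborel) = ennreal (measure lebesgue (\<psi> ` A2))"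
    unfolding det
    by (subst nn_integral_has_integral_lebesgue[symmetric, rotated]) (auto simp: ennreal_mult' ennreal_indicator)
  also have "\<dots> = emeasure lborel (B \<inter> \<phi> ` S)"
    using em finB bor emeasure_eq_ennreal_measure[of lborel "\<psi> ` A2"]
    by (simp add: measure_completion)
  also have "(\<integral>\<^sup>+x. indicator A2 x * ennreal ((norm (deriv \<phi> (complex_of_vec x)))\<^sup>2) \<partial>lborel) = 
     (\<integral>\<^sup>+x. (\<lambda>z. indicator A z * ennreal ((norm (deriv \<phi> z))\<^sup>2)) (complex_of_vec x) \<partial>lborel)"
    by (intro nn_integral_cong) (auto simp: A2_def indicator_def)
  also have "\<dots> = (\<integral>\<^sup>+z. indicator A z * ennreal ((norm (deriv \<phi> z))\<^sup>2) \<partial>lborel)"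
  proof -
    have "deriv \<phi> holomorphic_on S" using holo S by (rule holomorphic_deriv)
    then have "continuous_on S (deriv \<phi>)" by (rule holomorphic_on_imp_continuous_on)
    then have "(\<lambda>z. indicator S z *\<^sub>R deriv \<phi> z) \<in> borel_measurable borel"
      using S by (intro borel_measurable_continuous_on_indicator) auto
    moreover define D where "D = (\<lambda>z. indicator S z *\<^sub>R deriv \<phi> z)"
    ultimately have [measurable]: "D \<in> borel_measurable borel" "A \<in> sets borel"
      using A by simp_all
    have "indicator A z * ennreal ((norm (deriv \<phi> z))\<^sup>2) = indicator A z * ennreal ((norm (D z))\<^sup>2)" for z
      by (auto simp: A_def D_def indicator_def)
    then show ?thesis
      by (simp, subst lborel_eq_distr_complex_of_vec) (simp add: nn_integral_distr)
  qed
  finally show ?thesis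
    by (auto simp: A_def indicator_def intro!: nn_integral_cong elim!: trans[OF sym])
qed

text \<open>By the previous lemma, the push-forward of the measure with density \<open>\<bar>deriv \<phi>\<bar>\<^sup>2\<close> is Lebesgue measure
on the image, and integration with respect to a push-forward is composition.\<close>

lemma holomorphic_change_of_variables:
  fixes H :: "complex \<Rightarrow> 'b::{banach, second_countable_topology}"
  assumes S: "open S" and holo: "\<phi> holomorphic_on S" and inj: "inj_on \<phi> S"
    and fin: "emeasure lborel (\<phi> ` S) < \<infinity>" and [measurable]: "H \<in> borel_measurable borel"
  shows "set_integrable lborel S (\<lambda>z. (norm (deriv \<phi> z))\<^sup>2 *\<^sub>R H (\<phi> z)) \<longleftrightarrow> set_integrable lborel (\<phi> ` S) H"
    and "(LINT z:S|lborel. (norm (deriv \<phi> z))\<^sup>2 *\<^sub>R H (\<phi> z)) = (LINT w:\<phi> ` S|lborel. H w)"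
proof -
  define \<Phi> where "\<Phi> = (\<lambda>z. indicator S z *\<^sub>R \<phi> z)"
  define D where "D = (\<lambda>z. indicator S z *\<^sub>R deriv \<phi> z)"
  have "open (\<phi> ` S)"
    using open_mapping_thm3[OF holo S inj] .
  then have [measurable]: "\<phi> ` S \<in> sets borel" by simp
  have "continuous_on S (deriv \<phi>)"
    by (rule holomorphic_on_imp_continuous_on) (rule holomorphic_deriv[OF holo S])
  then have [measurable]: "D \<in> borel_measurable borel"
    unfolding D_def using S by (intro borel_measurable_continuous_on_indicator) auto
  have [measurable]: "\<Phi> \<in> borel_measurable borel"
    unfolding \<Phi>_def using S holomorphic_on_imp_continuous_on[OF holo]
    by (intro borel_measurable_continuous_on_indicator) auto
  have eq: "distr (density lborel (\<lambda>z. ennreal ((norm (D z))\<^sup>2))) borel \<Phi> =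
        density lborel (\<lambda>w. ennreal (indicator (\<phi> ` S) w))" (is "?M1 = ?M2")
  proof (rule measure_eqI)
    fix B assume "B \<in> sets ?M1"
    then have [measurable]: "B \<in> sets borel" by simp
    have "emeasure ?M1 B = (\<integral>\<^sup>+z. ennreal ((norm (D z))\<^sup>2) * indicator B (\<Phi> z) \<partial>lborel)"
      by (subst nn_integral_indicator[symmetric], simp, subst nn_integral_distr, simp, simp,
          subst nn_integral_density) auto
    also have "\<dots> = (\<integral>\<^sup>+z. ennreal (indicator S z * (norm (deriv \<phi> z))\<^sup>2) * indicator B (\<phi> z) \<partial>lborel)"
      by (intro nn_integral_cong) (auto simp: D_def \<Phi>_def indicator_def)
    also have "\<dots> = emeasure lborel (B \<inter> \<phi> ` S)"
      using emeasure_holomorphic_image[OF S holo inj fin, of B] by simp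
    also have "\<dots> = (\<integral>\<^sup>+w. indicator (B \<inter> \<phi> ` S) w \<partial>lborel)"
      by (rule nn_integral_indicator[symmetric]) simp
    also have "\<dots> = (\<integral>\<^sup>+w. ennreal (indicator (\<phi> ` S) w) * indicator B w \<partial>lborel)"
      by (intro nn_integral_cong) (auto split: split_indicator)
    also have "\<dots> = emeasure ?M2 B"
      by (rule emeasure_density[symmetric]) auto
    finally show "emeasure ?M1 B = emeasure ?M2 B" .
  qed simp
  let ?G = "\<lambda>z. (norm (D z))\<^sup>2 *\<^sub>R H (\<Phi> z)"
  have G: "?G = (\<lambda>z. indicator S z *\<^sub>R (norm (deriv \<phi> z))\<^sup>2 *\<^sub>R H (\<phi> z))"
    by (auto simp: D_def \<Phi>_def indicator_def)
  have "integrable ?M1 H \<longleftrightarrow> integrable (density lborel (\<lambda>z. ennreal ((norm (D z))\<^sup>2))) (\<lambda>z. H (\<Phi> z))"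
    by (rule integrable_distr_eq) auto
  also have "\<dots> \<longleftrightarrow> integrable lborel ?G"
    by (rule integrable_density) auto
  finally have 1: "integrable ?M1 H \<longleftrightarrow> set_integrable lborel S (\<lambda>z. (norm (deriv \<phi> z))\<^sup>2 *\<^sub>R H (\<phi> z))"
    unfolding set_integrable_def G .
  have "integral\<^sup>L ?M1 H = (\<integral>z. H (\<Phi> z) \<partial>density lborel (\<lambda>z. ennreal ((norm (D z))\<^sup>2)))"
    by (rule integral_distr) auto
  also have "\<dots> = integral\<^sup>L lborel ?G"
    by (rule integral_density) auto
  finally have 2: "integral\<^sup>L ?M1 H = (LINT z:S|lborel. (norm (deriv \<phi> z))\<^sup>2 *\<^sub>R H (\<phi> z))"
    unfolding set_lebesgue_integral_def G .
  have 3: "integrable ?M2 H \<longleftrightarrow> set_integrable lborel (\<phi> ` S) H"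
    by (subst integrable_density) (auto simp: set_integrable_def)
  have 4: "integral\<^sup>L ?M2 H = (LINT w:\<phi> ` S|lborel. H w)"
    by (subst integral_density) (auto simp: set_lebesgue_integral_def)
  show "set_integrable lborel S (\<lambda>z. (norm (deriv \<phi> z))\<^sup>2 *\<^sub>R H (\<phi> z)) \<longleftrightarrow> set_integrable lborel (\<phi> ` S) H"
    using 1 3 eq by simp
  show "(LINT z:S|lborel. (norm (deriv \<phi> z))\<^sup>2 *\<^sub>R H (\<phi> z)) = (LINT w:\<phi> ` S|lborel. H w)"
    using 2 4 eq by simp
qed

section \<open>Disc automorphisms and rotation-invariant integrals\<close>

lemma one_minus_cnj_mult_nonzero:
  assumes "norm z0 < 1" "norm w \<le> 1"
  shows "1 - cnj z0 * w \<noteq> 0"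
proof
  assume "1 - cnj z0 * w = 0"
  then have "norm (cnj z0 * w) = 1" by simp
  moreover have "norm z0 * norm w < 1"
    using assms by (metis mult_left_le norm_ge_zero order_le_less_trans)
  ultimately show False by (simp add: norm_mult)
qed

text \<open>This rests on \<open>\<bar>1 - cnj z0 w\<bar>\<^sup>2 - \<bar>z0 - w\<bar>\<^sup>2 = (1 - \<bar>z0\<bar>\<^sup>2) (1 - \<bar>w\<bar>\<^sup>2)\<close>. The right-hand side is the
Poisson kernel, extended inside the disc, times \<open>1 - \<bar>w\<bar>\<^sup>2\<close>.\<close>

lemma one_minus_norm_disc_aut:
  assumes "norm z0 < 1" "norm w \<le> 1"
  shows "1 - (norm (disc_aut z0 w))\<^sup>2 = (1 - (norm z0)\<^sup>2) * (1 - (norm w)\<^sup>2) / (norm (1 - cnj z0 * w))\<^sup>2"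
proof -
  have "(norm (1 - cnj z0 * w))\<^sup>2 - (norm (z0 - w))\<^sup>2 = (1 - (norm z0)\<^sup>2) * (1 - (norm w)\<^sup>2)"
    unfolding cmod_power2 by (simp add: algebra_simps power2_eq_square)
  then show ?thesis
    using one_minus_cnj_mult_nonzero[OF assms]
    by (simp add: disc_aut_def norm_divide field_simps)
qed

lemma norm_disc_aut_le:
  assumes "norm z0 < 1" "norm w \<le> 1"
  shows "norm (disc_aut z0 w) \<le> 1"
proof -
  have "0 \<le> 1 - (norm (disc_aut z0 w))\<^sup>2"
    unfolding one_minus_norm_disc_aut[OF assms] using assms by (simp add: power_le_one)
  then show ?thesis using power2_le_imp_le[of "norm (disc_aut z0 w)" 1] by simp
qed

lemma norm_disc_aut_less:
  assumes "norm z0 < 1" "norm w < 1"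
  shows "norm (disc_aut z0 w) < 1"
proof -
  have "0 < 1 - (norm (disc_aut z0 w))\<^sup>2"
    using assms one_minus_cnj_mult_nonzero[of z0 w]
    by (subst one_minus_norm_disc_aut) (auto simp: power_less_one_iff)
  then show ?thesis using power2_less_imp_less[of "norm (disc_aut z0 w)" 1] by simp
qed

lemma disc_aut_disc_aut:
  assumes "norm z0 < 1" "norm w \<le> 1"
  shows "disc_aut z0 (disc_aut z0 w) = w"
proof -
  have nz: "1 - cnj z0 * w \<noteq> 0" using one_minus_cnj_mult_nonzero[OF assms] .
  have nz': "1 - cnj z0 * z0 \<noteq> 0"
    using one_minus_cnj_mult_nonzero[OF assms(1), of z0] assms(1) by simp
  have "z0 - (z0 - w) / (1 - cnj z0 * w) = w * (1 - cnj z0 * z0) / (1 - cnj z0 * w)"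
    using nz by (simp add: field_simps)
  moreover have "1 - cnj z0 * ((z0 - w) / (1 - cnj z0 * w)) = (1 - cnj z0 * z0) / (1 - cnj z0 * w)"
    using nz by (simp add: field_simps)
  ultimately show ?thesis
    using nz nz' unfolding disc_aut_def by simp
qed

lemma holomorphic_on_disc_aut:
  assumes "norm z0 < 1"
  shows "disc_aut z0 holomorphic_on {w. 1 - cnj z0 * w \<noteq> 0}"
  unfolding disc_aut_def by (intro holomorphic_intros) auto

lemma inj_on_disc_aut: "norm z0 < 1 \<Longrightarrow> inj_on (disc_aut z0) (cball 0 1)"
  by (rule inj_on_inverseI[of _ "disc_aut z0"]) (simp add: disc_aut_disc_aut)

lemma disc_aut_image_ball: "norm z0 < 1 \<Longrightarrow> disc_aut z0 ` ball 0 1 = ball 0 1"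
proof (intro equalityI subsetI)
  fix w assume "norm z0 < 1" "w \<in> ball (0::complex) 1"
  then show "w \<in> disc_aut z0 ` ball 0 1"
    using norm_disc_aut_less[of z0 w] disc_aut_disc_aut[of z0 w]
    by (intro image_eqI[of _ _ "disc_aut z0 w"]) auto
qed (auto simp: norm_disc_aut_less)

lemma open_disc_aut_domain: "open {w. 1 - cnj z0 * w \<noteq> 0}"
  by (intro open_Collect_neq continuous_intros)

lemma disc_aut_change_of_variables:
  fixes H :: "complex \<Rightarrow> 'b::{banach, second_countable_topology}"
  assumes z0: "norm z0 < 1" and "H \<in> borel_measurable borel"
  shows "set_integrable lborel (ball 0 1) (\<lambda>z. (norm (deriv (disc_aut z0) z))\<^sup>2 *\<^sub>R H (disc_aut z0 z)) \<longleftrightarrow>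
           set_integrable lborel (ball 0 1) H"
    and "(LINT z:ball 0 1|lborel. (norm (deriv (disc_aut z0) z))\<^sup>2 *\<^sub>R H (disc_aut z0 z)) =
           (LINT w:ball 0 1|lborel. H w)"
proof -
  have *: "disc_aut z0 holomorphic_on ball 0 1"
    by (rule holomorphic_on_subset[OF holomorphic_on_disc_aut[OF z0]])
       (use one_minus_cnj_mult_nonzero[OF z0] in auto)
  have "emeasure lborel (disc_aut z0 ` ball 0 1) < \<infinity>"
    unfolding disc_aut_image_ball[OF z0] by (rule emeasure_lborel_ball_finite)
  note cov = holomorphic_change_of_variables[OF open_ball * inj_on_subset[OF inj_on_disc_aut[OF z0] ball_subset_cball] this assms(2)]
  from cov[unfolded disc_aut_image_ball[OF z0]]
  show "set_integrable lborel (ball 0 1) (\<lambda>z. (norm (deriv (disc_aut z0) z))\<^sup>2 *\<^sub>R H (disc_aut z0 z)) \<longleftrightarrow>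
           set_integrable lborel (ball 0 1) H"
    and "(LINT z:ball 0 1|lborel. (norm (deriv (disc_aut z0) z))\<^sup>2 *\<^sub>R H (disc_aut z0 z)) =
           (LINT w:ball 0 1|lborel. H w)" by auto
qed

lemma rotation_change_of_variables:
  fixes H :: "complex \<Rightarrow> 'b::{banach, second_countable_topology}"
  assumes "norm c = 1" and "H \<in> borel_measurable borel"
  shows "(LINT z:ball 0 1|lborel. H (c * z)) = (LINT w:ball 0 1|lborel. H w)"
proof -
  have c: "c \<noteq> 0" using assms(1) by auto
  have img: "(*) c ` ball 0 1 = ball 0 1"
  proof (intro equalityI subsetI)
    fix w :: complex assume "w \<in> ball 0 1"
    then show "w \<in> (*) c ` ball 0 1"
      using assms(1) c by (intro image_eqI[of _ _ "w / c"]) (auto simp: norm_divide)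
  qed (use assms in \<open>auto simp: norm_mult\<close>)
  have d: "deriv ((*) c) z = c" for z :: complex
    by (rule DERIV_imp_deriv) (auto intro!: derivative_eq_intros)
  have "emeasure lborel ((*) c ` ball 0 1) < \<infinity>"
    unfolding img by (rule emeasure_lborel_ball_finite)
  note holomorphic_change_of_variables(2)[OF open_ball _ _ this assms(2), unfolded img]
  then show ?thesis
    using c assms(1) by (simp add: d inj_on_def holomorphic_intros)
qed

lemma borel_measurable_cnj [measurable (raw)]:
  "f \<in> borel_measurable M \<Longrightarrow> (\<lambda>x. cnj (f x)) \<in> borel_measurable M"
  by (rule measurable_compose[OF _ borel_measurable_continuous_onI]) (auto intro: continuous_intros)

text \<open>A rotation by \<open>\<pi> / (n - m)\<close> changes the sign of \<open>w\<^sup>n cnj w\<^sup>m\<close> and preserves everything else.\<close>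

lemma LINT_disc_rotation_orthogonal:
  fixes \<rho> :: "complex \<Rightarrow> real"
  assumes [measurable]: "\<rho> \<in> borel_measurable borel" and rot: "\<And>c w. norm c = 1 \<Longrightarrow> \<rho> (c * w) = \<rho> w"
    and "n \<noteq> m"
  shows "(LINT w:ball 0 1|lborel. of_real (\<rho> w) * (w ^ n * cnj w ^ m)) = 0"
proof -
  define c where "c = cis (pi / (real n - real m))"
  have c1: "norm c = 1" by (simp add: c_def)
  let ?H = "\<lambda>w. of_real (\<rho> w) * (w ^ n * cnj w ^ m)"
  have "c ^ n * cnj c ^ m = cis (pi / (real n - real m) * (real n - real m))"
    unfolding c_def cis_cnj Complex.DeMoivre cis_mult by (rule arg_cong[of _ _ cis]) (simp only: algebra_simps)
  also have "\<dots> = -1" using \<open>n \<noteq> m\<close> by simp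
  finally have c: "c ^ n * cnj c ^ m = -1" .
  have "?H (c * w) = - ?H w" for w
  proof -
    have "?H (c * w) = of_real (\<rho> w) * (w ^ n * cnj w ^ m) * (c ^ n * cnj c ^ m)"
      using rot[of c w] by (simp add: c1 power_mult_distrib mult_ac)
    then show ?thesis using c by simp
  qed
  moreover have "(LINT w:ball 0 1|lborel. ?H (c * w)) = (LINT w:ball 0 1|lborel. ?H w)"
    by (rule rotation_change_of_variables[OF c1]) measurable
  ultimately have "(LINT w:ball 0 1|lborel. - ?H w) = (LINT w:ball 0 1|lborel. ?H w)" by simp
  then show ?thesis
    unfolding set_lebesgue_integral_def by simp
qed

lemma emeasure_disc_annulus:
  "emeasure lborel {w::complex. norm w < 1 \<and> x < (norm w)\<^sup>2} = ennreal (pi * (1 - min 1 (max 0 x)))"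
proof -
  consider "x < 0" | "0 \<le> x" "x < 1" | "1 \<le> x" by linarith
  then show ?thesis
  proof cases
    case 1
    then have "x < (norm w)\<^sup>2" for w :: complex
      by (rule less_le_trans) simp
    then have "{w::complex. norm w < 1 \<and> x < (norm w)\<^sup>2} = ball 0 1"
      by (simp add: set_eq_iff)
    then show ?thesis using 1 by (simp add: emeasure_ball unit_ball_vol_2)
  next
    case 2
    then have "x < (norm w)\<^sup>2 \<longleftrightarrow> \<not> norm w \<le> sqrt x" for w :: complex
      by (metis norm_ge_zero not_less real_sqrt_le_iff real_sqrt_pow2 real_sqrt_power real_sqrt_unique)
    then have "{w::complex. norm w < 1 \<and> x < (norm w)\<^sup>2} = ball 0 1 - cball 0 (sqrt x)"
      by (simp add: set_eq_iff)
    also have "emeasure lborel (ball 0 1 - cball (0::complex) (sqrt x)) =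
       emeasure lborel (ball (0::complex) 1) - emeasure lborel (cball (0::complex) (sqrt x))"
    proof (rule emeasure_Diff)
      have "sqrt x < 1" using 2 by simp
      then show "cball 0 (sqrt x) \<subseteq> ball (0::complex) 1"
        by (intro subsetI) (simp only: mem_cball_0 mem_ball_0 order_le_less_trans)
    qed (use 2 in \<open>auto simp: emeasure_cball\<close>)
    also have "\<dots> = ennreal (pi * (1 - x))"
      using 2 by (simp add: emeasure_ball emeasure_cball unit_ball_vol_2 ennreal_minus algebra_simps)
    finally show ?thesis using 2 by simp
  next
    case 3
    then have "\<not> x < (norm w)\<^sup>2" if "norm w < 1" for w :: complex
      using power_le_one[of "norm w" 2] that by simp
    then have "{w::complex. norm w < 1 \<and> x < (norm w)\<^sup>2} = {}"
      by auto
    then show ?thesis using 3 by (simp only: emeasure_empty) simp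
  qed
qed

text \<open>In place of polar coordinates: the disc of radius \<open>\<surd>x\<close> has area \<open>\<pi> x\<close>, so \<open>\<bar>w\<bar>\<^sup>2\<close> is distributed as
\<open>\<pi>\<close> times the uniform measure on the unit interval.\<close>

lemma distr_norm_power2_disc:
  "distr (density lborel (indicator (ball (0::complex) 1))) borel (\<lambda>w. (norm w)\<^sup>2) =
     density lborel (\<lambda>t. ennreal (pi * indicator {0<..<1} t))" (is "?M = ?N")
proof (rule measure_eqI_lessThan)
  have M: "emeasure ?M {x<..} = ennreal (pi * (1 - min 1 (max 0 x)))" for x
  proof -
    have m: "(\<lambda>w::complex. (norm w)\<^sup>2) -` {x<..} \<in> sets borel" 
      using measurable_sets_borel[of "\<lambda>w::complex. (norm w)\<^sup>2" borel "{x<..}"] by simp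
    have "emeasure ?M {x<..} = emeasure (density lborel (indicator (ball (0::complex) 1))) ((\<lambda>w::complex. (norm w)\<^sup>2) -` {x<..})"
      by (subst emeasure_distr) auto
    also have "\<dots> = (\<integral>\<^sup>+w. indicator (ball 0 1) w * indicator ((\<lambda>w::complex. (norm w)\<^sup>2) -` {x<..}) w \<partial>lborel)"
      using m by (subst emeasure_density) (auto intro!: borel_measurable_indicator)
    also have "\<dots> = (\<integral>\<^sup>+w. indicator {w::complex. norm w < 1 \<and> x < (norm w)\<^sup>2} w \<partial>lborel)"
      by (intro nn_integral_cong) (auto split: split_indicator)
    also have "\<dots> = emeasure lborel {w::complex. norm w < 1 \<and> x < (norm w)\<^sup>2}"
      by (rule nn_integral_indicator) measurable
    finally show ?thesis by (simp add: emeasure_disc_annulus)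
  qed
  have N: "emeasure ?N {x<..} = ennreal (pi * (1 - min 1 (max 0 x)))" for x
  proof -
    have "emeasure ?N {x<..} = (\<integral>\<^sup>+t. ennreal pi * indicator ({0<..<1} \<inter> {x<..}) t \<partial>lborel)"
      by (subst emeasure_density) (auto intro!: nn_integral_cong split: split_indicator)
    also have "{0<..<1} \<inter> {x<..} = {max 0 x<..<1}" by auto
    also have "(\<integral>\<^sup>+t. ennreal pi * indicator {max 0 x<..<1} t \<partial>lborel) = ennreal pi * ennreal (1 - min 1 (max 0 x))"
      by (auto simp: nn_integral_cmult_indicator min_def)
    finally show ?thesis by (simp add: ennreal_mult)
  qed
  show "emeasure ?M {x<..} < \<infinity>" for x unfolding M by simp
  show "emeasure ?M {x<..} = emeasure ?N {x<..}" for x unfolding M N ..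
qed simp_all

lemma
  fixes F :: "real \<Rightarrow> 'b::{banach, second_countable_topology}"
  assumes [measurable]: "F \<in> borel_measurable borel"
  shows LINT_disc_radial: "(LINT w:ball (0::complex) 1|lborel. F ((norm w)\<^sup>2)) = pi *\<^sub>R (LINT t:{0<..<1}|lborel. F t)"
    and set_integrable_disc_radial:
      "set_integrable lborel (ball (0::complex) 1) (\<lambda>w. F ((norm w)\<^sup>2)) \<longleftrightarrow> set_integrable lborel {0<..<1} F"
proof -
  let ?M = "distr (density lborel (\<lambda>w. ennreal (indicator (ball (0::complex) 1) w))) borel (\<lambda>w. (norm w)\<^sup>2)"
  let ?N = "density lborel (\<lambda>t. ennreal (pi * indicator {0<..<1} t))"
  have eq: "?M = ?N"
    using distr_norm_power2_disc by (simp add: ennreal_indicator)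
  have M: "integrable ?M F \<longleftrightarrow> set_integrable lborel (ball (0::complex) 1) (\<lambda>w. F ((norm w)\<^sup>2))"
    unfolding set_integrable_def
    by (subst integrable_distr_eq, simp, simp, subst integrable_density) (auto intro!: borel_measurable_indicator)
  have M': "integral\<^sup>L ?M F = (LINT w:ball (0::complex) 1|lborel. F ((norm w)\<^sup>2))"
    unfolding set_lebesgue_integral_def
    by (subst integral_distr, simp, simp, subst integral_density) (auto intro!: borel_measurable_indicator)
  have N: "integrable ?N F \<longleftrightarrow> set_integrable lborel {0<..<1} F"
    unfolding set_integrable_def
  proof -
    let ?G = "\<lambda>t. indicator {0<..<1} t *\<^sub>R F t"
    have "integrable ?N F \<longleftrightarrow> integrable lborel (\<lambda>t. (pi * indicator {0<..<1} t) *\<^sub>R F t)"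
      by (rule integrable_density) auto
    also have "\<dots> \<longleftrightarrow> integrable lborel (\<lambda>t. pi *\<^sub>R ?G t)" by simp
    also have "\<dots> \<longleftrightarrow> integrable lborel ?G"
    proof
      assume "integrable lborel (\<lambda>t. pi *\<^sub>R ?G t)"
      then have "integrable lborel (\<lambda>t. inverse pi *\<^sub>R pi *\<^sub>R ?G t)"
        by (rule integrable_scaleR_right)
      then show "integrable lborel ?G" by (simp add: mult.assoc[symmetric])
    qed (rule integrable_scaleR_right)
    finally show "integrable ?N F \<longleftrightarrow> integrable lborel ?G" .
  qed
  have N': "integral\<^sup>L ?N F = pi *\<^sub>R (LINT t:{0<..<1}|lborel. F t)"
    unfolding set_lebesgue_integral_def
  proof -
    have "integral\<^sup>L ?N F = (\<integral>t. (pi * indicator {0<..<1} t) *\<^sub>R F t \<partial>lborel)"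
      by (rule integral_density) auto
    also have "\<dots> = pi *\<^sub>R (\<integral>t. indicator {0<..<1} t *\<^sub>R F t \<partial>lborel)"
      by (simp only: scaleR_scaleR[symmetric] integral_scaleR_right)
    finally show "integral\<^sup>L ?N F = pi *\<^sub>R (\<integral>t. indicator {0<..<1} t *\<^sub>R F t \<partial>lborel)" .
  qed
  show "(LINT w:ball (0::complex) 1|lborel. F ((norm w)\<^sup>2)) = pi *\<^sub>R (LINT t:{0<..<1}|lborel. F t)"
    using M' N' eq by simp
  show "set_integrable lborel (ball (0::complex) 1) (\<lambda>w. F ((norm w)\<^sup>2)) \<longleftrightarrow> set_integrable lborel {0<..<1} F"
    using M N eq by simp
qed

section \<open>Moments of the disc and of the circle\<close>

text \<open>Only one-sided limits of the antiderivative are required at the end points, which admits the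
logarithmic singularity of the Green function.\<close>

lemma set_integrable_LINT_Ioo_FTC_nonneg:
  fixes f F :: "real \<Rightarrow> real"
  assumes "a < b"
    and "\<And>x. a < x \<Longrightarrow> x < b \<Longrightarrow> (F has_real_derivative f x) (at x)"
    and "\<And>x. a < x \<Longrightarrow> x < b \<Longrightarrow> isCont f x"
    and "\<And>x. a < x \<Longrightarrow> x < b \<Longrightarrow> 0 \<le> f x"
    and "(F \<longlongrightarrow> A) (at_right a)" and "(F \<longlongrightarrow> B) (at_left b)"
  shows "set_integrable lborel {a<..<b} f" and "(LINT x:{a<..<b}|lborel. f x) = B - A"
proof -
  have "((F \<circ> real_of_ereal) \<longlongrightarrow> A) (at_right (ereal a))" "((F \<circ> real_of_ereal) \<longlongrightarrow> B) (at_left (ereal b))"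
    using assms(5,6) by (simp_all add: ereal_tendsto_simps)
  note * = interval_integral_FTC_nonneg[of "ereal a" "ereal b" F f, OF _ _ _ _ this]
  show "set_integrable lborel {a<..<b} f" "(LINT x:{a<..<b}|lborel. f x) = B - A"
    using * assms by (auto simp: interval_lebesgue_integral_def)
qed

lemma LINT_unit_interval_power:
  "(LINT t:{0<..<1}|lborel. t ^ n) = 1 / real (Suc n)"
  and set_integrable_unit_interval_power: "set_integrable lborel {0<..<1::real} (\<lambda>t. t ^ n)"
proof -
  have "((\<lambda>t::real. t ^ Suc n / real (Suc n)) \<longlongrightarrow> 0 ^ Suc n / real (Suc n)) (at_right 0)"
       "((\<lambda>t::real. t ^ Suc n / real (Suc n)) \<longlongrightarrow> 1 ^ Suc n / real (Suc n)) (at_left 1)"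
    by (intro tendsto_intros; simp)+
  note * = set_integrable_LINT_Ioo_FTC_nonneg[OF zero_less_one _ _ _ this, of "\<lambda>t. t ^ n"]
  have d: "((\<lambda>t::real. t ^ Suc n / real (Suc n)) has_real_derivative t ^ n) (at t)" for t
    by (auto intro!: derivative_eq_intros simp del: of_nat_Suc power_Suc)
  show "(LINT t:{0<..<1}|lborel. t ^ n) = 1 / real (Suc n)" 
    using *(2) d by simp
  show "set_integrable lborel {0<..<1::real} (\<lambda>t. t ^ n)"
    using *(1) d by simp
qed

lemma LINT_unit_interval_ln_power:
  "(LINT t:{0<..<1}|lborel. - ln t * t ^ n) = 1 / (real (Suc n))\<^sup>2"
  and set_integrable_unit_interval_ln_power: "set_integrable lborel {0<..<1::real} (\<lambda>t. - ln t * t ^ n)"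
proof -
  let ?F = "\<lambda>t::real. t ^ Suc n / (real (Suc n))\<^sup>2 - ln t * t ^ Suc n / real (Suc n)"
  have "((\<lambda>t::real. t * ln t) \<longlongrightarrow> 0) (at_right 0)" by real_asymp
  then have "((\<lambda>t::real. t ^ Suc n / (real (Suc n))\<^sup>2 - t ^ n * (t * ln t) / real (Suc n)) \<longlongrightarrow> 0 ^ Suc n / (real (Suc n))\<^sup>2 - 0 ^ n * 0 / real (Suc n)) (at_right 0)"
    by (intro tendsto_intros) auto
  then have 0: "(?F \<longlongrightarrow> 0) (at_right 0)" by (simp add: mult_ac)
  have 1: "(?F \<longlongrightarrow> 1 ^ Suc n / (real (Suc n))\<^sup>2 - ln 1 * 1 ^ Suc n / real (Suc n)) (at_left 1)"
    by (intro tendsto_intros) auto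
  note * = set_integrable_LINT_Ioo_FTC_nonneg[OF zero_less_one _ _ _ 0 1, of "\<lambda>t. - ln t * t ^ n"]
  have d: "(?F has_real_derivative - ln t * t ^ n) (at t)" if "0 < t" for t
  proof -
    have p: "((\<lambda>t::real. t ^ Suc n) has_real_derivative real (Suc n) * t ^ n) (at t)"
      using DERIV_pow[of "Suc n" t] by simp
    have "(?F has_real_derivative real (Suc n) * t ^ n / (real (Suc n))\<^sup>2 -
        (1 / t * t ^ Suc n + real (Suc n) * t ^ n * ln t) / real (Suc n)) (at t)"
      using that by (intro DERIV_diff DERIV_cdivide DERIV_mult p DERIV_ln_divide)
    also have "real (Suc n) * t ^ n / (real (Suc n))\<^sup>2 -
        (1 / t * t ^ Suc n + real (Suc n) * t ^ n * ln t) / real (Suc n) = - ln t * t ^ n"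
      using that by (simp add: divide_simps power2_eq_square del: of_nat_Suc)
    finally show ?thesis .
  qed
  have c: "isCont (\<lambda>t. - ln t * t ^ n) t" if "0 < t" for t :: real
    using that by (intro continuous_intros) auto
  have s: "0 \<le> - ln t * t ^ n" if "0 < t" "t < 1" for t :: real
    using that by (intro mult_nonneg_nonneg) auto
  show "(LINT t:{0<..<1}|lborel. - ln t * t ^ n) = 1 / (real (Suc n))\<^sup>2"
    by (subst *(2)) (use d c s in \<open>simp_all only: power_one ln_one mult_zero_left div_0 diff_zero\<close>)
  show "set_integrable lborel {0<..<1::real} (\<lambda>t. - ln t * t ^ n)"
    by (rule *(1)) (use d c s in simp_all)
qed

lemma mult_cnj_power: "w ^ n * cnj w ^ n = of_real (((norm w)\<^sup>2) ^ n)"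
  by (metis complex_norm_square of_real_power power_mult_distrib)

lemma LINT_disc_radial_power:
  fixes \<rho> :: "real \<Rightarrow> real"
  assumes [measurable]: "\<rho> \<in> borel_measurable borel"
  shows "(LINT w:ball 0 1|lborel. of_real (\<rho> ((norm w)\<^sup>2)) * (w ^ n * cnj w ^ m)) =
           (if n = m then of_real (pi * (LINT t:{0<..<1}|lborel. \<rho> t * t ^ n)) else 0)"
proof (cases "n = m")
  case True
  have "(LINT w:ball 0 1|lborel. of_real (\<rho> ((norm w)\<^sup>2)) * (w ^ n * cnj w ^ m)) =
     (LINT w:ball (0::complex) 1|lborel. complex_of_real (\<rho> ((norm w)\<^sup>2) * ((norm w)\<^sup>2) ^ n))"
    unfolding True mult_cnj_power of_real_mult ..
  also have "\<dots> = complex_of_real (LINT w:ball (0::complex) 1|lborel. \<rho> ((norm w)\<^sup>2) * ((norm w)\<^sup>2) ^ n)"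
    by (rule set_integral_complex_of_real)
  also have "(LINT w:ball (0::complex) 1|lborel. \<rho> ((norm w)\<^sup>2) * ((norm w)\<^sup>2) ^ n) = pi * (LINT t:{0<..<1}|lborel. \<rho> t * t ^ n)"
    using LINT_disc_radial[of "\<lambda>t. \<rho> t * t ^ n"] by simp
  finally show ?thesis using True by simp
next
  case False
  then show ?thesis
    by (subst LINT_disc_rotation_orthogonal) (auto simp: norm_mult)
qed

lemma LINT_disc_power:
  "(LINT w:ball 0 1|lborel. w ^ n * cnj w ^ m) = (if n = m then of_real (pi / Suc n) else 0)"
  using LINT_disc_radial_power[of "\<lambda>_. 1" n m] by (simp add: LINT_unit_interval_power)

lemma LINT_disc_weight_power:
  "(LINT w:ball 0 1|lborel. of_real (1 - (norm w)\<^sup>2) * (w ^ n * cnj w ^ m)) =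
     (if n = m then of_real (pi / (Suc n * Suc (Suc n))) else 0)"
proof -
  have "(LINT t:{0<..<1::real}|lborel. (1 - t) * t ^ n) = (LINT t:{0<..<1::real}|lborel. t ^ n - t ^ Suc n)"
    by (simp add: algebra_simps)
  also have "\<dots> = 1 / real (Suc n) - 1 / real (Suc (Suc n))"
    by (subst set_integral_diff(2)) (simp_all only: LINT_unit_interval_power set_integrable_unit_interval_power)
  also have "\<dots> = 1 / (real (Suc n) * real (Suc (Suc n)))"
    by (simp add: field_simps)
  finally have *: "(LINT t:{0<..<1::real}|lborel. (1 - t) * t ^ n) = 1 / (real (Suc n) * real (Suc (Suc n)))" .
  show ?thesis
    by (subst LINT_disc_radial_power, measurable) (simp only: * of_nat_mult times_divide_eq_right mult_1_right)
qed

text \<open>In this form \<open>green 0\<close> is a function of \<open>\<bar>w\<bar>\<^sup>2\<close> everywhere, including \<open>w = 0\<close>, where both sides are \<open>0\<close>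
because \<open>ln 0 = 0\<close>.\<close>

lemma green_0: "green 0 w = - (ln ((norm w)\<^sup>2)) / 2"
  by (cases "w = 0") (simp_all add: green_def disc_aut_def ln_realpow)

lemma LINT_disc_green_power:
  "(LINT w:ball 0 1|lborel. of_real (green 0 w) * (w ^ n * cnj w ^ m)) =
     (if n = m then of_real (pi / (2 * (Suc n)\<^sup>2)) else 0)"
proof -
  have "(LINT t:{0<..<1::real}|lborel. - ln t / 2 * t ^ n) = (LINT t:{0<..<1}|lborel. (- ln t * t ^ n) / (2::real))"
    by simp
  also have "\<dots> = 1 / (2 * (real (Suc n))\<^sup>2)"
    by (simp only: set_integral_divide_zero LINT_unit_interval_ln_power) (simp add: field_simps)
  finally have *: "(LINT t:{0<..<1::real}|lborel. - ln t / 2 * t ^ n) = 1 / (2 * (real (Suc n))\<^sup>2)" .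
  show ?thesis
    unfolding green_0
    by (subst LINT_disc_radial_power[of "\<lambda>t. - ln t / 2"], measurable)
       (simp only: * of_nat_mult of_nat_numeral times_divide_eq_right mult_1_right of_nat_power)
qed

lemma set_integrable_green_0: "set_integrable lborel (ball 0 1) (green 0)"
proof -
  have "set_integrable lborel {0<..<1::real} (\<lambda>t. - ln t / 2)"
    using set_integrable_unit_interval_ln_power[of 0] by (simp add: set_integrable_def)
  then show ?thesis
    using set_integrable_disc_radial[of "\<lambda>t. - ln t / 2"]
    unfolding green_0[abs_def] by simp
qed

lemma measurable_cis_arclength:
  "cis \<in> uniform_measure lborel {0..<2 * pi} \<rightarrow>\<^sub>M restrict_space borel (sphere 0 1)"
  using borel_measurable_continuous_onI[of cis, OF continuous_on_cis[OF continuous_on_id]]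
  by (intro measurable_restrict_space2) (auto simp: measurable_def)

lemma sets_arclength [simp]: "sets arclength = sets (restrict_space borel (sphere 0 1))"
  by (simp add: arclength_def)

interpretation arclength: finite_measure arclength
  by standard (use emeasure_arclength_sphere in simp)

lemma measure_arclength_sphere [simp]: "measure arclength (sphere 0 1) = 1"
  by (simp add: measure_def emeasure_arclength_sphere)

lemma borel_measurable_arclength_continuous:
  "continuous_on (sphere 0 1) f \<Longrightarrow> f \<in> borel_measurable arclength"
  using borel_measurable_continuous_on_restrict[of "sphere 0 1" f] 
  by (simp add: measurable_def space_restrict_space)

lemma integral_arclength:
  fixes f :: "complex \<Rightarrow> 'b::{banach, second_countable_topology}"
  assumes "continuous_on (sphere 0 1) f"
  shows "(LINT w|arclength. f w) = (1 / (2 * pi)) *\<^sub>R (LINT t:{0..2 * pi}|lborel. f (cis t))"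
proof -
  have m: "f \<in> borel_measurable (restrict_space borel (sphere 0 1))"
    by (rule borel_measurable_continuous_on_restrict[OF assms])
  have [measurable]: "(\<lambda>t. f (cis t)) \<in> borel_measurable borel"
    by (rule borel_measurable_continuous_onI, rule continuous_on_compose2[OF assms])
       (auto intro: continuous_intros)
  have "emeasure lborel {0..<2 * pi} = ennreal (2 * pi)" by simp
  then have u: "uniform_measure lborel {0..<2 * pi} = density lborel (\<lambda>t. ennreal (indicator {0..<2 * pi} t / (2 * pi)))"
    unfolding uniform_measure_def
    by (intro density_cong) (auto simp: divide_ennreal simp flip: ennreal_indicator)
  have "(LINT w|arclength. f w) = (LINT t|uniform_measure lborel {0..<2 * pi}. f (cis t))"
    unfolding arclength_def by (rule integral_distr[OF measurable_cis_arclength m])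
  also have "\<dots> = (LINT t|lborel. (indicator {0..<2 * pi} t / (2 * pi)) *\<^sub>R f (cis t))"
    unfolding u by (rule integral_density) auto
  also have "\<dots> = (LINT t|lborel. (1 / (2 * pi)) *\<^sub>R (indicator {0..2 * pi} t *\<^sub>R f (cis t)))"
    by (rule integral_cong_AE, simp, simp)
       (use AE_lborel_singleton[of "2 * pi"] in eventually_elim, auto split: split_indicator)
  also have "\<dots> = (1 / (2 * pi)) *\<^sub>R (LINT t:{0..2 * pi}|lborel. f (cis t))"
    unfolding set_lebesgue_integral_def by (rule integral_scaleR_right)
  finally show ?thesis .
qed

lemma integral_arclength_power:
  "(LINT w|arclength. w ^ n * cnj w ^ m) = (if n = m then 1 else 0)"
proof -
  have "(LINT w|arclength. w ^ n * cnj w ^ m) =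
      (1 / (2 * pi)) *\<^sub>R (LINT t:{0..2 * pi}|lborel. cis ((real n - real m) * t))"
    by (subst integral_arclength)
       (auto intro!: continuous_intros simp: Complex.DeMoivre cis_cnj cis_mult algebra_simps)
  also have "\<dots> = (if n = m then 1 else 0)"
  proof (cases "n = m")
    case False
    let ?k = "real n - real m"
    have "((\<lambda>t. cis (?k * t) / (\<i> * ?k)) has_vector_derivative cis (?k * t)) (at t within {0..2 * pi})" for t
    proof -
      have "((\<lambda>t. cis (?k * t)) has_vector_derivative ?k *\<^sub>R (\<i> * cis (?k * t))) (at t within {0..2 * pi})"
        unfolding has_vector_derivative_def by (auto intro!: derivative_eq_intros simp: mult_ac)
      then have "((\<lambda>t. cis (?k * t) / (\<i> * ?k)) has_vector_derivative (?k *\<^sub>R (\<i> * cis (?k * t))) / (\<i> * ?k)) (at t within {0..2 * pi})"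
        by (rule bounded_linear.has_vector_derivative[OF bounded_linear_divide])
      then show ?thesis using False by (simp add: scaleR_conv_of_real)
    qed
    then have "(LINT t:{0..2 * pi}|lborel. cis (?k * t)) = cis (?k * (2 * pi)) / (\<i> * ?k) - cis (?k * 0) / (\<i> * ?k)"
      unfolding set_lebesgue_integral_def
      by (intro integral_FTC_Icc) (auto intro!: continuous_intros)
    also have "cis (?k * (2 * pi)) = 1"
      using cis_multiple_2pi[of "real n - real m"] by (simp add: mult_ac Ints_diff)
    finally show ?thesis using False by simp
  qed (simp add: set_lebesgue_integral_def)
  finally show ?thesis .
qed

section \<open>A Littlewood-Paley identity on the disc\<close>

text \<open>Convergence and domination are asked for on the whole of \<open>A\<close>; measurability of the limit is then
automatic.\<close>

lemma set_integral_dominated_convergence: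
  fixes s :: "nat \<Rightarrow> 'a \<Rightarrow> 'b::{banach, second_countable_topology}"
  assumes meas: "\<And>n. set_borel_measurable M A (s n)"
    and lim: "\<And>x. x \<in> A \<Longrightarrow> (\<lambda>n. s n x) \<longlonglongrightarrow> s' x"
    and w: "set_integrable M A w" and bound: "\<And>n x. x \<in> A \<Longrightarrow> norm (s n x) \<le> w x"
  shows "set_integrable M A s'" and "\<And>n. set_integrable M A (s n)"
    and "(\<lambda>n. LINT x:A|M. s n x) \<longlonglongrightarrow> (LINT x:A|M. s' x)"
proof -
  have lim': "(\<lambda>n. indicator A x *\<^sub>R s n x) \<longlonglongrightarrow> indicator A x *\<^sub>R s' x" for x
    by (cases "x \<in> A") (auto intro: lim)
  have m: "(\<lambda>x. indicator A x *\<^sub>R s n x) \<in> borel_measurable M" for n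
    using meas by (simp add: set_borel_measurable_def)
  have m': "(\<lambda>x. indicator A x *\<^sub>R s' x) \<in> borel_measurable M"
    by (rule borel_measurable_LIMSEQ_metric[OF m lim'])
  have b: "norm (indicator A x *\<^sub>R s n x) \<le> indicator A x *\<^sub>R w x" for n x
    by (cases "x \<in> A") (auto intro: bound)
  note prems = m' m w[unfolded set_integrable_def] AE_I2[OF lim'] AE_I2[OF b]
  show "set_integrable M A s'"
    unfolding set_integrable_def by (rule integrable_dominated_convergence[OF prems])
  show "set_integrable M A (s n)" for n
    unfolding set_integrable_def by (rule integrable_dominated_convergence2[OF prems])
  show "(\<lambda>n. LINT x:A|M. s n x) \<longlonglongrightarrow> (LINT x:A|M. s' x)"
    unfolding set_lebesgue_integral_def by (rule integral_dominated_convergence[OF prems])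
qed

lemma
  fixes f :: "'i \<Rightarrow> 'a \<Rightarrow> 'b::{banach, second_countable_topology}"
  assumes "\<And>i. i \<in> S \<Longrightarrow> set_integrable M A (f i)"
  shows set_integrable_sum: "set_integrable M A (\<lambda>x. \<Sum>i\<in>S. f i x)"
    and set_integral_sum: "(LINT x:A|M. \<Sum>i\<in>S. f i x) = (\<Sum>i\<in>S. LINT x:A|M. f i x)"
  using assms unfolding set_integrable_def set_lebesgue_integral_def scaleR_sum_right by simp_all

lemma set_borel_measurable_disc:
  fixes f :: "complex \<Rightarrow> 'b::real_normed_vector"
  shows "continuous_on (ball 0 1) f \<Longrightarrow> set_borel_measurable lborel (ball 0 1) f"
  unfolding set_borel_measurable_def
  using borel_measurable_continuous_on_indicator[of "ball 0 1" f] by simp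

lemma set_integrable_disc_continuous:
  fixes f :: "complex \<Rightarrow> 'b::{banach, second_countable_topology}"
  assumes "continuous_on (cball 0 1) f"
  shows "set_integrable lborel (ball 0 1) f"
proof (rule set_integrable_subset)
  show "set_integrable lborel (cball 0 1) f"
    unfolding set_integrable_def by (intro borel_integrable_compact assms) auto
qed (auto simp: ball_subset_cball)

lemma integrable_arclength_continuous:
  fixes f :: "complex \<Rightarrow> 'b::{banach, second_countable_topology}"
  assumes "continuous_on (sphere 0 1) f"
  shows "integrable arclength f"
proof -
  obtain B where "\<And>w. w \<in> sphere 0 1 \<Longrightarrow> norm (f w) \<le> B"
    using compact_sphere assms by (rule continuous_on_compact_bound) (rule that)
  then show ?thesis
    using borel_measurable_arclength_continuous[OF assms]
    by (intro arclength.integrable_const_bound[of _ B]) auto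
qed

text \<open>Both sides vanish unless \<open>n = m\<close>, and for \<open>n = m > 0\<close> the left one is
\<open>\<pi> n\<^sup>2 / (n (n + 1)) + \<pi> / (n + 1) = \<pi>\<close>.\<close>

lemma LINT_disc_green_form_power:
  defines "e \<equiv> \<lambda>(n::nat) (m::nat) w. of_real (1 - (norm w)\<^sup>2) * (of_nat n * w ^ (n - 1) * cnj (of_nat m * w ^ (m - 1))) +
     w ^ n * cnj (w ^ m)"
  shows "(LINT w:ball 0 1|lborel. e n m w) = pi * (LINT w|arclength. w ^ n * cnj (w ^ m))"
proof -
  have 1: "set_integrable lborel (ball 0 1) (\<lambda>w. of_real (1 - (norm w)\<^sup>2) * (w ^ k * cnj w ^ l) :: complex)" for k l
    by (intro set_integrable_disc_continuous continuous_intros)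
  have 2: "set_integrable lborel (ball 0 1) (\<lambda>w. w ^ k * cnj w ^ l)" for k l
    by (intro set_integrable_disc_continuous continuous_intros)
  have "(LINT w:ball 0 1|lborel. e n m w) =
    (LINT w:ball 0 1|lborel. (of_nat n * of_nat m) * (of_real (1 - (norm w)\<^sup>2) * (w ^ (n-1) * cnj w ^ (m-1))) +
      w ^ n * cnj w ^ m)"
    by (simp add: e_def mult_ac)
  also have "\<dots> = of_nat n * of_nat m * (LINT w:ball 0 1|lborel. of_real (1 - (norm w)\<^sup>2) * (w ^ (n-1) * cnj w ^ (m-1))) +
     (LINT w:ball 0 1|lborel. w ^ n * cnj w ^ m)"
    using 1 2 by (subst set_integral_add(2)) (simp_all del: of_real_diff)
  also have "\<dots> = (if n = m then of_real pi else 0)"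
  proof (cases n)
    case (Suc k)
    have "x * x * (pi / (x * (x + 1))) + pi / (x + 1) = pi" if "0 < x" for x :: real
    proof -
      have "x * x * (pi / (x * (x + 1))) + pi / (x + 1) = x * pi / (x + 1) + pi / (x + 1)"
        using that by simp
      also have "\<dots> = pi * (x + 1) / (x + 1)"
        by (simp add: algebra_simps add_divide_distrib)
      finally show ?thesis using that by simp
    qed
    moreover have "real (Suc (Suc k)) = real (Suc k) + 1" "0 < real (Suc k)" by simp_all
    ultimately have "real (Suc k) * real (Suc k) * (pi / (Suc k * Suc (Suc k))) + pi / Suc (Suc k) = pi"
      by (simp only: of_nat_mult)
    then have "complex_of_real (real (Suc k) * real (Suc k) * (pi / (Suc k * Suc (Suc k))) + pi / Suc (Suc k)) = of_real pi"
      by (simp only:)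
    then have "of_nat (Suc k) * of_nat (Suc k) * complex_of_real (pi / (Suc k * Suc (Suc k))) + of_real (pi / Suc (Suc k)) = of_real pi"
      by (simp only: of_real_add of_real_mult of_real_of_nat_eq)
    then show ?thesis
      unfolding LINT_disc_weight_power LINT_disc_power Suc
      by (cases m) (auto simp del: of_nat_Suc of_nat_mult mult_Suc mult_Suc_right of_real_divide)
  next
    case 0
    show ?thesis unfolding 0 LINT_disc_power by simp
  qed
  also have "\<dots> = pi * (LINT w|arclength. w ^ n * cnj (w ^ m))"
    by (simp add: integral_arclength_power)
  finally show ?thesis .
qed

lemma green_identity_disc_polynomial:
  fixes p q :: "nat \<Rightarrow> complex" and N :: nat
  defines "P \<equiv> \<lambda>w. \<Sum>n<N. p n * w ^ n" and "Q \<equiv> \<lambda>w. \<Sum>n<N. q n * w ^ n"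
    and "P' \<equiv> \<lambda>w. \<Sum>n<N. p n * (of_nat n * w ^ (n - 1))" and "Q' \<equiv> \<lambda>w. \<Sum>n<N. q n * (of_nat n * w ^ (n - 1))"
  shows "(LINT w:ball 0 1|lborel. of_real (1 - (norm w)\<^sup>2) * (P' w * cnj (Q' w)) + P w * cnj (Q w)) =
     pi * (LINT w|arclength. P w * cnj (Q w))"
proof -
  let ?e = "\<lambda>(n::nat) (m::nat) w. of_real (1 - (norm w)\<^sup>2) * (of_nat n * w ^ (n - 1) * cnj (of_nat m * w ^ (m - 1))) +
     w ^ n * cnj (w ^ m)"
  have PQ: "P w * cnj (Q w) = (\<Sum>n<N. \<Sum>m<N. p n * cnj (q m) * (w ^ n * cnj (w ^ m)))" for w
    unfolding P_def Q_def cnj_sum sum_product by (simp add: mult_ac)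
  have PQ': "P' w * cnj (Q' w) = (\<Sum>n<N. \<Sum>m<N. p n * cnj (q m) * (of_nat n * w ^ (n - 1) * cnj (of_nat m * w ^ (m - 1))))" for w
    unfolding P'_def Q'_def cnj_sum sum_product by (simp add: mult_ac)
  have eq: "of_real (1 - (norm w)\<^sup>2) * (P' w * cnj (Q' w)) + P w * cnj (Q w) =
      (\<Sum>n<N. \<Sum>m<N. p n * cnj (q m) * ?e n m w)" for w
    unfolding PQ PQ' sum_distrib_left sum.distrib[symmetric] by (intro sum.cong refl) (simp only: ring_distribs mult_ac)
  have i: "set_integrable lborel (ball 0 1) (?e n m)" for n m
    by (intro set_integrable_disc_continuous continuous_intros)
  have "(LINT w:ball 0 1|lborel. of_real (1 - (norm w)\<^sup>2) * (P' w * cnj (Q' w)) + P w * cnj (Q w)) =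
     (\<Sum>n<N. \<Sum>m<N. p n * cnj (q m) * (LINT w:ball 0 1|lborel. ?e n m w))"
    unfolding eq by (simp only: set_integral_sum set_integrable_sum set_integrable_mult_right i set_integral_mult_right)
  also have "\<dots> = (\<Sum>n<N. \<Sum>m<N. p n * cnj (q m) * (pi * (LINT w|arclength. w ^ n * cnj (w ^ m))))"
    unfolding LINT_disc_green_form_power ..
  also have "\<dots> = pi * (LINT w|arclength. P w * cnj (Q w))"
  proof -
    have "integrable arclength (\<lambda>w. p n * cnj (q m) * (w ^ n * cnj (w ^ m)))" for n m
      by (intro integrable_arclength_continuous continuous_intros)
    then have "(LINT w|arclength. P w * cnj (Q w)) = (\<Sum>n<N. \<Sum>m<N. (LINT w|arclength. p n * cnj (q m) * (w ^ n * cnj (w ^ m))))"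
      unfolding PQ by (simp only: Bochner_Integration.integral_sum Bochner_Integration.integrable_sum)
    then show ?thesis
      by (simp only: sum_distrib_left integral_mult_right_zero mult.left_commute[of "complex_of_real pi"])
  qed
  finally show ?thesis .
qed

text \<open>Convergence at a point of modulus larger than \<open>1\<close> makes the coefficient series, also that of the
derivative, absolutely summable on the closed disc.\<close>

lemma power_series_closed_disc:
  assumes f: "f holomorphic_on ball 0 R" and R: "1 < R"
  obtains p where "\<And>w. norm w \<le> 1 \<Longrightarrow> (\<lambda>n. p n * w ^ n) sums f w"
    and "\<And>w. norm w \<le> 1 \<Longrightarrow> (\<lambda>n. p n * (of_nat n * w ^ (n - 1))) sums deriv f w"
    and "summable (\<lambda>n. norm (p n))" and "summable (\<lambda>n. norm (p n * of_nat n))"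
proof -
  have abs: "summable (\<lambda>n. norm ((deriv ^^ n) g 0 / fact n))" if "g holomorphic_on ball 0 R" for g :: "complex \<Rightarrow> complex"
  proof -
    define x where "x = complex_of_real ((1 + R) / 2)"
    have "norm x = \<bar>(1 + R) / 2\<bar>" by (simp only: x_def norm_of_real)
    then have x: "norm x = (1 + R) / 2" "x \<in> ball 0 R" using R by (auto simp: abs_if field_simps)
    have "summable (\<lambda>n. norm ((deriv ^^ n) g 0 / fact n * 1 ^ n))"
      using holomorphic_power_series[OF that x(2)] x(1) R
      by (intro powser_insidea[of _ x]) (auto simp: sums_iff)
    then show ?thesis by simp
  qed
  define p where "p n = (deriv ^^ n) f 0 / fact n" for n
  have df: "deriv f holomorphic_on ball 0 R" by (rule holomorphic_deriv[OF f]) auto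
  have pS: "(deriv ^^ n) (deriv f) 0 / fact n = p (Suc n) * of_nat (Suc n)" for n
    by (simp add: p_def funpow_swap1 field_simps del: of_nat_Suc)
  show thesis
  proof
    show "(\<lambda>n. p n * w ^ n) sums f w" if "norm w \<le> 1" for w
      using holomorphic_power_series[OF f, of w] that R by (simp add: p_def)
    show "(\<lambda>n. p n * (of_nat n * w ^ (n - 1))) sums deriv f w" if "norm w \<le> 1" for w
    proof -
      have "(\<lambda>n. p (Suc n) * (of_nat (Suc n) * w ^ (Suc n - 1))) sums deriv f w"
        using holomorphic_power_series[OF df, of w] that R unfolding pS by (simp add: mult_ac)
      then show ?thesis by (subst (asm) sums_Suc_iff) simp
    qed
    show "summable (\<lambda>n. norm (p n))" using abs[OF f] by (simp add: p_def)
    show "summable (\<lambda>n. norm (p n * of_nat n))"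
      using abs[OF df] unfolding pS by (subst summable_Suc_iff[symmetric]) 
  qed
qed

text \<open>This is Stokes' theorem for the difference of the forms \<open>(1 - \<bar>w\<bar>\<^sup>2) P cnj Q' d(cnj w)\<close> and
\<open>cnj w P cnj Q dw\<close>, the first of which is \<open>0\<close> on the circle. It holds for monomials by
orthogonality, and both sides are continuous along the partial sums of the power series of \<open>P\<close> and
\<open>Q\<close>, which are dominated by the sums of the moduli of their coefficients.\<close>

lemma green_identity_disc:
  assumes P: "P holomorphic_on ball 0 R" and Q: "Q holomorphic_on ball 0 R" and R: "1 < R"
  shows "(LINT w:ball 0 1|lborel. of_real (1 - (norm w)\<^sup>2) * (deriv P w * cnj (deriv Q w)) + P w * cnj (Q w)) =
     pi * (LINT w|arclength. P w * cnj (Q w))"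
proof -
  obtain p where p: "\<And>w. norm w \<le> 1 \<Longrightarrow> (\<lambda>n. p n * w ^ n) sums P w"
    and p': "\<And>w. norm w \<le> 1 \<Longrightarrow> (\<lambda>n. p n * (of_nat n * w ^ (n - 1))) sums deriv P w"
    and ps: "summable (\<lambda>n. norm (p n))" "summable (\<lambda>n. norm (p n * of_nat n))"
    using P R by (rule power_series_closed_disc) (rule that)
  obtain q where q: "\<And>w. norm w \<le> 1 \<Longrightarrow> (\<lambda>n. q n * w ^ n) sums Q w"
    and q': "\<And>w. norm w \<le> 1 \<Longrightarrow> (\<lambda>n. q n * (of_nat n * w ^ (n - 1))) sums deriv Q w"
    and qs: "summable (\<lambda>n. norm (q n))" "summable (\<lambda>n. norm (q n * of_nat n))"
    using Q R by (rule power_series_closed_disc) (rule that)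
  have bound: "norm (\<Sum>n<N. a n * (b n * w ^ k n)) \<le> (\<Sum>n. norm (a n * b n))"
    if "summable (\<lambda>n. norm (a n * b n))" "norm w \<le> 1" for a b :: "nat \<Rightarrow> complex" and k N and w :: complex
  proof -
    have "norm (\<Sum>n<N. a n * (b n * w ^ k n)) \<le> (\<Sum>n<N. norm (a n * b n))"
    proof (rule sum_norm_le)
      fix n
      have "norm (w ^ k n) \<le> 1" using that by (simp add: norm_power power_le_one)
      then have "norm (a n * b n) * norm (w ^ k n) \<le> norm (a n * b n) * 1"
        by (rule mult_left_mono) simp
      then show "norm (a n * (b n * w ^ k n)) \<le> norm (a n * b n)"
        by (simp add: norm_mult mult.assoc)
    qed
    also have "\<dots> \<le> (\<Sum>n. norm (a n * b n))"
      using that by (intro sum_le_suminf) auto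
    finally show ?thesis .
  qed
  define PN where "PN N w = (\<Sum>n<N. p n * w ^ n)" for N w
  define QN where "QN N w = (\<Sum>n<N. q n * w ^ n)" for N w
  define PN' where "PN' N w = (\<Sum>n<N. p n * (of_nat n * w ^ (n - 1)))" for N w
  define QN' where "QN' N w = (\<Sum>n<N. q n * (of_nat n * w ^ (n - 1)))" for N w
  define A where "A = (\<Sum>n. norm (p n))"
  define A' where "A' = (\<Sum>n. norm (p n * of_nat n))"
  define B where "B = (\<Sum>n. norm (q n))"
  define B' where "B' = (\<Sum>n. norm (q n * of_nat n))"
  have nn: "0 \<le> A" "0 \<le> A'" "0 \<le> B" "0 \<le> B'"
    unfolding A_def A'_def B_def B'_def using ps qs by (auto intro!: suminf_nonneg)
  have PNb: "norm (PN N w) \<le> A" and QNb: "norm (QN N w) \<le> B" if "norm w \<le> 1" for N w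
    using bound[of p "\<lambda>_. 1" w "\<lambda>n. n" N] bound[of q "\<lambda>_. 1" w "\<lambda>n. n" N] ps qs that
    by (auto simp: PN_def QN_def A_def B_def)
  have PNb': "norm (PN' N w) \<le> A'" and QNb': "norm (QN' N w) \<le> B'" if "norm w \<le> 1" for N w
    using bound[of p of_nat w "\<lambda>n. n - 1" N] bound[of q of_nat w "\<lambda>n. n - 1" N] ps qs that
    by (auto simp: PN'_def QN'_def A'_def B'_def)
  let ?L = "\<lambda>P' Q' P Q w. of_real (1 - (norm w)\<^sup>2) * (P' w * cnj (Q' w)) + P w * cnj (Q w)"
  have l: "(\<lambda>N. PN N w) \<longlonglongrightarrow> P w" "(\<lambda>N. QN N w) \<longlonglongrightarrow> Q w" "(\<lambda>N. PN' N w) \<longlonglongrightarrow> deriv P w" "(\<lambda>N. QN' N w) \<longlonglongrightarrow> deriv Q w"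
    if "norm w \<le> 1" for w
    using p[OF that] q[OF that] p'[OF that] q'[OF that] by (auto simp: sums_def PN_def QN_def PN'_def QN'_def)
  have c: "continuous_on S (PN N)" "continuous_on S (QN N)" "continuous_on S (PN' N)" "continuous_on S (QN' N)" for N S
    unfolding PN_def QN_def PN'_def QN'_def by (intro continuous_intros)+
  have "(\<lambda>N. LINT w:ball 0 1|lborel. ?L (PN' N) (QN' N) (PN N) (QN N) w) \<longlonglongrightarrow>
      (LINT w:ball 0 1|lborel. ?L (deriv P) (deriv Q) P Q w)"
  proof (rule set_integral_dominated_convergence(3))
    show "set_integrable lborel (ball (0::complex) 1) (\<lambda>_. A' * B' + A * B)"
      by (intro set_integrable_disc_continuous continuous_intros)
    show "norm (?L (PN' N) (QN' N) (PN N) (QN N) w) \<le> A' * B' + A * B" if "w \<in> ball 0 1" for N w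
    proof (rule norm_triangle_mono)
      have "norm (complex_of_real (1 - (norm w)\<^sup>2)) \<le> 1"
        using that power_le_one[of "norm w" 2] by (simp only: norm_of_real) (simp add: abs_le_iff)
      then show "norm (of_real (1 - (norm w)\<^sup>2) * (PN' N w * cnj (QN' N w))) \<le> A' * B'"
      proof -
        have "norm (of_real (1 - (norm w)\<^sup>2) * (PN' N w * cnj (QN' N w))) \<le> 1 * (A' * B')"
          unfolding norm_mult complex_mod_cnj
          using that PNb'[of w N] QNb'[of w N] nn \<open>norm (complex_of_real (1 - (norm w)\<^sup>2)) \<le> 1\<close>
          by (intro mult_mono) auto
        then show ?thesis by simp
      qed
      show "norm (PN N w * cnj (QN N w)) \<le> A * B"
        using that PNb[of w N] QNb[of w N] nn by (auto simp: norm_mult intro!: mult_mono)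
    qed
    show "set_borel_measurable lborel (ball 0 1) (?L (PN' N) (QN' N) (PN N) (QN N))" for N
      by (intro set_borel_measurable_disc continuous_intros c)
    show "(\<lambda>N. ?L (PN' N) (QN' N) (PN N) (QN N) w) \<longlonglongrightarrow> ?L (deriv P) (deriv Q) P Q w" if "w \<in> ball 0 1" for w
      using that by (intro tendsto_intros l) auto
  qed
  then have "(\<lambda>N. pi * (LINT w|arclength. PN N w * cnj (QN N w))) \<longlonglongrightarrow>
      (LINT w:ball 0 1|lborel. ?L (deriv P) (deriv Q) P Q w)"
    unfolding PN_def QN_def PN'_def QN'_def green_identity_disc_polynomial .
  moreover have "(\<lambda>N. complex_of_real pi * (LINT w|arclength. PN N w * cnj (QN N w))) \<longlonglongrightarrow> pi * (LINT w|arclength. P w * cnj (Q w))"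
  proof (intro tendsto_intros integral_dominated_convergence[where w = "\<lambda>_. A * B"])
    have "continuous_on (sphere 0 1) P" "continuous_on (sphere 0 1) Q"
      using P Q R by (auto intro!: continuous_on_subset[OF holomorphic_on_imp_continuous_on])
    then show "(\<lambda>w. P w * cnj (Q w)) \<in> borel_measurable arclength"
      by (intro borel_measurable_arclength_continuous continuous_intros)
    show "(\<lambda>w. PN N w * cnj (QN N w)) \<in> borel_measurable arclength" for N
      by (intro borel_measurable_arclength_continuous continuous_intros c)
    show "AE w in arclength. (\<lambda>N. PN N w * cnj (QN N w)) \<longlonglongrightarrow> P w * cnj (Q w)"
      by (rule AE_I2) (auto intro!: tendsto_intros l)
    show "AE w in arclength. norm (PN N w * cnj (QN N w)) \<le> A * B" for N
      using PNb[of _ N] QNb[of _ N] nn by (intro AE_I2) (auto simp: norm_mult intro!: mult_mono)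
  qed auto
  ultimately show ?thesis
    by (rule LIMSEQ_unique)
qed

section \<open>Bounded holomorphic sequences that vanish inside the disc\<close>

text \<open>Cauchy's estimate on the disc of radius \<open>(1 - \<bar>w\<bar>) / 2\<close> about \<open>w\<close>.\<close>

lemma norm_deriv_le_disc:
  assumes f: "f holomorphic_on ball 0 1" and b: "\<And>w. w \<in> ball 0 1 \<Longrightarrow> norm (f w) \<le> C" and w: "w \<in> ball 0 1"
  shows "(1 - norm w) * norm (deriv f w) \<le> 2 * C"
proof -
  define s where "s = (1 - norm w) / 2"
  have s: "0 < s" "norm w + s < 1" using w by (auto simp: s_def field_simps)
  have sub: "cball w s \<subseteq> ball 0 1"
  proof
    fix z assume "z \<in> cball w s"
    then have "norm z \<le> norm w + s" using norm_triangle_ineq2[of z w] by (simp add: dist_norm norm_minus_commute)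
    then show "z \<in> ball 0 1" using s by simp
  qed
  have "norm ((deriv ^^ 1) f w) \<le> fact 1 * C / s ^ 1"
  proof (rule Cauchy_inequality)
    show "f holomorphic_on ball w s"
      by (rule holomorphic_on_subset[OF f]) (use sub ball_subset_cball in blast)
    show "continuous_on (cball w s) f"
      by (rule continuous_on_subset[OF holomorphic_on_imp_continuous_on[OF f] sub])
    show "norm (f x) \<le> C" if "norm (w - x) = s" for x
      by (rule b) (use sub that in \<open>auto simp: subset_iff dist_norm\<close>)
  qed (use s in auto)
  then have "norm (deriv f w) \<le> C / s" by simp
  then have "s * norm (deriv f w) \<le> C" using s by (simp add: field_simps)
  then show ?thesis by (simp add: s_def field_simps)
qed

text \<open>The radius \<open>R > 1\<close> may depend on \<open>n\<close> and shrink to \<open>1\<close>, as it does for functions \<open>g(r\<^sub>n w)\<close> with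
\<open>r\<^sub>n\<close> tending to \<open>1\<close>; only the bound on the closed unit disc is uniform.\<close>

definition bounded_holomorphic_seq :: "(nat \<Rightarrow> complex \<Rightarrow> complex) \<Rightarrow> bool" where
  "bounded_holomorphic_seq P \<longleftrightarrow>
     (\<forall>n. \<exists>R>1. P n holomorphic_on ball 0 R) \<and> (\<exists>C. \<forall>n. \<forall>w\<in>cball 0 1. norm (P n w) \<le> C)"

definition vanishing_seq :: "(nat \<Rightarrow> complex \<Rightarrow> complex) \<Rightarrow> bool" where
  "vanishing_seq P \<longleftrightarrow> bounded_holomorphic_seq P \<and>
     (\<forall>w\<in>ball 0 1. (\<lambda>n. P n w) \<longlonglongrightarrow> 0 \<and> (\<lambda>n. deriv (P n) w) \<longlonglongrightarrow> 0)"

lemma vanishing_seq_bounded: "vanishing_seq P \<Longrightarrow> bounded_holomorphic_seq P"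
  by (simp add: vanishing_seq_def)

lemma bounded_holomorphic_seq_holomorphic:
  assumes "bounded_holomorphic_seq P"
  obtains R where "1 < R" "P n holomorphic_on ball 0 R"
  using assms unfolding bounded_holomorphic_seq_def by blast

lemma bounded_holomorphic_seq_field_derivative:
  assumes "bounded_holomorphic_seq P" "norm w \<le> 1"
  shows "(P n has_field_derivative deriv (P n) w) (at w)"
proof -
  obtain R where "1 < R" "P n holomorphic_on ball 0 R"
    using assms(1) by (rule bounded_holomorphic_seq_holomorphic)
  then show ?thesis using assms(2) by (intro holomorphic_derivI[of _ "ball 0 R"]) auto
qed

lemma bounded_holomorphic_seq_continuous:
  assumes "bounded_holomorphic_seq P" "S \<subseteq> cball 0 1"
  shows "continuous_on S (P n)" "continuous_on S (deriv (P n))"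
proof -
  obtain R where R: "1 < R" "P n holomorphic_on ball 0 R"
    using assms(1) by (rule bounded_holomorphic_seq_holomorphic)
  have "S \<subseteq> ball 0 R" using assms(2) R(1) by (force simp: subset_iff)
  then show "continuous_on S (P n)" "continuous_on S (deriv (P n))"
    using R(2) holomorphic_deriv[OF R(2)]
    by (auto intro: continuous_on_subset holomorphic_on_imp_continuous_on)
qed

text \<open>The bound on the derivatives is the one that dominates all integrands below: the weight
\<open>1 - \<bar>w\<bar>\<^sup>2\<close> absorbs exactly one factor \<open>deriv (P n)\<close>.\<close>

lemma bounded_holomorphic_seq_bounds:
  assumes "bounded_holomorphic_seq P"
  obtains C where "0 \<le> C" and "\<And>n w. norm w \<le> 1 \<Longrightarrow> norm (P n w) \<le> C"
    and "\<And>n w. norm w < 1 \<Longrightarrow> (1 - (norm w)\<^sup>2) * norm (deriv (P n) w) \<le> C"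
proof -
  obtain C where "\<forall>n. \<forall>w\<in>cball 0 1. norm (P n w) \<le> C"
    using assms unfolding bounded_holomorphic_seq_def by blast
  then have C: "\<And>n w. norm w \<le> 1 \<Longrightarrow> norm (P n w) \<le> C" by simp
  have "0 \<le> C" using C[of 0 0] norm_ge_zero order_trans by (metis norm_zero zero_le_one)
  moreover have "(1 - (norm w)\<^sup>2) * norm (deriv (P n) w) \<le> 4 * C" if w: "norm w < 1" for n w
  proof -
    obtain R where R: "1 < R" "P n holomorphic_on ball 0 R"
    using assms(1) by (rule bounded_holomorphic_seq_holomorphic)
    then have "P n holomorphic_on ball 0 1" by (auto intro: holomorphic_on_subset)
    then have "(1 - norm w) * norm (deriv (P n) w) \<le> 2 * C"
      using C w by (intro norm_deriv_le_disc) auto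
    moreover have "(1 - (norm w)\<^sup>2) * norm (deriv (P n) w) = (1 + norm w) * ((1 - norm w) * norm (deriv (P n) w))"
      by (simp add: power2_eq_square algebra_simps)
    moreover have "\<dots> \<le> 2 * ((1 - norm w) * norm (deriv (P n) w))"
      using w by (intro mult_right_mono) auto
    ultimately show ?thesis by linarith
  qed
  moreover have "norm (P n w) \<le> 4 * C" if "norm w \<le> 1" for n w
    using C[OF that, of n] \<open>0 \<le> C\<close> by linarith
  ultimately show thesis by (intro that[of "4 * C"]) auto
qed

lemma bounded_holomorphic_seq_const:
  assumes "Q holomorphic_on ball 0 R" "1 < R"
  shows "bounded_holomorphic_seq (\<lambda>_. Q)"
proof -
  have "continuous_on (cball 0 1) Q"
    using assms by (auto intro!: continuous_on_subset[OF holomorphic_on_imp_continuous_on])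
  with compact_cball obtain B where "\<And>w. w \<in> cball 0 1 \<Longrightarrow> norm (Q w) \<le> B"
    by (rule continuous_on_compact_bound) (rule that)
  then have "\<forall>w\<in>cball 0 1. norm (Q w) \<le> B" by simp
  with assms show ?thesis unfolding bounded_holomorphic_seq_def by blast
qed

lemma bounded_holomorphic_seq_mult:
  assumes P: "bounded_holomorphic_seq P" and Q: "bounded_holomorphic_seq Q"
  shows "bounded_holomorphic_seq (\<lambda>n w. P n w * Q n w)"
  unfolding bounded_holomorphic_seq_def
proof (intro conjI allI)
  fix n
  obtain R S where "R > 1" "P n holomorphic_on ball 0 R" "S > 1" "Q n holomorphic_on ball 0 S"
    using P Q unfolding bounded_holomorphic_seq_def by meson
  then show "\<exists>R>1. (\<lambda>w. P n w * Q n w) holomorphic_on ball 0 R"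
    by (intro exI[of _ "min R S"]) (auto intro!: holomorphic_intros intro: holomorphic_on_subset)
next
  obtain C where C: "0 \<le> C" "\<And>n w. norm w \<le> 1 \<Longrightarrow> norm (P n w) \<le> C"
    by (rule bounded_holomorphic_seq_bounds[OF P]) (rule that)
  obtain D where D: "0 \<le> D" "\<And>n w. norm w \<le> 1 \<Longrightarrow> norm (Q n w) \<le> D"
    by (rule bounded_holomorphic_seq_bounds[OF Q]) (rule that)
  show "\<exists>C. \<forall>n. \<forall>w\<in>cball 0 1. norm (P n w * Q n w) \<le> C"
    using C D by (intro exI[of _ "C * D"]) (auto simp: norm_mult intro!: mult_mono)
qed

lemma deriv_mult_bounded_holomorphic_seq:
  assumes P: "bounded_holomorphic_seq P" and Q: "bounded_holomorphic_seq Q" and w: "norm w \<le> 1"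
  shows "deriv (\<lambda>w. P n w * Q n w) w = deriv (P n) w * Q n w + P n w * deriv (Q n) w"
  using DERIV_mult[OF bounded_holomorphic_seq_field_derivative[OF P w] bounded_holomorphic_seq_field_derivative[OF Q w]]
  by (intro DERIV_imp_deriv) (simp add: mult_ac add_ac)

lemma tendsto_0_mult_bounded:
  fixes a b :: "nat \<Rightarrow> complex"
  assumes "a \<longlonglongrightarrow> 0" "\<And>n. norm (b n) \<le> C"
  shows "(\<lambda>n. a n * b n) \<longlonglongrightarrow> 0"
  using assms(1) by (rule lim_null_mult_right_bounded) (auto intro!: always_eventually assms(2))

lemma vanishing_seq_mult:
  assumes P: "vanishing_seq P" and Q: "bounded_holomorphic_seq Q"
  shows "vanishing_seq (\<lambda>n w. P n w * Q n w)"
  unfolding vanishing_seq_def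
proof (intro conjI ballI)
  have P': "bounded_holomorphic_seq P" using P by (rule vanishing_seq_bounded)
  then show "bounded_holomorphic_seq (\<lambda>n w. P n w * Q n w)"
    using Q by (rule bounded_holomorphic_seq_mult)
  fix w :: complex assume w: "w \<in> ball 0 1"
  obtain C where C: "0 \<le> C" "\<And>n w. norm w \<le> 1 \<Longrightarrow> norm (Q n w) \<le> C"
    "\<And>n w. norm w < 1 \<Longrightarrow> (1 - (norm w)\<^sup>2) * norm (deriv (Q n) w) \<le> C"
    by (rule bounded_holomorphic_seq_bounds[OF Q]) (rule that)
  have lim: "(\<lambda>n. P n w) \<longlonglongrightarrow> 0" "(\<lambda>n. deriv (P n) w) \<longlonglongrightarrow> 0"
    using P w by (auto simp: vanishing_seq_def)
  have b: "norm (Q n w) \<le> C" for n using C(2) w by auto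
  have b': "norm (deriv (Q n) w) \<le> C / (1 - (norm w)\<^sup>2)" for n
    using C(3)[of w n] w by (simp add: field_simps power_less_one_iff abs_square_less_1)
  show "(\<lambda>n. P n w * Q n w) \<longlonglongrightarrow> 0"
    by (rule tendsto_0_mult_bounded[OF lim(1) b])
  have "(\<lambda>n. deriv (P n) w * Q n w + P n w * deriv (Q n) w) \<longlonglongrightarrow> 0 + 0"
    by (intro tendsto_add tendsto_0_mult_bounded[OF lim(1) b'] tendsto_0_mult_bounded[OF lim(2) b])
  then show "(\<lambda>n. deriv (\<lambda>w. P n w * Q n w) w) \<longlonglongrightarrow> 0"
    using deriv_mult_bounded_holomorphic_seq[OF P' Q] w by simp
qed

lemma bounded_holomorphic_seq_power: "bounded_holomorphic_seq (\<lambda>_ w. w ^ a)"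
  by (rule bounded_holomorphic_seq_const[of _ 2]) (auto intro!: holomorphic_intros)

lemma vanishing_seq_power: "vanishing_seq P \<Longrightarrow> vanishing_seq (\<lambda>n w. P n w ^ Suc k)"
proof (induction k)
  case (Suc k)
  then show ?case
    using vanishing_seq_mult[of P "\<lambda>n w. P n w ^ Suc k"] by (auto dest: vanishing_seq_bounded)
qed simp

text \<open>The two expressions differ by \<open>\<integral> P cnj Q\<close> over the disc, which tends to \<open>0\<close> by domination.\<close>

lemma LINT_disc_green_form_minus_circle_tendsto_0:
  assumes P: "vanishing_seq P" and Q: "bounded_holomorphic_seq Q"
  shows "(\<lambda>n. (LINT w:ball 0 1|lborel. of_real (1 - (norm w)\<^sup>2) * (deriv (P n) w * cnj (deriv (Q n) w))) -
      pi * (LINT w|arclength. P n w * cnj (Q n w))) \<longlonglongrightarrow> 0"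
proof -
  have P': "bounded_holomorphic_seq P" using P by (rule vanishing_seq_bounded)
  obtain C where C: "0 \<le> C" "\<And>n w. norm w \<le> 1 \<Longrightarrow> norm (P n w) \<le> C"
    by (rule bounded_holomorphic_seq_bounds[OF P']) (rule that)
  obtain D where D: "0 \<le> D" "\<And>n w. norm w \<le> 1 \<Longrightarrow> norm (Q n w) \<le> D"
    by (rule bounded_holomorphic_seq_bounds[OF Q]) (rule that)
  note cont = bounded_holomorphic_seq_continuous[OF P'] bounded_holomorphic_seq_continuous[OF Q]
  have 0: "(\<lambda>n. LINT w:ball 0 1|lborel. P n w * cnj (Q n w)) \<longlonglongrightarrow> (LINT w:ball (0::complex) 1|lborel. 0)"
  proof (rule set_integral_dominated_convergence(3)[where w = "\<lambda>_. C * D"])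
    show "set_borel_measurable lborel (ball 0 1) (\<lambda>w. P n w * cnj (Q n w))" for n
      by (intro set_borel_measurable_disc continuous_intros cont ball_subset_cball)
    show "set_integrable lborel (ball (0::complex) 1) (\<lambda>_. C * D)"
      by (intro set_integrable_disc_continuous continuous_intros)
    show "norm (P n w * cnj (Q n w)) \<le> C * D" if "w \<in> ball 0 1" for n w
      using that C D by (auto simp: norm_mult intro!: mult_mono)
    show "(\<lambda>n. P n w * cnj (Q n w)) \<longlonglongrightarrow> 0" if "w \<in> ball 0 1" for w
      using that P D by (intro tendsto_0_mult_bounded[of _ _ D]) (auto simp: vanishing_seq_def)
  qed
  have "(LINT w:ball 0 1|lborel. of_real (1 - (norm w)\<^sup>2) * (deriv (P n) w * cnj (deriv (Q n) w))) -
      pi * (LINT w|arclength. P n w * cnj (Q n w)) = - (LINT w:ball 0 1|lborel. P n w * cnj (Q n w))" for n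
  proof -
    obtain R where R: "1 < R" "P n holomorphic_on ball 0 R"
      using P' by (rule bounded_holomorphic_seq_holomorphic)
    obtain S where S: "1 < S" "Q n holomorphic_on ball 0 S"
      using Q by (rule bounded_holomorphic_seq_holomorphic)
    have "P n holomorphic_on ball 0 (min R S)" "Q n holomorphic_on ball 0 (min R S)"
      using R S by (auto intro: holomorphic_on_subset)
    then have "pi * (LINT w|arclength. P n w * cnj (Q n w)) =
       (LINT w:ball 0 1|lborel. of_real (1 - (norm w)\<^sup>2) * (deriv (P n) w * cnj (deriv (Q n) w)) + P n w * cnj (Q n w))"
      using R S by (intro green_identity_disc[symmetric, where R = "min R S"]) auto
    also have "\<dots> = (LINT w:ball 0 1|lborel. of_real (1 - (norm w)\<^sup>2) * (deriv (P n) w * cnj (deriv (Q n) w))) +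
       (LINT w:ball 0 1|lborel. P n w * cnj (Q n w))"
      by (intro set_integral_add(2) set_integrable_disc_continuous continuous_intros cont order_refl)
    finally show ?thesis by simp
  qed
  then show ?thesis using tendsto_minus[OF 0] by simp
qed

lemma LINT_disc_green_form_tendsto_0:
  fixes a b :: "nat \<Rightarrow> complex \<Rightarrow> complex"
  assumes a: "\<And>n. set_borel_measurable lborel (ball 0 1) (a n)" and b: "\<And>n. set_borel_measurable lborel (ball 0 1) (b n)"
    and a0: "\<And>w. w \<in> ball 0 1 \<Longrightarrow> (\<lambda>n. a n w) \<longlonglongrightarrow> 0" and aC: "\<And>n w. w \<in> ball 0 1 \<Longrightarrow> (1 - (norm w)\<^sup>2) * norm (a n w) \<le> C"
    and bD: "\<And>n w. w \<in> ball 0 1 \<Longrightarrow> norm (b n w) \<le> D"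
  shows "(\<lambda>n. LINT w:ball 0 1|lborel. of_real (1 - (norm w)\<^sup>2) * (a n w * cnj (b n w))) \<longlonglongrightarrow> 0"
proof -
  have "0 \<le> C" using order_trans[OF norm_ge_zero[of "a 0 0"], of C] aC[of 0 0] by simp
  have "(\<lambda>n. LINT w:ball 0 1|lborel. of_real (1 - (norm w)\<^sup>2) * (a n w * cnj (b n w))) \<longlonglongrightarrow> (LINT w:ball (0::complex) 1|lborel. 0)"
  proof (rule set_integral_dominated_convergence(3)[where w = "\<lambda>_. C * D"])
    show "set_borel_measurable lborel (ball 0 1) (\<lambda>w. of_real (1 - (norm w)\<^sup>2) * (a n w * cnj (b n w)))" for n
    proof -
      define a' where "a' = (\<lambda>w. indicator (ball 0 1) w *\<^sub>R a n w)"
      define b' where "b' = (\<lambda>w. indicator (ball 0 1) w *\<^sub>R b n w)"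
      have [measurable]: "a' \<in> borel_measurable borel" "b' \<in> borel_measurable borel"
        using a b by (auto simp: set_borel_measurable_def a'_def b'_def)
      have "(\<lambda>w. of_real (1 - (norm w)\<^sup>2) * (a' w * cnj (b' w))) \<in> borel_measurable borel"
        by measurable
      also have "(\<lambda>w. of_real (1 - (norm w)\<^sup>2) * (a' w * cnj (b' w))) = (\<lambda>w. indicator (ball 0 1) w *\<^sub>R (of_real (1 - (norm w)\<^sup>2) * (a n w * cnj (b n w))))"
        by (auto simp: a'_def b'_def split: split_indicator)
      finally show ?thesis by (simp add: set_borel_measurable_def)
    qed
    show "set_integrable lborel (ball (0::complex) 1) (\<lambda>_. C * D)"
      by (intro set_integrable_disc_continuous continuous_intros)
    show "norm (of_real (1 - (norm w)\<^sup>2) * (a n w * cnj (b n w))) \<le> C * D" if w: "w \<in> ball 0 1" for n w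
    proof -
      have "0 \<le> 1 - (norm w)\<^sup>2" using w by (simp add: power_le_one)
      then have "norm (of_real (1 - (norm w)\<^sup>2) * (a n w * cnj (b n w))) = (1 - (norm w)\<^sup>2) * norm (a n w) * norm (b n w)"
        by (simp only: norm_mult norm_of_real abs_of_nonneg complex_mod_cnj mult.assoc)
      also have "\<dots> \<le> C * D"
        using aC[OF w, of n] bD[OF w, of n] \<open>0 \<le> C\<close> by (intro mult_mono) auto
      finally show ?thesis .
    qed
    show "(\<lambda>n. of_real (1 - (norm w)\<^sup>2) * (a n w * cnj (b n w))) \<longlonglongrightarrow> 0" if "w \<in> ball 0 1" for w
      using that bD by (intro tendsto_mult_right_zero tendsto_0_mult_bounded[of _ _ D] a0) auto
  qed
  then show ?thesis by simp
qed

text \<open>Bounded sequences that vanish inside the disc tend weakly to \<open>0\<close> on the circle. For a fixed \<open>Q\<close> the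
derivative \<open>deriv Q\<close> is bounded, so the area integral that replaces the circle integral has only one
unbounded factor and is dominated.\<close>

lemma integral_arclength_vanishing_tendsto_0:
  assumes P: "vanishing_seq P" and Q: "Q holomorphic_on ball 0 R" "1 < R"
  shows "(\<lambda>n. LINT w|arclength. P n w * cnj (Q w)) \<longlonglongrightarrow> 0"
proof -
  have P': "bounded_holomorphic_seq P" using P by (rule vanishing_seq_bounded)
  have Q': "bounded_holomorphic_seq (\<lambda>_. Q)" using Q by (rule bounded_holomorphic_seq_const)
  obtain C where C: "\<And>n w. norm w < 1 \<Longrightarrow> (1 - (norm w)\<^sup>2) * norm (deriv (P n) w) \<le> C"
    by (rule bounded_holomorphic_seq_bounds[OF P']) (rule that)
  obtain D where "\<And>w. w \<in> cball 0 1 \<Longrightarrow> norm (deriv Q w) \<le> D"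
    using compact_cball bounded_holomorphic_seq_continuous(2)[OF Q' order_refl]
    by (rule continuous_on_compact_bound) (rule that)
  then have D: "\<And>w. norm w \<le> 1 \<Longrightarrow> norm (deriv Q w) \<le> D" by simp
  have "(\<lambda>n. LINT w:ball 0 1|lborel. of_real (1 - (norm w)\<^sup>2) * (deriv (P n) w * cnj (deriv Q w))) \<longlonglongrightarrow> 0"
    using P C D
    by (intro LINT_disc_green_form_tendsto_0[where C = C and D = D] set_borel_measurable_disc
        bounded_holomorphic_seq_continuous[OF P'] bounded_holomorphic_seq_continuous[OF Q'] ball_subset_cball)
       (auto simp: vanishing_seq_def)
  from tendsto_diff[OF this LINT_disc_green_form_minus_circle_tendsto_0[OF P Q']]
  have "(\<lambda>n. pi * (LINT w|arclength. P n w * cnj (Q w))) \<longlonglongrightarrow> 0" by simp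
  from tendsto_mult_left[OF this, of "inverse (complex_of_real pi)"] show ?thesis
    by (simp add: mult.assoc[symmetric])
qed

text \<open>By the product rule \<open>w\<^sup>a P'\<close> is \<open>(w\<^sup>a P)'\<close> up to \<open>a w\<^sup>a\<^sup>-\<^sup>1 P\<close>. Such a correction is bounded and tends to
\<open>0\<close>, so it contributes nothing in the limit, and the unweighted statement applies to \<open>w\<^sup>a P\<close> and
\<open>w\<^sup>b Q\<close>.\<close>

lemma LINT_disc_weighted_green_form_minus_circle_tendsto_0:
  assumes P: "vanishing_seq P" and Q: "vanishing_seq Q"
  shows "(\<lambda>n. (LINT w:ball 0 1|lborel. of_real (1 - (norm w)\<^sup>2) * (w ^ a * deriv (P n) w * cnj (w ^ b * deriv (Q n) w))) -
      pi * (LINT w|arclength. (w ^ a * P n w) * cnj (w ^ b * Q n w))) \<longlonglongrightarrow> 0"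
proof -
  define A where "A = (\<lambda>n w. P n w * w ^ a)"
  define B where "B = (\<lambda>n w. Q n w * w ^ b)"
  define \<alpha> where "\<alpha> = (\<lambda>n w. P n w * (of_nat a * w ^ (a - 1)))"
  define \<beta> where "\<beta> = (\<lambda>n w. Q n w * (of_nat b * w ^ (b - 1)))"
  have P': "bounded_holomorphic_seq P" and Q': "bounded_holomorphic_seq Q"
    using P Q by (auto dest: vanishing_seq_bounded)
  have A: "vanishing_seq A" and B: "vanishing_seq B"
    unfolding A_def B_def using P Q by (auto intro: vanishing_seq_mult bounded_holomorphic_seq_power)
  note A' = vanishing_seq_bounded[OF A] and B' = vanishing_seq_bounded[OF B]
  have pow: "bounded_holomorphic_seq (\<lambda>_ w. of_nat k * w ^ (k - 1))" for k
    by (rule bounded_holomorphic_seq_const[of _ 2]) (auto intro!: holomorphic_intros)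
  have \<alpha>: "vanishing_seq \<alpha>" and \<beta>: "vanishing_seq \<beta>"
    unfolding \<alpha>_def \<beta>_def by (intro vanishing_seq_mult pow P Q)+
  note \<alpha>' = vanishing_seq_bounded[OF \<alpha>] and \<beta>' = vanishing_seq_bounded[OF \<beta>]
  have dpow: "deriv (\<lambda>w. w ^ k) w = of_nat k * w ^ (k - 1)" for k and w :: complex
    by (rule DERIV_imp_deriv) (auto intro!: derivative_eq_intros)
  have dA: "deriv (P n) w * w ^ a = deriv (A n) w - \<alpha> n w" if "norm w \<le> 1" for n w
    unfolding A_def \<alpha>_def using deriv_mult_bounded_holomorphic_seq[OF P' bounded_holomorphic_seq_power that]
    by (simp add: dpow)
  have dB: "deriv (Q n) w * w ^ b = deriv (B n) w - \<beta> n w" if "norm w \<le> 1" for n w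
    unfolding B_def \<beta>_def using deriv_mult_bounded_holomorphic_seq[OF Q' bounded_holomorphic_seq_power that]
    by (simp add: dpow)
  let ?J = "\<lambda>f g. (LINT w:ball 0 1|lborel. of_real (1 - (norm w)\<^sup>2) * (f w * cnj (g w)))"
  obtain CA where CA: "\<And>n w. norm w < 1 \<Longrightarrow> (1 - (norm w)\<^sup>2) * norm (deriv (A n) w) \<le> CA"
    by (rule bounded_holomorphic_seq_bounds[OF A']) (rule that)
  obtain CB where CB: "\<And>n w. norm w < 1 \<Longrightarrow> (1 - (norm w)\<^sup>2) * norm (deriv (B n) w) \<le> CB"
    by (rule bounded_holomorphic_seq_bounds[OF B']) (rule that)
  obtain C\<alpha> where C\<alpha>: "0 \<le> C\<alpha>" "\<And>n w. norm w \<le> 1 \<Longrightarrow> norm (\<alpha> n w) \<le> C\<alpha>"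
    by (rule bounded_holomorphic_seq_bounds[OF \<alpha>']) (rule that)
  obtain C\<beta> where C\<beta>: "0 \<le> C\<beta>" "\<And>n w. norm w \<le> 1 \<Longrightarrow> norm (\<beta> n w) \<le> C\<beta>"
    by (rule bounded_holomorphic_seq_bounds[OF \<beta>']) (rule that)
  note cont = bounded_holomorphic_seq_continuous[OF A'] bounded_holomorphic_seq_continuous[OF B']
    bounded_holomorphic_seq_continuous[OF \<alpha>'] bounded_holomorphic_seq_continuous[OF \<beta>']
  have 1: "(\<lambda>n. ?J (deriv (A n)) (\<beta> n)) \<longlonglongrightarrow> 0"
    using A CA C\<beta>
    by (intro LINT_disc_green_form_tendsto_0[where C = CA and D = C\<beta>] set_borel_measurable_disc cont ball_subset_cball)
       (auto simp: vanishing_seq_def)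
  have "(\<lambda>n. ?J (deriv (B n)) (\<alpha> n)) \<longlonglongrightarrow> 0"
    using B CB C\<alpha>
    by (intro LINT_disc_green_form_tendsto_0[where C = CB and D = C\<alpha>] set_borel_measurable_disc cont ball_subset_cball)
       (auto simp: vanishing_seq_def)
  then have "(\<lambda>n. cnj (?J (deriv (B n)) (\<alpha> n))) \<longlonglongrightarrow> 0"
    using tendsto_cnj by fastforce
  moreover have "cnj (?J (deriv (B n)) (\<alpha> n)) = ?J (\<alpha> n) (deriv (B n))" for n
    unfolding set_lebesgue_integral_def
    by (subst Bochner_Integration.integral_cnj[symmetric], intro Bochner_Integration.integral_cong) (auto simp: mult_ac)
  ultimately have 2: "(\<lambda>n. ?J (\<alpha> n) (deriv (B n))) \<longlonglongrightarrow> 0" by simp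
  have 3: "(\<lambda>n. ?J (\<alpha> n) (\<beta> n)) \<longlonglongrightarrow> 0"
  proof (intro LINT_disc_green_form_tendsto_0[where C = C\<alpha> and D = C\<beta>] set_borel_measurable_disc cont ball_subset_cball)
    show "(1 - (norm w)\<^sup>2) * norm (\<alpha> n w) \<le> C\<alpha>" if "w \<in> ball 0 1" for n w
    proof -
      have "(1 - (norm w)\<^sup>2) * norm (\<alpha> n w) \<le> 1 * norm (\<alpha> n w)"
        by (intro mult_right_mono) auto
      also have "\<dots> \<le> C\<alpha>" using C\<alpha>(2)[of w n] that by simp
      finally show ?thesis .
    qed
  qed (use \<alpha> C\<beta> in \<open>auto simp: vanishing_seq_def\<close>)
  have i: "set_integrable lborel (ball 0 1) (\<lambda>w. of_real (1 - (norm w)\<^sup>2) * (f w * cnj (g w)) :: complex)"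
    if "continuous_on (cball 0 1) f" "continuous_on (cball 0 1) g" for f g :: "complex \<Rightarrow> complex"
    using that by (intro set_integrable_disc_continuous continuous_intros)
  have eq: "(LINT w:ball 0 1|lborel. of_real (1 - (norm w)\<^sup>2) * (w ^ a * deriv (P n) w * cnj (w ^ b * deriv (Q n) w))) =
     ?J (deriv (A n)) (deriv (B n)) - ?J (deriv (A n)) (\<beta> n) - ?J (\<alpha> n) (deriv (B n)) + ?J (\<alpha> n) (\<beta> n)" for n
  proof -
    let ?lhs = "\<lambda>w. of_real (1 - (norm w)\<^sup>2) * (w ^ a * deriv (P n) w * cnj (w ^ b * deriv (Q n) w))"
    let ?rhs = "\<lambda>w. of_real (1 - (norm w)\<^sup>2) * (deriv (A n) w * cnj (deriv (B n) w)) -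
        of_real (1 - (norm w)\<^sup>2) * (deriv (A n) w * cnj (\<beta> n w)) -
        of_real (1 - (norm w)\<^sup>2) * (\<alpha> n w * cnj (deriv (B n) w)) +
        of_real (1 - (norm w)\<^sup>2) * (\<alpha> n w * cnj (\<beta> n w))"
    have "(LINT w:ball 0 1|lborel. ?lhs w) = (LINT w:ball 0 1|lborel. ?rhs w)"
    proof (rule set_lebesgue_integral_cong)
      show "\<forall>w. w \<in> ball 0 1 \<longrightarrow> ?lhs w = ?rhs w"
      proof (intro allI impI)
        fix w :: complex assume "w \<in> ball 0 1"
        then have w: "norm w \<le> 1" by simp
        show "?lhs w = ?rhs w"
          unfolding mult.commute[of "w ^ a"] mult.commute[of "w ^ b"] dA[OF w] dB[OF w]
          by (simp only: complex_cnj_diff ring_distribs) simp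
      qed
    qed simp
    also have "\<dots> = ?J (deriv (A n)) (deriv (B n)) - ?J (deriv (A n)) (\<beta> n) - ?J (\<alpha> n) (deriv (B n)) + ?J (\<alpha> n) (\<beta> n)"
      by (simp only: set_integral_add set_integral_diff i cont order_refl)
    finally show ?thesis .
  qed
  have "(\<lambda>n. (?J (deriv (A n)) (deriv (B n)) - pi * (LINT w|arclength. A n w * cnj (B n w))) - ?J (deriv (A n)) (\<beta> n) - ?J (\<alpha> n) (deriv (B n)) + ?J (\<alpha> n) (\<beta> n)) \<longlonglongrightarrow> 0 - 0 - 0 + 0"
    by (intro tendsto_intros 1 2 3 LINT_disc_green_form_minus_circle_tendsto_0 A B')
  moreover have "A n w * cnj (B n w) = (w ^ a * P n w) * cnj (w ^ b * Q n w)" for n w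
    by (simp add: A_def B_def mult_ac)
  ultimately show ?thesis
    unfolding eq by (simp add: algebra_simps)
qed

section \<open>Sequences whose modulus tends to an indicator on the circle\<close>

lemma norm_integral_diff_le:
  fixes f g :: "'a \<Rightarrow> 'b::{banach, second_countable_topology}"
  assumes "integrable M f" "integrable M g" "integrable M u"
    and "\<And>x. x \<in> space M \<Longrightarrow> norm (f x - g x) \<le> u x"
  shows "norm (integral\<^sup>L M f - integral\<^sup>L M g) \<le> integral\<^sup>L M u"
proof -
  have "norm (integral\<^sup>L M (\<lambda>x. f x - g x)) \<le> integral\<^sup>L M u"
    by (rule order_trans[OF Bochner_Integration.integral_norm_bound], rule Bochner_Integration.integral_mono) (use assms in auto)
  then show ?thesis using assms by simp
qed

text \<open>The properties of \<open>h\<^sub>\<nu>(w) = g(r\<^sub>\<nu> w)\<^sup>\<nu>\<close> that determine the limit of its graphs. The last one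
encodes that \<open>r\<^sub>\<nu>\<close> tends to \<open>1\<close> fast enough; if \<open>I\<close> were the whole circle, it would say that \<open>h\<close> is
asymptotically an inner function.\<close>

locale asymptotically_inner_seq =
  fixes h :: "nat \<Rightarrow> complex \<Rightarrow> complex" and I :: "complex set"
  assumes vanishing: "vanishing_seq h"
    and norm_le_1: "norm w \<le> 1 \<Longrightarrow> norm (h n w) \<le> 1"
    and I_sets: "I \<in> sets arclength"
    and modulus: "(\<lambda>n. LINT w|arclength. \<bar>(norm (h n w))\<^sup>2 - indicator I w\<bar>) \<longlonglongrightarrow> 0"
begin

lemma bounded_holo: "bounded_holomorphic_seq h"
  by (rule vanishing_seq_bounded[OF vanishing])

lemmas continuous = bounded_holomorphic_seq_continuous[OF bounded_holo]

lemma integrable_indicator_mult: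
  assumes "continuous_on (sphere 0 1) f"
  shows "integrable arclength (\<lambda>w. indicator I w *\<^sub>R f w :: complex)"
  using I_sets integrable_arclength_continuous[OF assms] by (rule integrable_mult_indicator)

abbreviation defect :: "nat \<Rightarrow> complex \<Rightarrow> real" where
  "defect n w \<equiv> \<bar>(norm (h n w))\<^sup>2 - indicator I w\<bar>"

lemma integrable_defect: "integrable arclength (defect n)"
proof -
  have "integrable arclength (\<lambda>w. (norm (h n w))\<^sup>2)"
    by (intro integrable_arclength_continuous continuous_intros continuous) auto
  moreover have "integrable arclength (indicator I :: complex \<Rightarrow> real)"
    using I_sets arclength.emeasure_finite by (intro integrable_real_indicator) (auto simp: less_top[symmetric])
  ultimately show ?thesis by auto
qed

lemma norm_circle_monomial: "norm w = 1 \<Longrightarrow> norm (w ^ a * cnj w ^ b) = 1" for w :: complex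
  by (simp add: norm_mult norm_power)

text \<open>The indicator of \<open>I\<close> is not the boundary value of a holomorphic function, but it is \<open>L\<^sup>1\<close>-close to
\<open>h m * cnj (h m)\<close> for a large fixed \<open>m\<close>, and each factor can be moved to one side of the pairing.\<close>

lemma weighted_power_on_I_tendsto_0:
  assumes "0 < k"
  shows "(\<lambda>n. LINT w|arclength. indicator I w *\<^sub>R (w ^ a * cnj w ^ b * h n w ^ k)) \<longlonglongrightarrow> 0"
proof (rule LIMSEQ_I)
  fix e :: real assume "0 < e"
  then have "\<forall>\<^sub>F m in sequentially. (LINT w|arclength. defect m w) < e / 2"
    by (intro order_tendstoD(2)[OF modulus]) auto
  then obtain m where m: "(LINT w|arclength. defect m w) < e / 2"
    by (auto simp: eventually_sequentially)
  \<comment> \<open>The indicator is replaced by the square modulus of the fixed function \<open>h m\<close>.\<close>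
  let ?A = "\<lambda>n w. w ^ a * cnj w ^ b * h n w ^ k * of_real ((norm (h m w))\<^sup>2)"
  obtain k' where k': "k = Suc k'" using assms by (auto simp: gr0_conv_Suc)
  obtain R where R: "1 < R" "h m holomorphic_on ball 0 R"
    using bounded_holo by (rule bounded_holomorphic_seq_holomorphic)
  have hm: "bounded_holomorphic_seq (\<lambda>_. h m)"
    by (rule bounded_holomorphic_seq_const[OF R(2,1)])
  have "vanishing_seq (\<lambda>n w. h n w ^ k * (w ^ a * h m w))"
    unfolding k' by (intro vanishing_seq_mult vanishing_seq_power vanishing bounded_holomorphic_seq_mult
        bounded_holomorphic_seq_power hm)
  moreover have "(\<lambda>w. w ^ b * h m w) holomorphic_on ball 0 R"
    using R by (intro holomorphic_intros)
  ultimately have "(\<lambda>n. LINT w|arclength. (h n w ^ k * (w ^ a * h m w)) * cnj (w ^ b * h m w)) \<longlonglongrightarrow> 0"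
    using R(1) by (intro integral_arclength_vanishing_tendsto_0)
  also have "(\<lambda>n w. (h n w ^ k * (w ^ a * h m w)) * cnj (w ^ b * h m w)) = ?A"
    unfolding complex_norm_square by (simp add: mult_ac)
  finally have "(\<lambda>n. LINT w|arclength. ?A n w) \<longlonglongrightarrow> 0" .
  then have "\<forall>\<^sub>F n in sequentially. norm (LINT w|arclength. ?A n w) < e / 2"
    using \<open>0 < e\<close> by (intro order_tendstoD(2)[OF tendsto_norm_zero]) auto
  then obtain N where N: "\<And>n. n \<ge> N \<Longrightarrow> norm (LINT w|arclength. ?A n w) < e / 2"
    by (auto simp: eventually_sequentially)
  have "norm ((LINT w|arclength. indicator I w *\<^sub>R (w ^ a * cnj w ^ b * h n w ^ k)) - (LINT w|arclength. ?A n w))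
      \<le> (LINT w|arclength. defect m w)" for n
  proof (rule norm_integral_diff_le)
    show "integrable arclength (\<lambda>w. indicator I w *\<^sub>R (w ^ a * cnj w ^ b * h n w ^ k))"
      by (intro integrable_indicator_mult continuous_intros continuous) auto
    show "integrable arclength (?A n)"
      by (intro integrable_arclength_continuous continuous_intros continuous) auto
    show "integrable arclength (defect m)" by (rule integrable_defect)
    fix w assume "w \<in> space arclength"
    then have w: "norm w = 1" by simp
    have "indicator I w *\<^sub>R (w ^ a * cnj w ^ b * h n w ^ k) - ?A n w =
       (w ^ a * cnj w ^ b) * h n w ^ k * of_real (indicator I w - (norm (h m w))\<^sup>2)"
      by (simp add: scaleR_conv_of_real algebra_simps)
    also have "norm \<dots> = norm (h n w) ^ k * defect m w"
      by (simp only: norm_mult[of "(w ^ a * cnj w ^ b) * h n w ^ k"] norm_mult[of "w ^ a * cnj w ^ b"] norm_circle_monomial[OF w] norm_power norm_of_real) (simp add: abs_minus_commute)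
    also have "\<dots> \<le> 1 * defect m w"
      using norm_le_1[of w n] w by (intro mult_right_mono power_le_one) auto
    finally show "norm (indicator I w *\<^sub>R (w ^ a * cnj w ^ b * h n w ^ k) - ?A n w) \<le> defect m w" by simp
  qed
  then have close: "norm (LINT w|arclength. indicator I w *\<^sub>R (w ^ a * cnj w ^ b * h n w ^ k))
      \<le> norm (LINT w|arclength. ?A n w) + (LINT w|arclength. defect m w)" for n
    by (rule order_trans[OF norm_triangle_sub add_left_mono])
  have "norm (LINT w|arclength. indicator I w *\<^sub>R (w ^ a * cnj w ^ b * h n w ^ k)) < e" if "n \<ge> N" for n
    using close[of n] N[OF that] m by linarith
  then show "\<exists>N. \<forall>n\<ge>N. norm ((LINT w|arclength. indicator I w *\<^sub>R (w ^ a * cnj w ^ b * h n w ^ k)) - 0) < e"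
    by auto
qed

text \<open>On the circle the integrand is \<open>w\<^sup>a cnj w\<^sup>b h\<^sup>k \<bar>h\<bar>\<^sup>2\<^sup>(\<^sup>d\<^sup>+\<^sup>1\<^sup>)\<close> with \<open>k = c - d\<close>, and \<open>\<bar>h\<bar>\<^sup>2\<^sup>(\<^sup>d\<^sup>+\<^sup>1\<^sup>)\<close> tends in
\<open>L\<^sup>1\<close> to the indicator of \<open>I\<close>. The case \<open>c < d\<close> follows by conjugation.\<close>

lemma circle_moments_tendsto:
  "(\<lambda>n. LINT w|arclength. w ^ a * h n w ^ Suc c * cnj (w ^ b * h n w ^ Suc d)) \<longlonglongrightarrow>
     (if c = d then LINT w:I|arclength. w ^ a * cnj w ^ b else 0)"
proof -
  have *: "(\<lambda>n. LINT w|arclength. w ^ a * h n w ^ Suc (d + k) * cnj (w ^ b * h n w ^ Suc d)) \<longlonglongrightarrow>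
     (if k = 0 then LINT w:I|arclength. w ^ a * cnj w ^ b else 0)" for a b d k
  proof -
    let ?T = "\<lambda>n w. w ^ a * h n w ^ Suc (d + k) * cnj (w ^ b * h n w ^ Suc d)"
    let ?S = "\<lambda>n w. indicator I w *\<^sub>R (w ^ a * cnj w ^ b * h n w ^ k)"
    have T: "?T n w = w ^ a * cnj w ^ b * h n w ^ k * of_real (((norm (h n w))\<^sup>2) ^ Suc d)" for n w
      unfolding of_real_power[of _ "Suc d"] complex_norm_square
      by (simp add: power_mult_distrib power_add mult_ac)
    have "norm ((LINT w|arclength. ?T n w) - (LINT w|arclength. ?S n w)) \<le> (LINT w|arclength. Suc d * defect n w)" for n
    proof (rule norm_integral_diff_le)
      show "integrable arclength (?T n)"
        by (intro integrable_arclength_continuous continuous_intros continuous) auto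
      show "integrable arclength (?S n)"
        by (intro integrable_indicator_mult continuous_intros continuous) auto
      show "integrable arclength (\<lambda>w. Suc d * defect n w)"
        by (intro integrable_mult_right integrable_defect)
      fix w assume "w \<in> space arclength"
      then have w: "norm w = 1" by simp
      have ind: "(indicator I w :: real) = indicator I w ^ Suc d" by (simp split: split_indicator)
      have "?T n w - ?S n w = (w ^ a * cnj w ^ b) * h n w ^ k * of_real (((norm (h n w))\<^sup>2) ^ Suc d - indicator I w)"
        unfolding T by (simp add: scaleR_conv_of_real algebra_simps)
      also have "norm \<dots> = norm (h n w) ^ k * \<bar>((norm (h n w))\<^sup>2) ^ Suc d - indicator I w\<bar>"
        by (simp only: norm_mult[of "(w ^ a * cnj w ^ b) * h n w ^ k"] norm_mult[of "w ^ a * cnj w ^ b"] norm_circle_monomial[OF w] norm_power norm_of_real mult_1_left)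
      also have "\<dots> \<le> 1 * (Suc d * defect n w)"
      proof (rule mult_mono)
        show "norm (h n w) ^ k \<le> 1" using norm_le_1[of w n] w by (intro power_le_one) auto
        have "norm (h n w) \<le> 1" using norm_le_1[of w n] w by simp
        then show "\<bar>((norm (h n w))\<^sup>2) ^ Suc d - indicator I w\<bar> \<le> Suc d * defect n w"
          using norm_power_diff[of "(norm (h n w))\<^sup>2" "indicator I w :: real" "Suc d"]
          unfolding ind[symmetric] real_norm_def by (simp add: power_le_one split: split_indicator)
      qed auto
      finally show "norm (?T n w - ?S n w) \<le> Suc d * defect n w" by simp
    qed
    then have bound: "\<forall>n. norm ((LINT w|arclength. ?T n w) - (LINT w|arclength. ?S n w)) \<le> (LINT w|arclength. Suc d * defect n w)"
      by (rule allI)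
    have "(\<lambda>n. LINT w|arclength. Suc d * defect n w) \<longlonglongrightarrow> 0"
      using tendsto_mult_left[OF modulus, of "real (Suc d)"] by (simp only: integral_mult_right_zero mult_zero_right)
    then have "(\<lambda>n. (LINT w|arclength. ?T n w) - (LINT w|arclength. ?S n w)) \<longlonglongrightarrow> 0"
      by (rule Lim_null_comparison[OF always_eventually[OF bound]])
    moreover have "(\<lambda>n. LINT w|arclength. ?S n w) \<longlonglongrightarrow> (if k = 0 then LINT w:I|arclength. w ^ a * cnj w ^ b else 0)"
      using weighted_power_on_I_tendsto_0[of k a b]
      by (cases "k = 0") (simp_all add: set_lebesgue_integral_def)
    ultimately have "(\<lambda>n. ((LINT w|arclength. ?T n w) - (LINT w|arclength. ?S n w)) + (LINT w|arclength. ?S n w)) \<longlonglongrightarrow>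
        0 + (if k = 0 then LINT w:I|arclength. w ^ a * cnj w ^ b else 0)"
      by (rule tendsto_add)
    then show ?thesis by simp
  qed
  show ?thesis
  proof (cases "d \<le> c")
    case True
    then show ?thesis using *[of a d "c - d" b] by (auto split: if_splits)
  next
    case False
    then have "(\<lambda>n. LINT w|arclength. w ^ b * h n w ^ Suc d * cnj (w ^ a * h n w ^ Suc c)) \<longlonglongrightarrow> 0"
      using *[of b c "d - c" a] by (auto split: if_splits)
    then have "(\<lambda>n. cnj (LINT w|arclength. w ^ b * h n w ^ Suc d * cnj (w ^ a * h n w ^ Suc c))) \<longlonglongrightarrow> cnj 0"
      by (rule tendsto_cnj)
    then show ?thesis
      using False unfolding Bochner_Integration.integral_cnj[symmetric] by (simp add: mult_ac)
  qed
qed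

text \<open>In the variable \<open>\<xi> = h n w\<close> the factor \<open>\<bar>deriv (h n) w\<bar>\<^sup>2\<close> is the Jacobian, so this integrates \<open>\<Psi>\<close> over the graph
of \<open>h n\<close> with the weight \<open>1 - \<bar>w\<bar>\<^sup>2\<close> and the area of the second coordinate.\<close>

definition energy_pairing :: "nat \<Rightarrow> (complex \<times> complex \<Rightarrow> complex) \<Rightarrow> complex" where
  "energy_pairing n \<Psi> = (LINT w:ball 0 1|lborel. of_real ((1 - (norm w)\<^sup>2) * (norm (deriv (h n) w))\<^sup>2) * \<Psi> (w, h n w))"

text \<open>The factor \<open>2\<close> accounts for \<open>1 - \<bar>w\<bar>\<^sup>2\<close> being asymptotic to \<open>2 green 0 w\<close> at the circle.\<close>

definition fibre_pairing :: "(complex \<times> complex \<Rightarrow> complex) \<Rightarrow> complex" where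
  "fibre_pairing \<Psi> = 2 * (LINT w:I|arclength. LINT \<xi>:ball 0 1|lborel. of_real (green 0 \<xi>) * \<Psi> (w, \<xi>))"

text \<open>Here \<open>h\<^sup>c h'\<close> is the derivative of \<open>h\<^sup>c\<^sup>+\<^sup>1 / (c + 1)\<close>, so the energy of a monomial is a circle moment
divided by \<open>(c + 1) (d + 1)\<close>. For \<open>c = d\<close> this matches twice the Green integral of \<open>\<bar>\<xi>\<bar>\<^sup>2\<^sup>c\<close>,
which is \<open>\<pi> / (c + 1)\<^sup>2\<close>.\<close>

lemma energy_pairing_monomial_tendsto:
  "(\<lambda>n. energy_pairing n (\<lambda>(w, \<xi>). w ^ a * cnj w ^ b * \<xi> ^ c * cnj \<xi> ^ d)) \<longlonglongrightarrow> fibre_pairing (\<lambda>(w, \<xi>). w ^ a * cnj w ^ b * \<xi> ^ c * cnj \<xi> ^ d)"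
proof -
  let ?P = "\<lambda>c n w. h n w ^ Suc c"
  have dP: "deriv (?P c n) w = of_nat (Suc c) * h n w ^ c * deriv (h n) w" if "norm w \<le> 1" for c n w
    using DERIV_power[OF bounded_holomorphic_seq_field_derivative[OF bounded_holo that, of n], where n = "Suc c"]
    by (intro DERIV_imp_deriv) (simp add: mult_ac del: of_nat_Suc)
  let ?N = "of_nat (Suc c) * of_nat (Suc d) :: complex"
  have nz: "?N \<noteq> 0" by (simp del: of_nat_Suc)
  let ?K = "\<lambda>n. (LINT w:ball 0 1|lborel. of_real (1 - (norm w)\<^sup>2) * (w ^ a * deriv (?P c n) w * cnj (w ^ b * deriv (?P d n) w)))"
  have K: "?K n = ?N * energy_pairing n (\<lambda>(w, \<xi>). w ^ a * cnj w ^ b * \<xi> ^ c * cnj \<xi> ^ d)" for n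
  proof -
    have "of_real (1 - (norm w)\<^sup>2) * (w ^ a * deriv (?P c n) w * cnj (w ^ b * deriv (?P d n) w)) =
      ?N * (of_real ((1 - (norm w)\<^sup>2) * (norm (deriv (h n) w))\<^sup>2) * (w ^ a * cnj w ^ b * h n w ^ c * cnj (h n w) ^ d))"
      if "w \<in> ball 0 1" for w
    proof -
      have w: "norm w \<le> 1" using that by simp
      show ?thesis
        unfolding dP[OF w] of_real_mult complex_norm_square[of "deriv (h n) w"]
        by (simp add: mult_ac del: of_nat_Suc of_real_diff)
    qed
    then have "?K n = (LINT w:ball 0 1|lborel. ?N * (of_real ((1 - (norm w)\<^sup>2) * (norm (deriv (h n) w))\<^sup>2) * (w ^ a * cnj w ^ b * h n w ^ c * cnj (h n w) ^ d)))"
      by (intro set_lebesgue_integral_cong) auto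
    then show ?thesis by (simp only: set_integral_mult_right energy_pairing_def prod.case)
  qed
  have "(\<lambda>n. (?K n - pi * (LINT w|arclength. w ^ a * h n w ^ Suc c * cnj (w ^ b * h n w ^ Suc d))) +
       pi * (LINT w|arclength. w ^ a * h n w ^ Suc c * cnj (w ^ b * h n w ^ Suc d))) \<longlonglongrightarrow>
     0 + pi * (if c = d then LINT w:I|arclength. w ^ a * cnj w ^ b else 0)"
    by (intro tendsto_add tendsto_mult_left circle_moments_tendsto
        LINT_disc_weighted_green_form_minus_circle_tendsto_0 vanishing_seq_power vanishing)
  then have "(\<lambda>n. inverse ?N * ?K n) \<longlonglongrightarrow> inverse ?N * (pi * (if c = d then LINT w:I|arclength. w ^ a * cnj w ^ b else 0))"
    by (intro tendsto_mult_left) simp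
  also have "(\<lambda>n. inverse ?N * ?K n) = (\<lambda>n. energy_pairing n (\<lambda>(w, \<xi>). w ^ a * cnj w ^ b * \<xi> ^ c * cnj \<xi> ^ d))"
  proof -
    have "inverse N * (N * x) = x" if "N \<noteq> 0" for N x :: complex
      using that by simp
    from this[OF nz] show ?thesis unfolding K by (simp only:)
  qed
  also have "inverse ?N * (pi * (if c = d then LINT w:I|arclength. w ^ a * cnj w ^ b else 0)) =
     fibre_pairing (\<lambda>(w, \<xi>). w ^ a * cnj w ^ b * \<xi> ^ c * cnj \<xi> ^ d)"
  proof -
    have "(LINT \<xi>:ball 0 1|lborel. of_real (green 0 \<xi>) * (w ^ a * cnj w ^ b * \<xi> ^ c * cnj \<xi> ^ d)) =
        w ^ a * cnj w ^ b * (if c = d then of_real (pi / (2 * (Suc c)\<^sup>2)) else 0)" for w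
    proof -
      have "(LINT \<xi>:ball 0 1|lborel. of_real (green 0 \<xi>) * (w ^ a * cnj w ^ b * \<xi> ^ c * cnj \<xi> ^ d)) =
        (LINT \<xi>:ball 0 1|lborel. w ^ a * cnj w ^ b * (of_real (green 0 \<xi>) * (\<xi> ^ c * cnj \<xi> ^ d)))"
        by (simp add: mult_ac)
      also have "\<dots> = w ^ a * cnj w ^ b * (LINT \<xi>:ball 0 1|lborel. of_real (green 0 \<xi>) * (\<xi> ^ c * cnj \<xi> ^ d))"
        by (rule set_integral_mult_right)
      finally show ?thesis unfolding LINT_disc_green_power .
    qed
    then have "fibre_pairing (\<lambda>(w, \<xi>). w ^ a * cnj w ^ b * \<xi> ^ c * cnj \<xi> ^ d) =
      2 * ((LINT w:I|arclength. w ^ a * cnj w ^ b) * (if c = d then of_real (pi / (2 * (Suc c)\<^sup>2)) else 0))"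
      unfolding fibre_pairing_def prod.case by (simp only: set_integral_mult_left)
    also have "\<dots> = inverse ?N * (pi * (if c = d then LINT w:I|arclength. w ^ a * cnj w ^ b else 0))"
    proof -
      define x :: complex where "x = of_nat (Suc c)"
      have "complex_of_real (pi / (2 * (Suc c)\<^sup>2)) = pi / (2 * x\<^sup>2)"
        unfolding x_def by (simp only: of_nat_mult of_nat_power of_nat_numeral of_real_divide of_real_mult of_real_power
            of_real_of_nat_eq of_real_numeral)
      moreover have "x \<noteq> 0" unfolding x_def by (simp del: of_nat_Suc)
      moreover have "2 * (S * (pi / (2 * x\<^sup>2))) = inverse (x * x) * (pi * S)" if "x \<noteq> 0" for x S :: complex
        using that by (simp add: field_simps power2_eq_square)
      ultimately show ?thesis
        by (cases "c = d") (simp_all only: x_def if_True if_False mult_zero_right refl)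
    qed
    finally show ?thesis ..
  qed
  finally show ?thesis .
qed

end

section \<open>From monomials to continuous test functions\<close>

text \<open>Polynomials in the two coordinates and their conjugates, generated as sums of monomials, so that
additive statements about them need only be checked on monomials.\<close>

inductive conj_polynomial :: "(complex \<times> complex \<Rightarrow> complex) \<Rightarrow> bool" where
  monomial: "conj_polynomial (\<lambda>(w, \<xi>). k * (w ^ a * cnj w ^ b * \<xi> ^ c * cnj \<xi> ^ d))"
| add: "conj_polynomial p \<Longrightarrow> conj_polynomial q \<Longrightarrow> conj_polynomial (\<lambda>x. p x + q x)"

lemma conj_polynomial_mult:
  assumes "conj_polynomial p" "conj_polynomial q"
  shows "conj_polynomial (\<lambda>x. p x * q x)"
  using assms(1)
proof induction
  case (monomial k a b c d)
  show ?case
    using assms(2)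
  proof induction
    case (monomial k' a' b' c' d')
    have "(\<lambda>x. (case x of (w, \<xi>) \<Rightarrow> k * (w ^ a * cnj w ^ b * \<xi> ^ c * cnj \<xi> ^ d)) *
        (case x of (w, \<xi>) \<Rightarrow> k' * (w ^ a' * cnj w ^ b' * \<xi> ^ c' * cnj \<xi> ^ d'))) =
      (\<lambda>(w, \<xi>). (k * k') * (w ^ (a + a') * cnj w ^ (b + b') * \<xi> ^ (c + c') * cnj \<xi> ^ (d + d')))"
      by (auto simp: power_add)
    then show ?case by (simp only: conj_polynomial.monomial)
  next
    case (add p q)
    from add.IH show ?case unfolding ring_distribs by (rule conj_polynomial.add)
  qed
next
  case (add p q)
  from add.IH show ?case unfolding ring_distribs by (rule conj_polynomial.add)
qed

lemma conj_polynomial_const: "conj_polynomial (\<lambda>_. k)"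
  using conj_polynomial.monomial[of k 0 0 0 0] by (simp add: case_prod_unfold)

lemma conj_polynomial_cmult: "conj_polynomial p \<Longrightarrow> conj_polynomial (\<lambda>x. k * p x)"
  by (rule conj_polynomial_mult[OF conj_polynomial_const])

lemma conj_polynomial_coordinates:
  "conj_polynomial (\<lambda>x. fst x)" "conj_polynomial (\<lambda>x. cnj (fst x))"
  "conj_polynomial (\<lambda>x. snd x)" "conj_polynomial (\<lambda>x. cnj (snd x))"
  using conj_polynomial.monomial[of 1 1 0 0 0] conj_polynomial.monomial[of 1 0 1 0 0]
    conj_polynomial.monomial[of 1 0 0 1 0] conj_polynomial.monomial[of 1 0 0 0 1]
  by (simp_all add: case_prod_unfold)

text \<open>The real coordinates are \<open>(z + cnj z) / 2\<close> and \<open>(z - cnj z) / (2 \<i>)\<close>.\<close>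

lemma conj_polynomial_real_polynomial_function:
  assumes "real_polynomial_function f"
  shows "conj_polynomial (\<lambda>x. of_real (f x))"
  using assms
proof induction
  case (linear f)
  interpret f: bounded_linear f by fact
  have f: "complex_of_real (f x) =
      (of_real (f (1, 0)) - \<i> * of_real (f (\<i>, 0))) / 2 * fst x + (of_real (f (1, 0)) + \<i> * of_real (f (\<i>, 0))) / 2 * cnj (fst x) +
      ((of_real (f (0, 1)) - \<i> * of_real (f (0, \<i>))) / 2 * snd x + (of_real (f (0, 1)) + \<i> * of_real (f (0, \<i>))) / 2 * cnj (snd x))" for x
  proof -
    have "x = Re (fst x) *\<^sub>R (1, 0) + Im (fst x) *\<^sub>R (\<i>, 0) + Re (snd x) *\<^sub>R (0, 1) + Im (snd x) *\<^sub>R (0, \<i>)"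
      by (simp add: prod_eq_iff complex_eq_iff)
    then have "f x = f (Re (fst x) *\<^sub>R (1, 0) + Im (fst x) *\<^sub>R (\<i>, 0) + Re (snd x) *\<^sub>R (0, 1) + Im (snd x) *\<^sub>R (0, \<i>))"
      by (rule arg_cong)
    also have "\<dots> = Re (fst x) * f (1, 0) + Im (fst x) * f (\<i>, 0) + Re (snd x) * f (0, 1) + Im (snd x) * f (0, \<i>)"
      by (simp only: f.add f.scaleR real_scaleR_def)
    finally have fx: "f x = Re (fst x) * f (1, 0) + Im (fst x) * f (\<i>, 0) + Re (snd x) * f (0, 1) + Im (snd x) * f (0, \<i>)" .
    show ?thesis unfolding fx by (simp add: complex_eq_iff field_simps)
  qed
  show ?case
    by (rule back_subst[where P = conj_polynomial, OF _ ext[OF f[symmetric]]])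
       (intro conj_polynomial.add conj_polynomial_cmult conj_polynomial_coordinates)
next
  case (const c)
  show ?case by (rule conj_polynomial_const)
next
  case (add f g)
  then show ?case unfolding of_real_add by (intro conj_polynomial.add)
next
  case (mult f g)
  then show ?case unfolding of_real_mult by (intro conj_polynomial_mult)
qed

lemma conj_polynomial_polynomial_function:
  fixes p :: "complex \<times> complex \<Rightarrow> complex"
  assumes "polynomial_function p"
  shows "conj_polynomial p"
proof -
  have "real_polynomial_function (Re \<circ> p)" "real_polynomial_function (Im \<circ> p)"
    using assms bounded_linear_Re bounded_linear_Im by (auto simp: polynomial_function_def)
  then have "conj_polynomial (\<lambda>x. of_real ((Re \<circ> p) x) + \<i> * of_real ((Im \<circ> p) x))"
    by (intro conj_polynomial.add conj_polynomial_cmult conj_polynomial_real_polynomial_function)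
  also have "(\<lambda>x. of_real ((Re \<circ> p) x) + \<i> * of_real ((Im \<circ> p) x)) = p"
    by (simp add: fun_eq_iff complex_eq_iff)
  finally show ?thesis .
qed

lemma conj_polynomial_continuous: "conj_polynomial p \<Longrightarrow> continuous_on S p"
  by (induction rule: conj_polynomial.induct) (auto intro!: continuous_intros simp: case_prod_unfold)

lemma conj_polynomial_approximation:
  assumes "continuous_on (cball 0 1 \<times> cball 0 1) \<Psi>" "0 < e"
  obtains p where "conj_polynomial p" "\<And>x. x \<in> cball 0 1 \<times> cball 0 1 \<Longrightarrow> norm (\<Psi> x - p x) < e"
proof -
  have "compact (cball (0::complex) 1 \<times> cball (0::complex) 1)" by (intro compact_Times compact_cball)
  from Stone_Weierstrass_polynomial_function[OF this assms] conj_polynomial_polynomial_function that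
  show thesis by blast
qed

lemma green_0_nonneg: "norm w < 1 \<Longrightarrow> 0 \<le> green 0 w"
  by (cases "w = 0") (auto simp: green_def disc_aut_def)

lemma LINT_green_0: "(LINT \<xi>:ball 0 1|lborel. green 0 \<xi>) = pi / 2"
proof -
  have "complex_of_real (LINT \<xi>:ball 0 1|lborel. green 0 \<xi>) = of_real (pi / 2)"
    using LINT_disc_green_power[of 0 0] by (simp add: set_integral_complex_of_real)
  then show ?thesis by (simp only: of_real_eq_iff)
qed

text \<open>The inner integral of the second term of the limit current.\<close>

definition green_fibre :: "(complex \<times> complex \<Rightarrow> complex) \<Rightarrow> complex \<Rightarrow> complex" where
  "green_fibre \<Psi> w = (LINT \<xi>:ball 0 1|lborel. of_real (green 0 \<xi>) * \<Psi> (w, \<xi>))"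

lemma bounded_on_bidisc:
  fixes \<Psi> :: "complex \<times> complex \<Rightarrow> complex"
  assumes "continuous_on (cball 0 1 \<times> cball 0 1) \<Psi>"
  obtains M where "0 \<le> M" "\<And>w \<xi>. norm w \<le> 1 \<Longrightarrow> norm \<xi> \<le> 1 \<Longrightarrow> norm (\<Psi> (w, \<xi>)) \<le> M"
proof -
  obtain M where "0 \<le> M" and M: "\<And>x. x \<in> cball 0 1 \<times> cball 0 1 \<Longrightarrow> norm (\<Psi> x) \<le> M"
    using compact_Times[OF compact_cball compact_cball] assms by (rule continuous_on_compact_bound) (rule that)
  then show thesis by (intro that[of M]) auto
qed

lemma borel_measurable_green [measurable]: "green z0 \<in> borel_measurable borel"
  unfolding green_def disc_aut_def by measurable

lemma set_borel_measurable_green_mult: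
  fixes f :: "complex \<Rightarrow> complex"
  assumes "continuous_on (ball 0 1) f"
  shows "set_borel_measurable lborel (ball 0 1) (\<lambda>\<xi>. of_real (green z0 \<xi>) * f \<xi>)"
proof -
  define f' where "f' = (\<lambda>w. indicator (ball 0 1) w *\<^sub>R f w)"
  have [measurable]: "f' \<in> borel_measurable borel"
    using set_borel_measurable_disc[OF assms] by (simp add: set_borel_measurable_def f'_def)
  have "(\<lambda>\<xi>. complex_of_real (green z0 \<xi>) * f' \<xi>) \<in> borel_measurable borel"
    by measurable
  also have "(\<lambda>\<xi>. complex_of_real (green z0 \<xi>) * f' \<xi>) = (\<lambda>\<xi>. indicator (ball 0 1) \<xi> *\<^sub>R (of_real (green z0 \<xi>) * f \<xi>))"
    by (auto simp: f'_def split: split_indicator)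
  finally show ?thesis by (simp add: set_borel_measurable_def)
qed

lemma continuous_on_slice:
  fixes \<Psi> :: "complex \<times> complex \<Rightarrow> complex"
  assumes "continuous_on (cball 0 1 \<times> cball 0 1) \<Psi>" "norm w \<le> 1" "S \<subseteq> cball 0 1"
  shows "continuous_on S (\<lambda>\<xi>. \<Psi> (w, \<xi>))"
  by (rule continuous_on_compose2[OF assms(1)]) (use assms(2,3) in \<open>auto intro!: continuous_intros\<close>)

lemma set_integrable_green_fibre:
  fixes \<Psi> :: "complex \<times> complex \<Rightarrow> complex"
  assumes "continuous_on (cball 0 1 \<times> cball 0 1) \<Psi>" "norm w \<le> 1"
  shows "set_integrable lborel (ball 0 1) (\<lambda>\<xi>. of_real (green 0 \<xi>) * \<Psi> (w, \<xi>))"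
proof -
  obtain M where M: "0 \<le> M" "\<And>w \<xi>. norm w \<le> 1 \<Longrightarrow> norm \<xi> \<le> 1 \<Longrightarrow> norm (\<Psi> (w, \<xi>)) \<le> M"
    using bounded_on_bidisc[OF assms(1)] by blast
  have "set_integrable lborel (ball 0 1) (\<lambda>\<xi>. green 0 \<xi> * M)"
    using set_integrable_green_0 by (rule set_integrable_mult_left[rule_format]) 
  then show ?thesis
  proof (rule set_integrable_bound)
    show "set_borel_measurable lborel (ball 0 1) (\<lambda>\<xi>. of_real (green 0 \<xi>) * \<Psi> (w, \<xi>))"
      by (intro set_borel_measurable_green_mult continuous_on_slice assms ball_subset_cball)
    show "AE \<xi> in lborel. \<xi> \<in> ball 0 1 \<longrightarrow> norm (of_real (green 0 \<xi>) * \<Psi> (w, \<xi>)) \<le> norm (green 0 \<xi> * M)"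
      using M assms(2) by (intro AE_I2 impI) (auto simp: norm_mult abs_mult intro!: mult_left_mono)
  qed
qed

lemma continuous_on_green_fibre:
  fixes \<Psi> :: "complex \<times> complex \<Rightarrow> complex"
  assumes "continuous_on (cball 0 1 \<times> cball 0 1) \<Psi>"
  shows "continuous_on (sphere 0 1) (green_fibre \<Psi>)"
  unfolding continuous_on_sequentially comp_def green_fibre_def
proof (intro allI ballI impI, elim conjE)
  fix x a assume x: "\<forall>n. x n \<in> sphere 0 1" "x \<longlonglongrightarrow> a" and a: "a \<in> sphere (0::complex) 1"
  obtain M where M: "0 \<le> M" "\<And>w \<xi>. norm w \<le> 1 \<Longrightarrow> norm \<xi> \<le> 1 \<Longrightarrow> norm (\<Psi> (w, \<xi>)) \<le> M"
    using bounded_on_bidisc[OF assms(1)] by blast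
  show "(\<lambda>n. LINT \<xi>:ball 0 1|lborel. of_real (green 0 \<xi>) * \<Psi> (x n, \<xi>)) \<longlonglongrightarrow> (LINT \<xi>:ball 0 1|lborel. of_real (green 0 \<xi>) * \<Psi> (a, \<xi>))"
  proof (rule set_integral_dominated_convergence(3))
    show "set_integrable lborel (ball 0 1) (\<lambda>\<xi>. green 0 \<xi> * M)"
      using set_integrable_green_0 by (rule set_integrable_mult_left[rule_format])
    show "set_borel_measurable lborel (ball 0 1) (\<lambda>\<xi>. of_real (green 0 \<xi>) * \<Psi> (x n, \<xi>))" for n
      using x by (intro set_borel_measurable_green_mult continuous_on_slice assms ball_subset_cball) auto
    show "norm (of_real (green 0 \<xi>) * \<Psi> (x n, \<xi>)) \<le> green 0 \<xi> * M" if "\<xi> \<in> ball 0 1" for n \<xi>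
      using M x that green_0_nonneg[of \<xi>] by (auto simp: norm_mult intro!: mult_mono)
    show "(\<lambda>n. of_real (green 0 \<xi>) * \<Psi> (x n, \<xi>)) \<longlonglongrightarrow> of_real (green 0 \<xi>) * \<Psi> (a, \<xi>)" if "\<xi> \<in> ball 0 1" for \<xi>
    proof (intro tendsto_intros)
      have "(\<lambda>n. (x n, \<xi>)) \<longlonglongrightarrow> (a, \<xi>)" using x by (intro tendsto_intros)
      then show "(\<lambda>n. \<Psi> (x n, \<xi>)) \<longlonglongrightarrow> \<Psi> (a, \<xi>)"
        using assms x a that unfolding continuous_on_sequentially comp_def by auto
    qed
  qed
qed

lemma norm_green_fibre_diff_le:
  fixes \<Psi> \<Phi> :: "complex \<times> complex \<Rightarrow> complex"
  assumes "continuous_on (cball 0 1 \<times> cball 0 1) \<Psi>" "continuous_on (cball 0 1 \<times> cball 0 1) \<Phi>"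
    and "\<And>x. x \<in> cball 0 1 \<times> cball 0 1 \<Longrightarrow> norm (\<Psi> x - \<Phi> x) \<le> e" and w: "norm w \<le> 1"
  shows "norm (green_fibre \<Psi> w - green_fibre \<Phi> w) \<le> pi / 2 * e"
proof -
  have "norm (green_fibre \<Psi> w - green_fibre \<Phi> w) \<le> (LINT \<xi>|lborel. indicator (ball 0 1) \<xi> *\<^sub>R (green 0 \<xi> * e))"
    unfolding green_fibre_def set_lebesgue_integral_def
  proof (rule norm_integral_diff_le)
    show "integrable lborel (\<lambda>\<xi>. indicator (ball 0 1) \<xi> *\<^sub>R (of_real (green 0 \<xi>) * \<Psi> (w, \<xi>)))"
      "integrable lborel (\<lambda>\<xi>. indicator (ball 0 1) \<xi> *\<^sub>R (of_real (green 0 \<xi>) * \<Phi> (w, \<xi>)))"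
      using set_integrable_green_fibre assms by (auto simp: set_integrable_def)
    show "integrable lborel (\<lambda>\<xi>. indicator (ball 0 1) \<xi> *\<^sub>R (green 0 \<xi> * e))"
      using set_integrable_mult_left[of e lborel "ball 0 1" "green 0"] set_integrable_green_0 by (simp add: set_integrable_def)
    show "norm (indicator (ball 0 1) \<xi> *\<^sub>R (of_real (green 0 \<xi>) * \<Psi> (w, \<xi>)) - indicator (ball 0 1) \<xi> *\<^sub>R (of_real (green 0 \<xi>) * \<Phi> (w, \<xi>)))
       \<le> indicator (ball 0 1) \<xi> *\<^sub>R (green 0 \<xi> * e)" for \<xi>
    proof (cases "\<xi> \<in> ball 0 1")
      case True
      then have "norm (of_real (green 0 \<xi>) * \<Psi> (w, \<xi>) - of_real (green 0 \<xi>) * \<Phi> (w, \<xi>)) = green 0 \<xi> * norm (\<Psi> (w, \<xi>) - \<Phi> (w, \<xi>))"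
        using green_0_nonneg[of \<xi>] by (simp flip: right_diff_distrib add: norm_mult)
      also have "\<dots> \<le> green 0 \<xi> * e"
        using True w assms(3)[of "(w, \<xi>)"] green_0_nonneg[of \<xi>] by (intro mult_left_mono) auto
      finally show ?thesis using True by simp
    qed simp
  qed
  also have "\<dots> = (LINT \<xi>:ball 0 1|lborel. green 0 \<xi>) * e"
    unfolding set_lebesgue_integral_def by (simp flip: mult.assoc)
  finally show ?thesis by (simp add: LINT_green_0)
qed

context asymptotically_inner_seq
begin

lemma fibre_pairing_eq: "fibre_pairing \<Psi> = 2 * (LINT w:I|arclength. green_fibre \<Psi> w)"
  by (simp add: fibre_pairing_def green_fibre_def)

lemma norm_fibre_pairing_diff_le:
  assumes "continuous_on (cball 0 1 \<times> cball 0 1) \<Psi>" "continuous_on (cball 0 1 \<times> cball 0 1) \<Phi>"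
    and "\<And>x. x \<in> cball 0 1 \<times> cball 0 1 \<Longrightarrow> norm (\<Psi> x - \<Phi> x) \<le> e"
  shows "norm (fibre_pairing \<Psi> - fibre_pairing \<Phi>) \<le> pi * e"
proof -
  have "0 \<le> e" using order_trans[OF norm_ge_zero assms(3)[of "(0, 0)"]] by simp
  have "norm ((LINT w:I|arclength. green_fibre \<Psi> w) - (LINT w:I|arclength. green_fibre \<Phi> w)) \<le> (LINT w|arclength. pi / 2 * e)"
    unfolding set_lebesgue_integral_def
  proof (rule norm_integral_diff_le)
    fix w assume "w \<in> space arclength"
    then have "norm (green_fibre \<Psi> w - green_fibre \<Phi> w) \<le> pi / 2 * e"
      using assms by (intro norm_green_fibre_diff_le) auto
    then show "norm (indicator I w *\<^sub>R green_fibre \<Psi> w - indicator I w *\<^sub>R green_fibre \<Phi> w) \<le> pi / 2 * e"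
      using \<open>0 \<le> e\<close> by (auto split: split_indicator)
  qed (use assms in \<open>auto intro!: integrable_indicator_mult continuous_on_green_fibre\<close>)
  then show ?thesis
    unfolding fibre_pairing_eq right_diff_distrib[symmetric] norm_mult by simp
qed

lemma fibre_pairing_add:
  assumes "continuous_on (cball 0 1 \<times> cball 0 1) \<Psi>" "continuous_on (cball 0 1 \<times> cball 0 1) \<Phi>"
  shows "fibre_pairing (\<lambda>x. \<Psi> x + \<Phi> x) = fibre_pairing \<Psi> + fibre_pairing \<Phi>"
proof -
  have "green_fibre (\<lambda>x. \<Psi> x + \<Phi> x) w = green_fibre \<Psi> w + green_fibre \<Phi> w" if "norm w = 1" for w
    unfolding green_fibre_def ring_distribs
    using that assms by (intro set_integral_add set_integrable_green_fibre) auto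
  then have "(LINT w:I|arclength. green_fibre (\<lambda>x. \<Psi> x + \<Phi> x) w) = (LINT w|arclength. indicator I w *\<^sub>R green_fibre \<Psi> w + indicator I w *\<^sub>R green_fibre \<Phi> w)"
    unfolding set_lebesgue_integral_def by (intro Bochner_Integration.integral_cong) (auto simp: scaleR_add_right)
  also have "\<dots> = (LINT w:I|arclength. green_fibre \<Psi> w) + (LINT w:I|arclength. green_fibre \<Phi> w)"
    unfolding set_lebesgue_integral_def using assms
    by (intro Bochner_Integration.integral_add integrable_indicator_mult continuous_on_green_fibre)
  finally show ?thesis unfolding fibre_pairing_eq by (simp add: algebra_simps)
qed

lemma fibre_pairing_cmult: "fibre_pairing (\<lambda>x. k * \<Psi> x) = k * fibre_pairing \<Psi>"
proof -
  have "green_fibre (\<lambda>x. k * \<Psi> x) = (\<lambda>w. k * green_fibre \<Psi> w)"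
    unfolding green_fibre_def mult.left_commute[of _ k] by (rule ext) (rule set_integral_mult_right)
  then show ?thesis unfolding fibre_pairing_eq by (simp only: set_integral_mult_right mult.left_commute)
qed

lemma continuous_on_graph:
  fixes \<Psi> :: "complex \<times> complex \<Rightarrow> complex"
  assumes "continuous_on (cball 0 1 \<times> cball 0 1) \<Psi>"
  shows "continuous_on (cball 0 1) (\<lambda>w. \<Psi> (w, h n w))"
  by (rule continuous_on_compose2[OF assms])
     (use norm_le_1 in \<open>auto intro!: continuous_intros continuous\<close>)

lemma set_integrable_energy_pairing:
  fixes \<Psi> :: "complex \<times> complex \<Rightarrow> complex"
  assumes "continuous_on (cball 0 1 \<times> cball 0 1) \<Psi>"
  shows "set_integrable lborel (ball 0 1) (\<lambda>w. of_real ((1 - (norm w)\<^sup>2) * (norm (deriv (h n) w))\<^sup>2) * \<Psi> (w, h n w))"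
  by (intro set_integrable_disc_continuous continuous_intros continuous continuous_on_graph assms order_refl)

text \<open>The identity for \<open>P = Q = h n\<close> bounds the energy by \<open>\<pi>\<close>, since \<open>\<bar>h n\<bar> \<le> 1\<close> on the circle.\<close>

lemma energy_le:
  "set_integrable lborel (ball 0 1) (\<lambda>w. (1 - (norm w)\<^sup>2) * (norm (deriv (h n) w))\<^sup>2)"
  "(LINT w:ball 0 1|lborel. (1 - (norm w)\<^sup>2) * (norm (deriv (h n) w))\<^sup>2) \<le> pi"
proof -
  let ?E = "\<lambda>w. (1 - (norm w)\<^sup>2) * (norm (deriv (h n) w))\<^sup>2"
  show i: "set_integrable lborel (ball 0 1) ?E"
    by (intro set_integrable_disc_continuous continuous_intros continuous order_refl)
  have i2: "set_integrable lborel (ball 0 1) (\<lambda>w. (norm (h n w))\<^sup>2)"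
    by (intro set_integrable_disc_continuous continuous_intros continuous order_refl)
  obtain R where R: "1 < R" "h n holomorphic_on ball 0 R"
    using bounded_holo by (rule bounded_holomorphic_seq_holomorphic)
  have "complex_of_real (LINT w:ball 0 1|lborel. ?E w + (norm (h n w))\<^sup>2) =
    (LINT w:ball 0 1|lborel. of_real (1 - (norm w)\<^sup>2) * (deriv (h n) w * cnj (deriv (h n) w)) + h n w * cnj (h n w))"
    by (simp only: set_integral_complex_of_real[symmetric] complex_norm_square[symmetric] of_real_mult of_real_add)
  also have "\<dots> = pi * (LINT w|arclength. h n w * cnj (h n w))"
    by (rule green_identity_disc[OF R(2,2,1)])
  also have "\<dots> = complex_of_real (pi * (LINT w|arclength. (norm (h n w))\<^sup>2))"
    by (simp only: complex_norm_square[symmetric] of_real_mult integral_complex_of_real)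
  finally have "(LINT w:ball 0 1|lborel. ?E w + (norm (h n w))\<^sup>2) = pi * (LINT w|arclength. (norm (h n w))\<^sup>2)"
    by (simp only: of_real_eq_iff)
  also have "\<dots> \<le> pi * (LINT w|arclength. 1)"
  proof (intro mult_left_mono Bochner_Integration.integral_mono)
    show "integrable arclength (\<lambda>w. (norm (h n w))\<^sup>2)"
      by (intro integrable_arclength_continuous continuous_intros continuous) auto
    show "(norm (h n w))\<^sup>2 \<le> 1" if "w \<in> space arclength" for w
      using norm_le_1[of w n] that by (simp add: power_le_one)
  qed auto
  finally have "(LINT w:ball 0 1|lborel. ?E w) + (LINT w:ball 0 1|lborel. (norm (h n w))\<^sup>2) \<le> pi"
    using i i2 by (simp add: set_integral_add)
  moreover have "0 \<le> (LINT w:ball 0 1|lborel. (norm (h n w))\<^sup>2)"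
    unfolding set_lebesgue_integral_def by (intro Bochner_Integration.integral_nonneg) auto
  ultimately show "(LINT w:ball 0 1|lborel. ?E w) \<le> pi" by linarith
qed

lemma norm_energy_pairing_diff_le:
  assumes "continuous_on (cball 0 1 \<times> cball 0 1) \<Psi>" "continuous_on (cball 0 1 \<times> cball 0 1) \<Phi>"
    and "\<And>x. x \<in> cball 0 1 \<times> cball 0 1 \<Longrightarrow> norm (\<Psi> x - \<Phi> x) \<le> e"
  shows "norm (energy_pairing n \<Psi> - energy_pairing n \<Phi>) \<le> pi * e"
proof -
  have "0 \<le> e" using order_trans[OF norm_ge_zero assms(3)[of "(0, 0)"]] by simp
  let ?E = "\<lambda>w. (1 - (norm w)\<^sup>2) * (norm (deriv (h n) w))\<^sup>2"
  have "norm (energy_pairing n \<Psi> - energy_pairing n \<Phi>) \<le> (LINT w|lborel. indicator (ball 0 1) w *\<^sub>R (?E w * e))"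
    unfolding energy_pairing_def set_lebesgue_integral_def
  proof (rule norm_integral_diff_le)
    show "integrable lborel (\<lambda>w. indicator (ball 0 1) w *\<^sub>R (of_real (?E w) * \<Psi> (w, h n w)))"
      "integrable lborel (\<lambda>w. indicator (ball 0 1) w *\<^sub>R (of_real (?E w) * \<Phi> (w, h n w)))"
      using set_integrable_energy_pairing assms by (auto simp only: set_integrable_def)
    show "integrable lborel (\<lambda>w. indicator (ball 0 1) w *\<^sub>R (?E w * e))"
      using set_integrable_mult_left[of e lborel "ball 0 1" ?E] energy_le(1) by (simp only: set_integrable_def)
    show "norm (indicator (ball 0 1) w *\<^sub>R (of_real (?E w) * \<Psi> (w, h n w)) - indicator (ball 0 1) w *\<^sub>R (of_real (?E w) * \<Phi> (w, h n w)))
       \<le> indicator (ball 0 1) w *\<^sub>R (?E w * e)" for w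
    proof (cases "w \<in> ball 0 1")
      case True
      then have E: "0 \<le> ?E w" by (simp add: power_le_one)
      have "norm (of_real (?E w) * \<Psi> (w, h n w) - of_real (?E w) * \<Phi> (w, h n w)) = ?E w * norm (\<Psi> (w, h n w) - \<Phi> (w, h n w))"
        using E by (simp only: norm_mult norm_of_real abs_of_nonneg right_diff_distrib[symmetric])
      also have "\<dots> \<le> ?E w * e"
        using True norm_le_1[of w n] E assms(3)[of "(w, h n w)"] by (intro mult_left_mono) auto
      finally show ?thesis using True by simp
    qed simp
  qed
  also have "\<dots> = (LINT w:ball 0 1|lborel. ?E w) * e"
    unfolding set_lebesgue_integral_def scaleR_conv_of_real of_real_eq_id id_apply mult.assoc[symmetric] by (rule integral_mult_left_zero)
  also have "\<dots> \<le> pi * e" using energy_le(2) \<open>0 \<le> e\<close> by (intro mult_right_mono)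
  finally show ?thesis .
qed

lemma energy_pairing_add:
  assumes "continuous_on (cball 0 1 \<times> cball 0 1) \<Psi>" "continuous_on (cball 0 1 \<times> cball 0 1) \<Phi>"
  shows "energy_pairing n (\<lambda>x. \<Psi> x + \<Phi> x) = energy_pairing n \<Psi> + energy_pairing n \<Phi>"
  unfolding energy_pairing_def distrib_left using assms by (intro set_integral_add set_integrable_energy_pairing)

lemma energy_pairing_cmult: "energy_pairing n (\<lambda>x. k * \<Psi> x) = k * energy_pairing n \<Psi>"
  unfolding energy_pairing_def mult.left_commute[of _ k] by (rule set_integral_mult_right)

lemma energy_pairing_conj_polynomial_tendsto: "conj_polynomial p \<Longrightarrow> (\<lambda>n. energy_pairing n p) \<longlonglongrightarrow> fibre_pairing p"
proof (induction rule: conj_polynomial.induct)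
  case (monomial k a b c d)
  have "(\<lambda>n. k * energy_pairing n (\<lambda>(w, \<xi>). w ^ a * cnj w ^ b * \<xi> ^ c * cnj \<xi> ^ d)) \<longlonglongrightarrow> k * fibre_pairing (\<lambda>(w, \<xi>). w ^ a * cnj w ^ b * \<xi> ^ c * cnj \<xi> ^ d)"
    by (intro tendsto_mult_left energy_pairing_monomial_tendsto)
  then show ?case
    unfolding energy_pairing_cmult[symmetric] fibre_pairing_cmult[symmetric] by (simp add: case_prod_unfold)
next
  case (add p q)
  then show ?case
    by (simp add: energy_pairing_add fibre_pairing_add conj_polynomial_continuous tendsto_add)
qed

text \<open>Both functionals have norm at most \<open>\<pi>\<close>, uniformly in \<open>n\<close>, so convergence on the dense set of
polynomials suffices, and uniformly convergent test functions are allowed.\<close>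

lemma energy_pairing_tendsto:
  assumes cont: "continuous_on (cball 0 1 \<times> cball 0 1) \<Psi>"
    and contn: "\<And>n. continuous_on (cball 0 1 \<times> cball 0 1) (\<Psi>n n)"
    and unif: "uniform_limit (cball 0 1 \<times> cball 0 1) \<Psi>n \<Psi> sequentially"
  shows "(\<lambda>n. energy_pairing n (\<Psi>n n)) \<longlonglongrightarrow> fibre_pairing \<Psi>"
proof (rule tendstoI)
  fix e :: real assume "0 < e"
  define d where "d = e / (4 * pi)"
  have d: "0 < d" "pi * d = e / 4" using \<open>0 < e\<close> by (simp_all add: d_def)
  obtain p where p: "conj_polynomial p" "\<And>x. x \<in> cball 0 1 \<times> cball 0 1 \<Longrightarrow> norm (\<Psi> x - p x) < d"
    using conj_polynomial_approximation[OF cont d(1)] by blast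
  have "\<forall>\<^sub>F n in sequentially. dist (energy_pairing n p) (fibre_pairing p) < e / 4"
    using energy_pairing_conj_polynomial_tendsto[OF p(1)] \<open>0 < e\<close> by (intro tendstoD) auto
  moreover have "\<forall>\<^sub>F n in sequentially. \<forall>x\<in>cball 0 1 \<times> cball 0 1. dist (\<Psi>n n x) (\<Psi> x) < d"
    using uniform_limitD[OF unif d(1)] .
  ultimately show "\<forall>\<^sub>F n in sequentially. dist (energy_pairing n (\<Psi>n n)) (fibre_pairing \<Psi>) < e"
  proof eventually_elim
    case (elim n)
    have "norm (energy_pairing n (\<Psi>n n) - energy_pairing n \<Psi>) \<le> pi * d"
      using elim(2) by (intro norm_energy_pairing_diff_le contn cont) (auto simp: dist_norm less_imp_le)
    moreover have "norm (energy_pairing n \<Psi> - energy_pairing n p) \<le> pi * d"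
      using p by (intro norm_energy_pairing_diff_le cont conj_polynomial_continuous) (auto simp: less_imp_le)
    moreover have "norm (fibre_pairing \<Psi> - fibre_pairing p) \<le> pi * d"
      using p by (intro norm_fibre_pairing_diff_le cont conj_polynomial_continuous) (auto simp: less_imp_le)
    moreover have "dist (energy_pairing n (\<Psi>n n)) (fibre_pairing \<Psi>) \<le> norm (energy_pairing n (\<Psi>n n) - energy_pairing n \<Psi>) + norm (energy_pairing n \<Psi> - energy_pairing n p) + dist (energy_pairing n p) (fibre_pairing p) + norm (fibre_pairing \<Psi> - fibre_pairing p)"
      using dist_triangle[of "energy_pairing n (\<Psi>n n)" "fibre_pairing \<Psi>" "energy_pairing n \<Psi>"] dist_triangle[of "energy_pairing n \<Psi>" "fibre_pairing \<Psi>" "energy_pairing n p"] dist_triangle[of "energy_pairing n p" "fibre_pairing \<Psi>" "fibre_pairing p"]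
      by (simp add: dist_norm norm_minus_commute)
    ultimately show ?case using elim(1) d(2) \<open>0 < e\<close> by linarith
  qed
qed

end

section \<open>Comparison of the Green kernel with the Poisson kernel\<close>

text \<open>On the circle this is the Poisson kernel of \<open>z0\<close>; unlike that kernel, written with \<open>\<bar>w - z0\<bar>\<close>, it has no
pole at \<open>z0\<close>.\<close>

definition poisson_factor :: "complex \<Rightarrow> complex \<Rightarrow> real" where
  "poisson_factor z0 w = (1 - (norm z0)\<^sup>2) / (norm (1 - cnj z0 * w))\<^sup>2"

lemma poisson_factor_circle:
  assumes "norm w = 1"
  shows "poisson_factor z0 w = (1 - (norm z0)\<^sup>2) / (norm (w - z0))\<^sup>2"
proof -
  have "norm (1 - cnj z0 * w) = norm (cnj w * (1 - cnj z0 * w))" using assms by (simp add: norm_mult)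
  also have "cnj w * (1 - cnj z0 * w) = cnj (w - z0)"
    using assms complex_norm_square[of w] by (simp add: algebra_simps)
  also have "norm \<dots> = norm (w - z0)" by (rule complex_mod_cnj)
  finally show ?thesis by (simp add: poisson_factor_def)
qed

lemma continuous_on_poisson_factor:
  "norm z0 < 1 \<Longrightarrow> continuous_on (cball 0 1) (poisson_factor z0)"
  unfolding poisson_factor_def using one_minus_cnj_mult_nonzero[of z0] by (intro continuous_intros) auto

lemma poisson_factor_nonneg: "norm z0 < 1 \<Longrightarrow> 0 \<le> poisson_factor z0 w"
  by (simp add: poisson_factor_def power_le_one)

lemma poisson_factor_bounded:
  assumes "norm z0 < 1"
  obtains B where "0 \<le> B" "\<And>w. norm w \<le> 1 \<Longrightarrow> poisson_factor z0 w \<le> B"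
proof -
  obtain B where "0 \<le> B" and B: "\<And>w. w \<in> cball 0 1 \<Longrightarrow> norm (poisson_factor z0 w) \<le> B"
    using compact_cball continuous_on_poisson_factor[OF assms] by (rule continuous_on_compact_bound) (rule that)
  note \<open>0 \<le> B\<close>
  moreover have "poisson_factor z0 w \<le> B" if "norm w \<le> 1" for w
    using B[of w] that by simp
  ultimately show thesis by (rule that)
qed

text \<open>The function \<open>g\<close> is \<open>x/2\<close> up to second order at \<open>0\<close> and has a logarithmic pole at \<open>1\<close>. The factor \<open>1 + g\<close>
makes the bounds uniform up to the pole. At \<open>x = 1\<close> the convention \<open>ln 0 = 0\<close> gives \<open>g = 0\<close>, and the
bounds persist.\<close>

lemma half_minus_ln_bounds:
  fixes x :: real
  assumes "0 \<le> x" "x \<le> 1"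
  defines "g \<equiv> - ln (1 - x) / 2"
  shows "0 \<le> g" and "g \<le> x * (1 + g)" and "\<bar>g - x / 2\<bar> \<le> x\<^sup>2 * (1 + g)"
proof -
  have "0 \<le> g \<and> g \<le> x * (1 + g) \<and> \<bar>g - x / 2\<bar> \<le> x\<^sup>2 * (1 + g)"
  proof (cases "x = 1")
    case False
    then have x: "0 \<le> x" "x < 1" using assms by auto
    define u where "u = - ln (1 - x)"
    have u1: "x \<le> u" using ln_le_minus_one[of "1 - x"] x by (simp add: u_def)
    have "ln (inverse (1 - x)) \<le> inverse (1 - x) - 1"
      using x by (intro ln_le_minus_one) auto
    moreover have "ln (inverse (1 - x)) = u" using x by (simp add: u_def ln_inverse)
    moreover have "inverse (1 - x) - 1 = x / (1 - x)" using x by (simp add: field_simps)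
    ultimately have "u \<le> x / (1 - x)" by (simp only:)
    then have u2: "u * (1 - x) \<le> x" using x by (simp add: field_simps)
    have "u * (1 - x) * (1 + x) \<le> x * (1 + x)" using x u2 by (intro mult_right_mono) auto
    then have u3: "u * (1 - x\<^sup>2) \<le> x + x\<^sup>2" by (simp add: algebra_simps power2_eq_square)
    have g: "g = u / 2" by (simp add: g_def u_def)
    have "0 \<le> g" using u1 x by (simp add: g)
    moreover have "g \<le> x * (1 + g)" using u2 x by (simp add: g algebra_simps)
    moreover have "g - x / 2 \<le> x\<^sup>2 * (1 + g)"
      using u3 x by (simp add: g algebra_simps) (smt (verit) zero_le_power2)
    moreover have "0 \<le> g - x / 2" using u1 by (simp add: g)
    ultimately show ?thesis by auto
  qed (simp add: g_def)
  then show "0 \<le> g" "g \<le> x * (1 + g)" "\<bar>g - x / 2\<bar> \<le> x\<^sup>2 * (1 + g)" by auto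
qed

text \<open>The first upper bound is of first order in \<open>1 - \<bar>w\<bar>\<^sup>2\<close> and can absorb one derivative; the second is of
second order and can absorb two. The remaining factor \<open>1 + green z0\<close> is integrable.\<close>

lemma green_bounds:
  assumes "norm z0 < 1" "norm w < 1"
  defines "x \<equiv> poisson_factor z0 w * (1 - (norm w)\<^sup>2)"
  shows "0 \<le> green z0 w" and "green z0 w \<le> x * (1 + green z0 w)" and "\<bar>green z0 w - x / 2\<bar> \<le> x\<^sup>2 * (1 + green z0 w)"
proof -
  have x: "x = 1 - (norm (disc_aut z0 w))\<^sup>2"
    using assms by (simp add: x_def poisson_factor_def one_minus_norm_disc_aut)
  have g: "green z0 w = - ln (1 - x) / 2"
    unfolding x green_def by (cases "disc_aut z0 w = 0") (simp_all add: ln_realpow)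
  have "0 \<le> x" "x \<le> 1"
    unfolding x using norm_disc_aut_le[of z0 w] assms(1,2) by (simp_all add: power_le_one)
  from half_minus_ln_bounds[OF this]
  show "0 \<le> green z0 w" "green z0 w \<le> x * (1 + green z0 w)" "\<bar>green z0 w - x / 2\<bar> \<le> x\<^sup>2 * (1 + green z0 w)"
    unfolding g by auto
qed

lemma green_disc_aut: "norm z0 < 1 \<Longrightarrow> norm w \<le> 1 \<Longrightarrow> green z0 (disc_aut z0 w) = green 0 w"
  by (simp add: green_def disc_aut_disc_aut) (simp add: disc_aut_def)

lemma continuous_on_deriv_disc_aut:
  assumes "norm z0 < 1"
  shows "continuous_on (cball 0 1) (deriv (disc_aut z0))"
proof (rule continuous_on_subset)
  show "continuous_on {w. 1 - cnj z0 * w \<noteq> 0} (deriv (disc_aut z0))"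
    by (intro holomorphic_on_imp_continuous_on holomorphic_deriv holomorphic_on_disc_aut open_disc_aut_domain assms)
qed (use one_minus_cnj_mult_nonzero[OF assms] in auto)

lemma set_integrable_green:
  assumes z0: "norm z0 < 1"
  shows "set_integrable lborel (ball 0 1) (green z0)"
proof -
  obtain B where B: "\<And>w. w \<in> cball 0 1 \<Longrightarrow> norm (deriv (disc_aut z0) w) \<le> B"
    using compact_cball continuous_on_deriv_disc_aut[OF z0] by (rule continuous_on_compact_bound) (rule that)
  define d where "d = (\<lambda>w. indicator (ball 0 1) w *\<^sub>R deriv (disc_aut z0) w)"
  have [measurable]: "d \<in> borel_measurable borel"
    using set_borel_measurable_disc[OF continuous_on_subset[OF continuous_on_deriv_disc_aut[OF z0] ball_subset_cball]]
    by (simp add: d_def set_borel_measurable_def)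
  have "set_integrable lborel (ball 0 1) (\<lambda>z. B\<^sup>2 * green 0 z)"
    using set_integrable_green_0 by simp
  then have "set_integrable lborel (ball 0 1) (\<lambda>z. (norm (deriv (disc_aut z0) z))\<^sup>2 *\<^sub>R green z0 (disc_aut z0 z))"
  proof (rule set_integrable_bound)
    have [measurable]: "ball (0::complex) 1 \<in> sets borel" by simp
    have "(\<lambda>z. indicator (ball 0 1) z *\<^sub>R ((norm (d z))\<^sup>2 * green 0 z)) \<in> borel_measurable borel"
      by measurable
    also have "(\<lambda>z. indicator (ball 0 1) z *\<^sub>R ((norm (d z))\<^sup>2 * green 0 z)) =
       (\<lambda>z. indicator (ball 0 1) z *\<^sub>R ((norm (deriv (disc_aut z0) z))\<^sup>2 *\<^sub>R green z0 (disc_aut z0 z)))"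
      by (auto simp: d_def green_disc_aut z0 split: split_indicator)
    finally show "set_borel_measurable lborel (ball 0 1) (\<lambda>z. (norm (deriv (disc_aut z0) z))\<^sup>2 *\<^sub>R green z0 (disc_aut z0 z))"
      by (simp add: set_borel_measurable_def)
    show "AE z in lborel. z \<in> ball 0 1 \<longrightarrow> norm ((norm (deriv (disc_aut z0) z))\<^sup>2 *\<^sub>R green z0 (disc_aut z0 z)) \<le> norm (B\<^sup>2 * green 0 z)"
      using B by (intro AE_I2 impI) (auto simp: green_disc_aut z0 abs_mult intro!: mult_right_mono power_mono)
  qed
  then show ?thesis using disc_aut_change_of_variables(1)[OF z0, of "green z0"] by simp
qed

lemma set_integrable_green_mult:
  fixes f :: "complex \<Rightarrow> complex"
  assumes z0: "norm z0 < 1" and f: "continuous_on (cball 0 1) f"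
  shows "set_integrable lborel (ball 0 1) (\<lambda>w. of_real (green z0 w) * f w)"
proof -
  obtain B where B: "\<And>w. w \<in> cball 0 1 \<Longrightarrow> norm (f w) \<le> B"
    using compact_cball f by (rule continuous_on_compact_bound) (rule that)
  have "set_integrable lborel (ball 0 1) (\<lambda>w. green z0 w * B)"
    using set_integrable_green[OF z0] by simp
  then show ?thesis
  proof (rule set_integrable_bound)
    show "set_borel_measurable lborel (ball 0 1) (\<lambda>w. of_real (green z0 w) * f w)"
      by (intro set_borel_measurable_green_mult continuous_on_subset[OF f ball_subset_cball])
    show "AE w in lborel. w \<in> ball 0 1 \<longrightarrow> norm (of_real (green z0 w) * f w) \<le> norm (green z0 w * B)"
      using B green_bounds(1)[OF z0] by (intro AE_I2 impI) (auto simp: norm_mult abs_mult intro!: mult_left_mono order_trans[OF _ abs_ge_self])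
  qed
qed

lemma LINT_green_mult_tendsto:
  fixes b :: "nat \<Rightarrow> complex \<Rightarrow> complex"
  assumes z0: "norm z0 < 1" and cont: "\<And>n. continuous_on (cball 0 1) (b n)"
    and bound: "\<And>n w. norm w < 1 \<Longrightarrow> norm (b n w) \<le> M"
    and lim: "\<And>w. norm w < 1 \<Longrightarrow> (\<lambda>n. b n w) \<longlonglongrightarrow> b' w"
  shows "(\<lambda>n. LINT w:ball 0 1|lborel. of_real (green z0 w) * b n w) \<longlonglongrightarrow> (LINT w:ball 0 1|lborel. of_real (green z0 w) * b' w)"
proof (rule set_integral_dominated_convergence(3))
  show "set_integrable lborel (ball 0 1) (\<lambda>w. green z0 w * M)"
    using set_integrable_green[OF z0] by simp
  show "set_borel_measurable lborel (ball 0 1) (\<lambda>w. of_real (green z0 w) * b n w)" for n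
    by (intro set_borel_measurable_green_mult continuous_on_subset[OF cont ball_subset_cball])
  show "norm (of_real (green z0 w) * b n w) \<le> green z0 w * M" if "w \<in> ball 0 1" for n w
    using that bound[of w n] green_bounds(1)[OF z0, of w] by (auto simp: norm_mult intro!: mult_left_mono)
  show "(\<lambda>n. of_real (green z0 w) * b n w) \<longlonglongrightarrow> of_real (green z0 w) * b' w" if "w \<in> ball 0 1" for w
    using that by (intro tendsto_mult_left lim) auto
qed

context asymptotically_inner_seq
begin

lemma LINT_green_deriv_tendsto_0:
  fixes e :: "nat \<Rightarrow> complex \<Rightarrow> complex"
  assumes z0: "norm z0 < 1" and cont: "\<And>n. continuous_on (cball 0 1) (e n)" and "0 \<le> M"
    and bound: "\<And>n w. norm w < 1 \<Longrightarrow> norm (e n w) \<le> M * norm (deriv (h n) w)"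
  shows "(\<lambda>n. LINT w:ball 0 1|lborel. of_real (green z0 w) * e n w) \<longlonglongrightarrow> 0"
proof -
  obtain C where C: "0 \<le> C" "\<And>n w. norm w < 1 \<Longrightarrow> (1 - (norm w)\<^sup>2) * norm (deriv (h n) w) \<le> C"
    by (rule bounded_holomorphic_seq_bounds[OF bounded_holo]) (rule that)
  obtain B where B: "0 \<le> B" "\<And>w. norm w \<le> 1 \<Longrightarrow> poisson_factor z0 w \<le> B"
    by (rule poisson_factor_bounded[OF z0]) (rule that)
  have "(\<lambda>n. LINT w:ball 0 1|lborel. of_real (green z0 w) * e n w) \<longlonglongrightarrow> (LINT w:ball (0::complex) 1|lborel. 0)"
  proof (rule set_integral_dominated_convergence(3))
    have "set_integrable lborel (ball 0 1) (\<lambda>w. 1 + green z0 w)"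
      by (intro set_integral_add(1) set_integrable_green z0 set_integrable_disc_continuous continuous_intros)
    then show "set_integrable lborel (ball 0 1) (\<lambda>w. M * (B * C) * (1 + green z0 w))"
      by simp
    show "set_borel_measurable lborel (ball 0 1) (\<lambda>w. of_real (green z0 w) * e n w)" for n
      by (intro set_borel_measurable_green_mult continuous_on_subset[OF cont ball_subset_cball])
    show "norm (of_real (green z0 w) * e n w) \<le> M * (B * C) * (1 + green z0 w)" if "w \<in> ball 0 1" for n w
    proof -
      have w: "norm w < 1" using that by simp
      note g = green_bounds[OF z0 w]
      have p: "0 \<le> 1 - (norm w)\<^sup>2" using w by (simp add: power_le_one)
      have "norm (of_real (green z0 w) * e n w) = green z0 w * norm (e n w)"
        using g(1) by (simp add: norm_mult)
      also have "\<dots> \<le> (poisson_factor z0 w * (1 - (norm w)\<^sup>2) * (1 + green z0 w)) * (M * norm (deriv (h n) w))"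
        using g bound[OF w, of n] poisson_factor_nonneg[OF z0] p by (intro mult_mono) auto
      also have "\<dots> = M * (poisson_factor z0 w * ((1 - (norm w)\<^sup>2) * norm (deriv (h n) w))) * (1 + green z0 w)"
        by (simp only: mult_ac)
      also have "\<dots> \<le> M * (B * C) * (1 + green z0 w)"
        using g B(2)[of w] C(2)[OF w, of n] B(1) C(1) w p \<open>0 \<le> M\<close> poisson_factor_nonneg[OF z0]
        by (intro mult_right_mono mult_left_mono mult_mono) auto
      finally show ?thesis .
    qed
    show "(\<lambda>n. of_real (green z0 w) * e n w) \<longlonglongrightarrow> 0" if "w \<in> ball 0 1" for w
    proof (rule tendsto_mult_right_zero)
      have "(\<lambda>n. M * norm (deriv (h n) w)) \<longlonglongrightarrow> M * 0"
        using vanishing that by (intro tendsto_mult_left tendsto_norm_zero) (auto simp: vanishing_seq_def)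
      then have "(\<lambda>n. M * norm (deriv (h n) w)) \<longlonglongrightarrow> 0" by simp
      moreover have "\<forall>n. norm (e n w) \<le> M * norm (deriv (h n) w)" using bound that by simp
      ultimately show "(\<lambda>n. e n w) \<longlonglongrightarrow> 0"
        by (rule Lim_null_comparison[OF always_eventually, rotated])
    qed
  qed
  then show ?thesis by simp
qed

text \<open>The second-order difference between the Green function and half the Poisson kernel times
\<open>1 - \<bar>w\<bar>\<^sup>2\<close> absorbs \<open>\<bar>h'\<bar>\<^sup>2\<close>, so only the Poisson part survives. The Poisson factor, continuous on the
closed disc, is then made part of the test function.\<close>

lemma LINT_green_energy_tendsto:
  fixes a :: "complex \<times> complex \<Rightarrow> complex"
  assumes z0: "norm z0 < 1" and a: "continuous_on (cball 0 1 \<times> cball 0 1) a"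
    and r: "r \<longlonglongrightarrow> 1" "\<And>n. 0 < r n" "\<And>n. r n < 1"
  shows "(\<lambda>n. LINT w:ball 0 1|lborel. of_real (green z0 w) * (a (of_real (r n) * w, h n w) * (deriv (h n) w * cnj (deriv (h n) w))))
     \<longlonglongrightarrow> (LINT w:I|arclength. of_real (poisson_factor z0 w) * green_fibre a w)"
proof -
  obtain C where C: "0 \<le> C" "\<And>n w. norm w < 1 \<Longrightarrow> (1 - (norm w)\<^sup>2) * norm (deriv (h n) w) \<le> C"
    by (rule bounded_holomorphic_seq_bounds[OF bounded_holo]) (rule that)
  obtain B where B: "0 \<le> B" "\<And>w. norm w \<le> 1 \<Longrightarrow> poisson_factor z0 w \<le> B"
    by (rule poisson_factor_bounded[OF z0]) (rule that)
  obtain M where M: "0 \<le> M" "\<And>w \<xi>. norm w \<le> 1 \<Longrightarrow> norm \<xi> \<le> 1 \<Longrightarrow> norm (a (w, \<xi>)) \<le> M"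
    using a by (rule bounded_on_bidisc) (rule that)
  have rw: "norm (of_real (r n) * w) \<le> 1" if "norm w \<le> 1" for n and w :: complex
    using that r(2)[of n] r(3)[of n] by (simp add: norm_mult mult_le_one)
  \<comment> \<open>The radius enters the test function, which converges uniformly by uniform continuity of \<open>a\<close>.\<close>
  define \<Psi>n where "\<Psi>n n x = of_real (poisson_factor z0 (fst x)) * a (of_real (r n) * fst x, snd x)" for n x
  define \<Psi> where "\<Psi> x = of_real (poisson_factor z0 (fst x)) * a x" for x
  have pf: "continuous_on (cball 0 1 \<times> cball 0 1) (\<lambda>x. poisson_factor z0 (fst x))"
    by (rule continuous_on_compose2[OF continuous_on_poisson_factor[OF z0]]) (auto intro: continuous_intros)
  have cont: "continuous_on (cball 0 1 \<times> cball 0 1) \<Psi>"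
    unfolding \<Psi>_def by (intro continuous_intros pf a)
  have ar: "continuous_on (cball 0 1 \<times> cball 0 1) (\<lambda>x. a (of_real (r n) * fst x, snd x))" for n
    by (rule continuous_on_compose2[OF a]) (use rw in \<open>auto intro!: continuous_intros\<close>)
  then have contn: "continuous_on (cball 0 1 \<times> cball 0 1) (\<Psi>n n)" for n
    unfolding \<Psi>n_def by (intro continuous_intros pf)
  have unif: "uniform_limit (cball 0 1 \<times> cball 0 1) \<Psi>n \<Psi> sequentially"
  proof (rule uniform_limitI)
    fix e :: real assume "0 < e"
    have "uniformly_continuous_on (cball 0 1 \<times> cball 0 1) a"
      by (intro compact_uniformly_continuous a compact_Times compact_cball)
    moreover have "0 < e / (B + 1)" using \<open>0 < e\<close> B by simp
    ultimately obtain d where d: "0 < d" "\<And>x y. x \<in> cball 0 1 \<times> cball 0 1 \<Longrightarrow> y \<in> cball 0 1 \<times> cball 0 1 \<Longrightarrow> dist y x < d \<Longrightarrow> dist (a y) (a x) < e / (B + 1)"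
      unfolding uniformly_continuous_on_def by meson
    have "\<forall>\<^sub>F n in sequentially. dist (r n) 1 < d" using r(1) d(1) by (rule tendstoD)
    then show "\<forall>\<^sub>F n in sequentially. \<forall>x\<in>cball 0 1 \<times> cball 0 1. dist (\<Psi>n n x) (\<Psi> x) < e"
    proof eventually_elim
      case (elim n)
      show ?case
      proof
        fix x :: "complex \<times> complex" assume x: "x \<in> cball 0 1 \<times> cball 0 1"
        obtain w \<xi> where x_eq: "x = (w, \<xi>)" by (cases x)
        have w: "norm w \<le> 1" "norm \<xi> \<le> 1" using x x_eq by auto
        have "dist (of_real (r n) * w, \<xi>) (w, \<xi>) = norm (of_real (r n - 1) * w)"
          by (simp add: dist_Pair_Pair dist_norm algebra_simps)
        also have "\<dots> \<le> \<bar>r n - 1\<bar> * 1" unfolding norm_mult norm_of_real using w by (intro mult_left_mono) auto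
        also have "\<dots> < d" using elim by (simp add: dist_real_def)
        finally have "dist (a (of_real (r n) * w, \<xi>)) (a (w, \<xi>)) < e / (B + 1)"
          using w rw[of w n] by (intro d) auto
        then have "norm (a (of_real (r n) * w, \<xi>) - a (w, \<xi>)) * (B + 1) < e"
          using B by (simp add: dist_norm field_simps)
        moreover have "dist (\<Psi>n n x) (\<Psi> x) = poisson_factor z0 w * norm (a (of_real (r n) * w, \<xi>) - a (w, \<xi>))"
          using poisson_factor_nonneg[OF z0, of w]
          by (simp add: \<Psi>n_def \<Psi>_def x_eq dist_norm norm_mult flip: right_diff_distrib)
        moreover have "\<dots> \<le> (B + 1) * norm (a (of_real (r n) * w, \<xi>) - a (w, \<xi>))"
          using B(2)[OF w(1)] by (intro mult_right_mono) auto
        ultimately show "dist (\<Psi>n n x) (\<Psi> x) < e" by (simp add: mult.commute)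
      qed
    qed
  qed
  have J: "(\<lambda>n. energy_pairing n (\<Psi>n n) / 2) \<longlonglongrightarrow> fibre_pairing \<Psi> / 2"
    by (intro tendsto_divide tendsto_const energy_pairing_tendsto cont contn unif) simp
  let ?A = "\<lambda>n w. a (of_real (r n) * w, h n w) * (deriv (h n) w * cnj (deriv (h n) w))"
  have A: "continuous_on S (?A n)" if "S \<subseteq> cball 0 1" for S n
    using that rw norm_le_1
    by (intro continuous_intros continuous continuous_on_compose2[OF a]) (auto intro!: continuous_intros continuous)
  let ?D = "\<lambda>n w. of_real (green z0 w - poisson_factor z0 w * (1 - (norm w)\<^sup>2) / 2) * ?A n w"
  have D: "(\<lambda>n. LINT w:ball 0 1|lborel. ?D n w) \<longlonglongrightarrow> (LINT w:ball (0::complex) 1|lborel. 0)"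
  proof (rule set_integral_dominated_convergence(3))
    have "set_integrable lborel (ball 0 1) (\<lambda>w. 1 + green z0 w)"
      by (intro set_integral_add(1) set_integrable_green z0 set_integrable_disc_continuous continuous_intros)
    then show "set_integrable lborel (ball 0 1) (\<lambda>w. M * (B\<^sup>2 * C\<^sup>2) * (1 + green z0 w))"
      by simp
    have "set_integrable lborel (ball 0 1) (?D n)" for n
    proof -
      have "set_integrable lborel (ball 0 1) (\<lambda>w. of_real (green z0 w) * ?A n w - of_real (poisson_factor z0 w * (1 - (norm w)\<^sup>2) / 2) * ?A n w)"
        by (intro set_integral_diff(1) set_integrable_green_mult z0 A set_integrable_disc_continuous continuous_intros continuous_on_poisson_factor order_refl) simp
      then show ?thesis by (simp only: left_diff_distrib of_real_diff)
    qed
    then show "set_borel_measurable lborel (ball 0 1) (?D n)" for n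
      unfolding set_integrable_def set_borel_measurable_def by (rule borel_measurable_integrable)
    show "norm (?D n w) \<le> M * (B\<^sup>2 * C\<^sup>2) * (1 + green z0 w)" if "w \<in> ball 0 1" for n w
    proof -
      have w: "norm w < 1" using that by simp
      note g = green_bounds[OF z0 w]
      have p: "0 \<le> 1 - (norm w)\<^sup>2" using w by (simp add: power_le_one)
      let ?x = "poisson_factor z0 w * (1 - (norm w)\<^sup>2)"
      have "norm (?D n w) = \<bar>green z0 w - ?x / 2\<bar> * (norm (a (of_real (r n) * w, h n w)) * (norm (deriv (h n) w))\<^sup>2)"
        by (simp only: norm_mult norm_of_real complex_mod_cnj power2_eq_square)
      also have "\<dots> \<le> (?x\<^sup>2 * (1 + green z0 w)) * (M * (norm (deriv (h n) w))\<^sup>2)"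
        using g M(2)[of "of_real (r n) * w" "h n w"] M(1) rw[of w n] norm_le_1[of w n] w
        by (intro mult_mono) auto
      also have "\<dots> = M * ((poisson_factor z0 w)\<^sup>2 * ((1 - (norm w)\<^sup>2) * norm (deriv (h n) w))\<^sup>2) * (1 + green z0 w)"
        by (simp only: power_mult_distrib mult_ac)
      also have "\<dots> \<le> M * (B\<^sup>2 * C\<^sup>2) * (1 + green z0 w)"
        using g B(2)[of w] C(2)[OF w, of n] B(1) C(1) w p M(1) poisson_factor_nonneg[OF z0]
        by (intro mult_right_mono mult_left_mono mult_mono power_mono) auto
      finally show ?thesis .
    qed
    show "(\<lambda>n. ?D n w) \<longlonglongrightarrow> 0" if "w \<in> ball 0 1" for w
    proof -
      have lim0: "(\<lambda>n. M * (norm (deriv (h n) w))\<^sup>2) \<longlonglongrightarrow> M * 0\<^sup>2"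
        using vanishing that by (intro tendsto_mult_left tendsto_power tendsto_norm_zero) (auto simp: vanishing_seq_def)
      have "norm (?A n w) \<le> M * (norm (deriv (h n) w))\<^sup>2" for n
        unfolding norm_mult complex_mod_cnj power2_eq_square[symmetric]
        using M(2)[of "of_real (r n) * w" "h n w"] rw[of w n] norm_le_1[of w n] that by (intro mult_right_mono) auto
      then have bound: "\<forall>n. norm (?A n w) \<le> M * (norm (deriv (h n) w))\<^sup>2" by (rule allI)
      have "(\<lambda>n. M * (norm (deriv (h n) w))\<^sup>2) \<longlonglongrightarrow> 0" using lim0 by simp
      then have "(\<lambda>n. ?A n w) \<longlonglongrightarrow> 0"
        by (rule Lim_null_comparison[OF always_eventually[OF bound]])
      then show ?thesis by (rule tendsto_mult_right_zero)
    qed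
  qed
  have "(LINT w:ball 0 1|lborel. of_real (green z0 w) * ?A n w) = energy_pairing n (\<Psi>n n) / 2 + (LINT w:ball 0 1|lborel. ?D n w)" for n
  proof -
    let ?K = "\<lambda>w. of_real (poisson_factor z0 w * (1 - (norm w)\<^sup>2) / 2) * ?A n w"
    have "(LINT w:ball 0 1|lborel. ?D n w) = (LINT w:ball 0 1|lborel. of_real (green z0 w) * ?A n w - ?K w)"
      by (simp only: left_diff_distrib of_real_diff)
    also have "\<dots> = (LINT w:ball 0 1|lborel. of_real (green z0 w) * ?A n w) - (LINT w:ball 0 1|lborel. ?K w)"
      by (intro set_integral_diff(2) set_integrable_green_mult z0 A set_integrable_disc_continuous continuous_intros continuous_on_poisson_factor order_refl) simp
    also have "?K = (\<lambda>w. (of_real ((1 - (norm w)\<^sup>2) * (norm (deriv (h n) w))\<^sup>2) * \<Psi>n n (w, h n w)) / 2)"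
      unfolding \<Psi>n_def of_real_mult complex_norm_square[of "deriv (h n) _"] of_real_divide
      by (simp add: fun_eq_iff del: of_real_diff)
    also have "(LINT w:ball 0 1|lborel. (of_real ((1 - (norm w)\<^sup>2) * (norm (deriv (h n) w))\<^sup>2) * \<Psi>n n (w, h n w)) / 2) = energy_pairing n (\<Psi>n n) / 2"
      unfolding energy_pairing_def by (rule set_integral_divide_zero)
    finally show ?thesis by simp
  qed
  then have "(\<lambda>n. LINT w:ball 0 1|lborel. of_real (green z0 w) * ?A n w) \<longlonglongrightarrow> fibre_pairing \<Psi> / 2 + 0"
    using tendsto_add[OF J D] by simp
  moreover have "green_fibre \<Psi> = (\<lambda>w. of_real (poisson_factor z0 w) * green_fibre a w)"
    unfolding green_fibre_def \<Psi>_def fst_conv mult.left_commute[of _ "of_real (poisson_factor z0 _)"]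
    by (rule ext) (rule set_integral_mult_right)
  ultimately show ?thesis unfolding fibre_pairing_eq by simp
qed

end

section \<open>Green currents of graphs and the limit current\<close>

lemma smooth_imp_continuous_on: "smooth f \<Longrightarrow> continuous_on S f"
proof -
  assume "smooth f"
  then have "C_diff 0 f" by (simp only: smooth_def)
  then show ?thesis by (auto intro: continuous_on_subset)
qed

definition form11 ::
  "(complex \<times> complex \<Rightarrow> complex) \<Rightarrow> (complex \<times> complex \<Rightarrow> complex) \<Rightarrow> (complex \<times> complex \<Rightarrow> complex) \<Rightarrow>
   (complex \<times> complex \<Rightarrow> complex) \<Rightarrow> (complex \<times> complex) form2" where
  "form11 a11 a12 a21 a22 = (\<lambda>x u v. a11 x * wedge fst (cnj \<circ> fst) u v + a12 x * wedge fst (cnj \<circ> snd) u v +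
                   a21 x * wedge snd (cnj \<circ> fst) u v + a22 x * wedge snd (cnj \<circ> snd) u v)"

text \<open>A complex linear map \<open>u \<mapsto> d u\<close> satisfies \<open>d\<^sub>j cnj (d\<^sub>k \<i>) - d\<^sub>j \<i> cnj d\<^sub>k = -2 \<i> d\<^sub>j cnj d\<^sub>k\<close>.\<close>

lemma pullback_form11:
  assumes f1: "(f1 has_field_derivative d1) (at \<zeta>)" and f2: "(f2 has_field_derivative d2) (at \<zeta>)"
  defines "x \<equiv> (f1 \<zeta>, f2 \<zeta>)"
  shows "pullback (\<lambda>\<zeta>. (f1 \<zeta>, f2 \<zeta>)) (form11 a11 a12 a21 a22) \<zeta> 1 \<i> =
    - 2 * \<i> * (a11 x * (d1 * cnj d1) + a12 x * (d1 * cnj d2) + a21 x * (d2 * cnj d1) + a22 x * (d2 * cnj d2))"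
proof -
  have "((\<lambda>\<zeta>. (f1 \<zeta>, f2 \<zeta>)) has_derivative (\<lambda>u. (d1 * u, d2 * u))) (at \<zeta>)"
    using f1 f2 by (intro has_derivative_Pair) (simp_all add: has_field_derivative_def)
  then have "frechet_derivative (\<lambda>\<zeta>. (f1 \<zeta>, f2 \<zeta>)) (at \<zeta>) = (\<lambda>u. (d1 * u, d2 * u))"
    by (rule frechet_derivative_at[symmetric])
  then show ?thesis
    by (simp add: pullback_def form11_def wedge_def x_def algebra_simps)
qed

lemma pushforward_green_current_horizontal:
  "pushforward (\<lambda>\<xi>. (\<xi>, 0)) (green_current z0) (form11 a11 a12 a21 a22) =
     (LINT w:ball 0 1|lborel. of_real (green z0 w) * (- 2 * \<i> * a11 (w, 0)))"
  unfolding pushforward_def green_current_def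
  by (subst pullback_form11[of "\<lambda>\<xi>. \<xi>" 1 _ "\<lambda>_. 0" 0]) (auto intro!: derivative_eq_intros)

lemma pushforward_green_current_vertical:
  "pushforward (\<lambda>\<xi>. (\<zeta>, \<xi>)) (green_current 0) (form11 a11 a12 a21 a22) = - 2 * \<i> * green_fibre a22 \<zeta>"
proof -
  have "pushforward (\<lambda>\<xi>. (\<zeta>, \<xi>)) (green_current 0) (form11 a11 a12 a21 a22) =
     (LINT w:ball 0 1|lborel. of_real (green 0 w) * (- 2 * \<i> * a22 (\<zeta>, w)))"
    unfolding pushforward_def green_current_def
    by (subst pullback_form11[of "\<lambda>\<xi>. \<zeta>" 0 _ "\<lambda>\<xi>. \<xi>" 1]) (auto intro!: derivative_eq_intros)
  also have "\<dots> = - 2 * \<i> * green_fibre a22 \<zeta>"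
    unfolding green_fibre_def mult.left_commute[of _ "- 2 * \<i>"] by (rule set_integral_mult_right)
  finally show ?thesis .
qed

text \<open>All derivatives along \<open>\<zeta>\<close> carry a factor \<open>deriv (disc_aut z0) \<zeta>\<close>, and together they form the Jacobian of
\<open>w = disc_aut z0 \<zeta>\<close>.\<close>

lemma pushforward_green_current_disc_aut:
  fixes \<rho> :: complex
  assumes z0: "norm z0 < 1"
    and a: "\<And>S. continuous_on S a11" "\<And>S. continuous_on S a12" "\<And>S. continuous_on S a21" "\<And>S. continuous_on S a22"
    and h: "\<And>w. norm w < 1 \<Longrightarrow> (h has_field_derivative deriv h w) (at w)" "continuous_on (cball 0 1) h" "continuous_on (cball 0 1) (deriv h)"
  defines "m \<equiv> \<lambda>w. a11 (\<rho> * w, h w) * (\<rho> * cnj \<rho>) + a12 (\<rho> * w, h w) * (\<rho> * cnj (deriv h w)) +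
      a21 (\<rho> * w, h w) * (deriv h w * cnj \<rho>) + a22 (\<rho> * w, h w) * (deriv h w * cnj (deriv h w))"
  shows "pushforward (\<lambda>\<zeta>. (\<rho> * disc_aut z0 \<zeta>, h (disc_aut z0 \<zeta>))) (green_current 0) (form11 a11 a12 a21 a22) =
     - 2 * \<i> * (LINT w:ball 0 1|lborel. of_real (green z0 w) * m w)"
proof -
  let ?f = "\<lambda>\<zeta>. (\<rho> * disc_aut z0 \<zeta>, h (disc_aut z0 \<zeta>))"
  let ?\<alpha> = "form11 a11 a12 a21 a22"
  have mc: "continuous_on (cball 0 1) m"
    unfolding m_def using h by (intro continuous_intros continuous_on_compose2[OF a(1)[of UNIV]] continuous_on_compose2[OF a(2)[of UNIV]]
        continuous_on_compose2[OF a(3)[of UNIV]] continuous_on_compose2[OF a(4)[of UNIV]]) auto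
  \<comment> \<open>Cut off outside the disc, where nothing is known about \<open>h\<close>, to obtain a measurable function.\<close>
  define H where "H w = indicator (ball 0 1) w *\<^sub>R (of_real (green z0 w) * m w)" for w
  have H: "H \<in> borel_measurable borel"
    using set_borel_measurable_green_mult[OF continuous_on_subset[OF mc ball_subset_cball], of z0]
    by (simp add: H_def[abs_def] set_borel_measurable_def)
  have "pullback ?f ?\<alpha> \<zeta> 1 \<i> =
     - 2 * \<i> * ((norm (deriv (disc_aut z0) \<zeta>))\<^sup>2 *\<^sub>R m (disc_aut z0 \<zeta>))" if "norm \<zeta> < 1" for \<zeta>
  proof -
    have "(disc_aut z0 has_field_derivative deriv (disc_aut z0) \<zeta>) (at \<zeta>)"
      using holomorphic_on_disc_aut[OF z0] open_disc_aut_domain one_minus_cnj_mult_nonzero[OF z0, of \<zeta>] that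
      by (intro holomorphic_derivI) auto
    note d = this
    have 1: "((\<lambda>\<zeta>. \<rho> * disc_aut z0 \<zeta>) has_field_derivative \<rho> * deriv (disc_aut z0) \<zeta>) (at \<zeta>)"
      by (intro DERIV_cmult d)
    have 2: "((\<lambda>\<zeta>. h (disc_aut z0 \<zeta>)) has_field_derivative deriv h (disc_aut z0 \<zeta>) * deriv (disc_aut z0) \<zeta>) (at \<zeta>)"
      using DERIV_chain[OF h(1) d] norm_disc_aut_less[OF z0 that] by (simp add: o_def)
    show ?thesis
      unfolding pullback_form11[OF 1 2] m_def scaleR_conv_of_real complex_norm_square
      by (simp add: algebra_simps)
  qed
  then have "of_real (green 0 \<zeta>) * pullback ?f ?\<alpha> \<zeta> 1 \<i> =
     - 2 * \<i> * ((norm (deriv (disc_aut z0) \<zeta>))\<^sup>2 *\<^sub>R H (disc_aut z0 \<zeta>))" if "\<zeta> \<in> ball 0 1" for \<zeta>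
    using that norm_disc_aut_less[OF z0, of \<zeta>] by (simp add: H_def green_disc_aut[OF z0])
  then have "pushforward ?f (green_current 0) ?\<alpha> =
     (LINT \<zeta>:ball 0 1|lborel. - 2 * \<i> * ((norm (deriv (disc_aut z0) \<zeta>))\<^sup>2 *\<^sub>R H (disc_aut z0 \<zeta>)))"
    unfolding pushforward_def green_current_def by (intro set_lebesgue_integral_cong) auto
  also have "\<dots> = - 2 * \<i> * (LINT \<zeta>:ball 0 1|lborel. (norm (deriv (disc_aut z0) \<zeta>))\<^sup>2 *\<^sub>R H (disc_aut z0 \<zeta>))"
    by (rule set_integral_mult_right)
  also have "(LINT \<zeta>:ball 0 1|lborel. (norm (deriv (disc_aut z0) \<zeta>))\<^sup>2 *\<^sub>R H (disc_aut z0 \<zeta>)) = (LINT w:ball 0 1|lborel. H w)"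
    by (rule disc_aut_change_of_variables(2)[OF z0 H])
  also have "\<dots> = (LINT w:ball 0 1|lborel. of_real (green z0 w) * m w)"
    by (rule set_lebesgue_integral_cong) (auto simp: H_def)
  finally show ?thesis .
qed

lemma borel_measurable_arclengthI: "f \<in> borel_measurable borel \<Longrightarrow> f \<in> borel_measurable arclength"
  by (simp add: measurable_cong_sets[OF sets_arclength refl] measurable_restrict_space1)

lemma sets_arclengthI: "S \<in> sets borel \<Longrightarrow> S \<subseteq> sphere 0 1 \<Longrightarrow> S \<in> sets arclength"
  by (simp add: sets_restrict_space_iff)

lemma LINT_harmonic_measure:
  assumes z0: "norm z0 < 1" and I: "I \<in> sets arclength" and F: "continuous_on (sphere 0 1) (F :: complex \<Rightarrow> complex)"
  shows "(LINT w:I|harmonic_measure z0. F w) = (LINT w:I|arclength. of_real (poisson_factor z0 w) * F w)"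
proof -
  have I': "(\<lambda>w. indicator I w *\<^sub>R F w) \<in> borel_measurable arclength"
    using I borel_measurable_arclength_continuous[OF F] by measurable
  have p: "(\<lambda>w. (1 - (norm z0)\<^sup>2) / (norm (w - z0))\<^sup>2) \<in> borel_measurable arclength"
    by (rule borel_measurable_arclengthI) measurable
  have "(LINT w:I|harmonic_measure z0. F w) = (LINT w|arclength. ((1 - (norm z0)\<^sup>2) / (norm (w - z0))\<^sup>2) *\<^sub>R (indicator I w *\<^sub>R F w))"
    unfolding set_lebesgue_integral_def harmonic_measure_def
    by (rule integral_density[OF I' p]) (use z0 in \<open>auto simp: power_le_one\<close>)
  also have "\<dots> = (LINT w:I|arclength. of_real (poisson_factor z0 w) * F w)"
    unfolding set_lebesgue_integral_def
    by (rule Bochner_Integration.integral_cong) (auto simp: poisson_factor_circle scaleR_conv_of_real)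
  finally show ?thesis .
qed

text \<open>Since \<open>I\<close> is relatively open, \<open>E\<close> is \<open>closure I - I\<close>; so off \<open>E\<close> the circle splits into \<open>I\<close> and the
complement of \<open>closure I\<close>.\<close>

lemma relative_frontier_open_circle:
  fixes I E :: "complex set"
  assumes I: "openin (top_of_set (sphere 0 1)) I" and E: "E = (top_of_set (sphere 0 1)) frontier_of I"
  shows "closed E" "E \<subseteq> sphere 0 1" "I \<inter> E = {}" "sphere 0 1 - E - I \<subseteq> sphere 0 1 - closure I" "I \<in> sets borel" "I \<subseteq> sphere 0 1"
proof -
  have sub: "I \<subseteq> sphere 0 1" using I openin_imp_subset by blast
  have "(top_of_set (sphere 0 1)) closure_of I = sphere 0 1 \<inter> closure I"
    using sub by (simp add: closure_of_subtopology Int_absorb1 inf.absorb2)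
  moreover have "(top_of_set (sphere 0 1)) interior_of I = I"
    by (rule interior_of_openin[OF I])
  ultimately have E': "E = sphere 0 1 \<inter> closure I - I" unfolding E frontier_of_def by simp
  have "closedin (top_of_set (sphere 0 1)) E" unfolding E by (rule closedin_frontier_of)
  then show "closed E" using closedin_closed_trans closed_sphere by blast
  show "E \<subseteq> sphere 0 1" "I \<inter> E = {}" "sphere 0 1 - E - I \<subseteq> sphere 0 1 - closure I" using E' by auto
  obtain T where "open T" "I = sphere 0 1 \<inter> T" using I by (auto simp: openin_open)
  then show "I \<in> sets borel" by simp
  show "I \<subseteq> sphere 0 1" by (rule sub)
qed

lemma AE_arclength_not_in_null:
  assumes "closed E" "E \<subseteq> sphere 0 1" "measure arclength E = 0"
  shows "AE w in arclength. w \<notin> E"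
proof (rule AE_not_in)
  have "E \<in> sets arclength" using assms by (intro sets_arclengthI) auto
  then show "E \<in> null_sets arclength"
    using assms arclength.emeasure_eq_measure[of E] by (simp add: null_sets_def)
qed

text \<open>Off the null set \<open>E\<close> the values \<open>g (r w)\<close> converge to \<open>g_ext w\<close> by continuity. The function \<open>v\<close> is the
modulus of the boundary values, set to \<open>0\<close> on \<open>E\<close>, where \<open>g_ext\<close> is arbitrary.\<close>

lemma LINT_dilation_modulus_tendsto:
  fixes g g_ext :: "complex \<Rightarrow> complex"
  assumes E: "closed E" "E \<subseteq> sphere 0 1" "measure arclength E = 0"
    and g: "continuous_on (ball 0 1) g" "g ` ball 0 1 \<subseteq> ball 0 1"
    and g_ext: "continuous_on (cball 0 1 - E) g_ext" "\<forall>\<zeta>\<in>ball 0 1. g_ext \<zeta> = g \<zeta>"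
    and le_1: "\<And>w. w \<in> sphere 0 1 - E \<Longrightarrow> norm (g_ext w) \<le> 1"
  defines "v \<equiv> \<lambda>w. norm (indicator (sphere 0 1 - E) w *\<^sub>R g_ext w)"
  shows "v \<in> borel_measurable arclength"
    and "((\<lambda>r. LINT w|arclength. \<bar>norm (g (of_real r * w)) ^ k - v w ^ k\<bar>) \<longlongrightarrow> 0) (at_left 1)"
proof -
  have "(\<lambda>w. indicator (sphere 0 1 - E) w *\<^sub>R g_ext w) \<in> borel_measurable borel"
    using E by (intro borel_measurable_continuous_on_indicator continuous_on_subset[OF g_ext(1)]) auto
  then show v: "v \<in> borel_measurable arclength"
    unfolding v_def by (intro borel_measurable_arclengthI measurable_compose[OF _ borel_measurable_norm])
  have v1: "0 \<le> v w" "v w \<le> 1" for w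
    using le_1 by (auto simp: v_def split: split_indicator)
  show "((\<lambda>r. LINT w|arclength. \<bar>norm (g (of_real r * w)) ^ k - v w ^ k\<bar>) \<longlongrightarrow> 0) (at_left 1)"
  proof (rule tendsto_at_left_sequentially[of 0])
    fix S :: "nat \<Rightarrow> real" assume S: "\<And>n. S n < 1" "\<And>n. 0 < S n" "S \<longlonglongrightarrow> 1"
    have in_ball: "of_real (S n) * w \<in> ball 0 1" if "norm w \<le> 1" for n and w :: complex
    proof -
      have "\<bar>S n\<bar> * norm w \<le> \<bar>S n\<bar> * 1" using that by (intro mult_left_mono) auto
      then show ?thesis using S(1)[of n] S(2)[of n] unfolding mem_ball_0 norm_mult norm_of_real by linarith
    qed
    have "(\<lambda>n. LINT w|arclength. \<bar>norm (g (of_real (S n) * w)) ^ k - v w ^ k\<bar>) \<longlonglongrightarrow> (LINT w|arclength. 0)"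
    proof (rule integral_dominated_convergence[where w = "\<lambda>_. 1"])
      have "continuous_on (sphere 0 1) (\<lambda>w. g (of_real (S n) * w))" for n
        by (rule continuous_on_compose2[OF g(1)]) (use in_ball in \<open>auto intro!: continuous_intros\<close>)
      from borel_measurable_arclength_continuous[OF this] v
      show "(\<lambda>w. \<bar>norm (g (of_real (S n) * w)) ^ k - v w ^ k\<bar>) \<in> borel_measurable arclength" for n
        by measurable
      show "AE w in arclength. (\<lambda>n. \<bar>norm (g (of_real (S n) * w)) ^ k - v w ^ k\<bar>) \<longlonglongrightarrow> 0"
        using AE_arclength_not_in_null[OF E] AE_space
      proof eventually_elim
        case (elim w)
        then have w: "w \<in> sphere 0 1 - E" "w \<in> cball 0 1 - E" by auto
        have "(\<lambda>n. of_real (S n) * w) \<longlonglongrightarrow> of_real 1 * w" by (intro tendsto_intros S)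
        then have "(\<lambda>n. of_real (S n) * w) \<longlonglongrightarrow> w" by simp
        moreover have "of_real (S n) * w \<in> cball 0 1 - E" for n
        proof -
          have "of_real (S n) * w \<in> ball 0 1" using w in_ball by auto
          then show ?thesis using E(2) by auto
        qed
        ultimately have "(\<lambda>n. g_ext (of_real (S n) * w)) \<longlonglongrightarrow> g_ext w"
          by (intro continuous_on_tendsto_compose[OF g_ext(1)] w always_eventually allI)
        moreover have "g_ext (of_real (S n) * w) = g (of_real (S n) * w)" for n
          using g_ext(2) in_ball[of w n] w by auto
        ultimately have "(\<lambda>n. g (of_real (S n) * w)) \<longlonglongrightarrow> g_ext w" by simp
        then have "(\<lambda>n. \<bar>norm (g (of_real (S n) * w)) ^ k - norm (g_ext w) ^ k\<bar>) \<longlonglongrightarrow> \<bar>norm (g_ext w) ^ k - norm (g_ext w) ^ k\<bar>"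
          by (intro tendsto_intros)
        then show ?case using w by (simp add: v_def)
      qed
      show "AE w in arclength. norm \<bar>norm (g (of_real (S n) * w)) ^ k - v w ^ k\<bar> \<le> 1" for n
      proof (rule AE_I2)
        fix w assume "w \<in> space arclength"
        then have "g (of_real (S n) * w) \<in> ball 0 1" using g(2) in_ball[of w n] by (auto simp: image_subset_iff)
        then have "0 \<le> norm (g (of_real (S n) * w)) ^ k" "norm (g (of_real (S n) * w)) ^ k \<le> 1" "0 \<le> v w ^ k" "v w ^ k \<le> 1"
          using v1[of w] by (auto intro!: power_le_one)
        then show "norm \<bar>norm (g (of_real (S n) * w)) ^ k - v w ^ k\<bar> \<le> 1"
          unfolding real_norm_def abs_idempotent by linarith
      qed
    qed auto
    then show "(\<lambda>n. LINT w|arclength. \<bar>norm (g (of_real (S n) * w)) ^ k - v w ^ k\<bar>) \<longlonglongrightarrow> 0" by simp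
  qed auto
qed

lemma LINT_power_minus_indicator_tendsto_0:
  fixes v :: "complex \<Rightarrow> real"
  assumes v: "v \<in> borel_measurable arclength" and I: "I \<in> sets arclength"
    and lim: "AE w in arclength. (w \<in> I \<and> v w = 1) \<or> (w \<notin> I \<and> 0 \<le> v w \<and> v w < 1)"
  shows "(\<lambda>n. LINT w|arclength. \<bar>v w ^ (2 * Suc n) - indicator I w\<bar>) \<longlonglongrightarrow> 0"
proof -
  have "(\<lambda>n. LINT w|arclength. \<bar>v w ^ (2 * Suc n) - indicator I w\<bar>) \<longlonglongrightarrow> (LINT w|arclength. 0)"
  proof (rule integral_dominated_convergence[where w = "\<lambda>_. 1"])
    show "(\<lambda>w. \<bar>v w ^ (2 * Suc n) - indicator I w\<bar>) \<in> borel_measurable arclength" for n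
      using v I by measurable
    show "AE w in arclength. (\<lambda>n. \<bar>v w ^ (2 * Suc n) - indicator I w\<bar>) \<longlonglongrightarrow> 0"
      using lim
    proof eventually_elim
      case (elim w)
      then show ?case
      proof (elim disjE conjE)
        assume w: "w \<notin> I" "0 \<le> v w" "v w < 1"
        then have "(v w)\<^sup>2 < 1" by (simp add: power_less_one_iff abs_square_less_1)
        then have "(\<lambda>n. ((v w)\<^sup>2) ^ n) \<longlonglongrightarrow> 0" by (intro LIMSEQ_power_zero) auto
        then have "(\<lambda>n. ((v w)\<^sup>2) ^ Suc n) \<longlonglongrightarrow> 0" by (rule LIMSEQ_Suc)
        then have "(\<lambda>n. \<bar>((v w)\<^sup>2) ^ Suc n\<bar>) \<longlonglongrightarrow> 0" by (rule tendsto_rabs_zero)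
        then show ?thesis using w by (simp only: power_mult[symmetric]) simp
      qed simp
    qed
    show "AE w in arclength. norm \<bar>v w ^ (2 * Suc n) - indicator I w\<bar> \<le> 1" for n
      using lim by eventually_elim (auto simp: power_le_one simp del: power_Suc)
  qed auto
  then show ?thesis by simp
qed

text \<open>Near \<open>w\<close> one has \<open>\<bar>g\<bar> \<le> q < 1\<close>, so the powers decay geometrically and their derivatives like
\<open>n q\<^sup>n\<close>.\<close>

lemma vanishing_seq_dilated_powers:
  assumes g: "g holomorphic_on ball 0 1" "g ` ball 0 1 \<subseteq> ball 0 1"
    and r: "r \<longlonglongrightarrow> 1" "\<And>n. 0 < r n" "\<And>n. r n < 1"
  shows "vanishing_seq (\<lambda>n w. g (of_real (r n) * w) ^ Suc n)"
    and "norm w \<le> 1 \<Longrightarrow> norm (g (of_real (r n) * w) ^ Suc n) \<le> 1"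
proof -
  have in_ball: "of_real (r n) * w \<in> ball 0 1" if "norm w \<le> 1" for n and w :: complex
  proof -
    have "\<bar>r n\<bar> * norm w \<le> \<bar>r n\<bar> * 1" using that by (intro mult_left_mono) auto
    then show ?thesis using r(2)[of n] r(3)[of n] unfolding mem_ball_0 norm_mult norm_of_real by linarith
  qed
  have le1: "norm (g (of_real (r n) * w) ^ Suc n) \<le> 1" if "norm w \<le> 1" for n w
    unfolding norm_power using g(2) in_ball[OF that, of n] by (intro power_le_one) (auto simp: image_subset_iff intro: less_imp_le)
  then show "norm w \<le> 1 \<Longrightarrow> norm (g (of_real (r n) * w) ^ Suc n) \<le> 1" .
  have holo: "(\<lambda>w. g (of_real (r n) * w) ^ Suc n) holomorphic_on ball 0 (1 / r n)" for n
  proof -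
    have "(\<lambda>w. g (of_real (r n) * w)) holomorphic_on ball 0 (1 / r n)"
      by (rule holomorphic_on_compose_gen[of "\<lambda>w. of_real (r n) * w" _ g "ball 0 1", unfolded o_def])
         (use g r(2)[of n] in \<open>auto intro!: holomorphic_intros simp: norm_mult field_simps\<close>)
    then show ?thesis by (rule holomorphic_on_power)
  qed
  have bdd: "bounded_holomorphic_seq (\<lambda>n w. g (of_real (r n) * w) ^ Suc n)"
    unfolding bounded_holomorphic_seq_def
  proof (intro conjI allI)
    show "\<exists>R>1. (\<lambda>w. g (of_real (r n) * w) ^ Suc n) holomorphic_on ball 0 R" for n
      using holo[of n] r(2)[of n] r(3)[of n] by (intro exI[of _ "1 / r n"]) auto
    show "\<exists>C. \<forall>n. \<forall>w\<in>cball 0 1. norm (g (of_real (r n) * w) ^ Suc n) \<le> C"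
      using le1 by (intro exI[of _ 1]) auto
  qed
  have "(\<lambda>n. g (of_real (r n) * w) ^ Suc n) \<longlonglongrightarrow> 0 \<and> (\<lambda>n. deriv (\<lambda>w. g (of_real (r n) * w) ^ Suc n) w) \<longlonglongrightarrow> 0"
    if w: "w \<in> ball 0 1" for w
  proof -
    have dg: "deriv g holomorphic_on ball 0 1" by (rule holomorphic_deriv[OF g(1)]) auto
    have "(\<lambda>n. of_real (r n) * w) \<longlonglongrightarrow> of_real 1 * w" by (intro tendsto_intros r)
    then have rw: "(\<lambda>n. of_real (r n) * w) \<longlonglongrightarrow> w" by simp
    have lim: "(\<lambda>n. f (of_real (r n) * w)) \<longlonglongrightarrow> f w" if "f holomorphic_on ball 0 1" for f :: "complex \<Rightarrow> complex"
    proof -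
      have "isCont f w"
        using holomorphic_on_imp_continuous_on[OF that] w by (simp add: continuous_on_eq_continuous_at)
      then show ?thesis using rw by (rule isCont_tendsto_compose)
    qed
    have "norm (g w) < 1" using g(2) w by (auto simp: image_subset_iff)
    then obtain q where q: "norm (g w) < q" "q < 1" using dense by blast
    then have "0 < q" by (meson norm_ge_zero order_le_less_trans)
    have "\<forall>\<^sub>F n in sequentially. norm (g (of_real (r n) * w)) < q"
      by (rule order_tendstoD(2)[OF tendsto_norm[OF lim[OF g(1)]] q(1)])
    then have ev: "\<forall>\<^sub>F n in sequentially. norm (g (of_real (r n) * w)) \<le> q"
      by (rule eventually_mono) simp
    have qlim: "(\<lambda>n. q ^ Suc n) \<longlonglongrightarrow> 0"
      by (rule LIMSEQ_Suc) (use q \<open>0 < q\<close> in \<open>auto intro: LIMSEQ_power_zero\<close>)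
    have 1: "(\<lambda>n. g (of_real (r n) * w) ^ Suc n) \<longlonglongrightarrow> 0"
      by (rule Lim_null_comparison[OF _ qlim])
         (use ev in eventually_elim, simp only: norm_power, intro power_mono norm_ge_zero)
    have d: "deriv (\<lambda>w. g (of_real (r n) * w) ^ Suc n) w =
        of_nat (Suc n) * g (of_real (r n) * w) ^ n * (deriv g (of_real (r n) * w) * of_real (r n))" for n
    proof -
      have "(g has_field_derivative deriv g (of_real (r n) * w)) (at (of_real (r n) * w))"
        using holomorphic_derivI[OF g(1) open_ball in_ball[of w n]] w by simp
      moreover have "((*) (of_real (r n)) has_field_derivative of_real (r n)) (at w)"
        by (auto intro!: derivative_eq_intros)
      ultimately have "((\<lambda>w. g (of_real (r n) * w)) has_field_derivative deriv g (of_real (r n) * w) * of_real (r n)) (at w)"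
        using DERIV_chain[of g _ "(*) (of_real (r n))" w] by (simp add: o_def)
      from DERIV_power[OF this, where n = "Suc n"] show ?thesis
        by (intro DERIV_imp_deriv) (simp add: mult_ac del: of_nat_Suc power_Suc)
    qed
    have "(\<lambda>n. deriv g (of_real (r n) * w) * of_real (r n)) \<longlonglongrightarrow> deriv g w * of_real 1"
      by (intro tendsto_intros lim dg r)
    moreover have "(\<lambda>n. of_nat (Suc n) * g (of_real (r n) * w) ^ n) \<longlonglongrightarrow> 0"
    proof (rule Lim_null_comparison)
      show "\<forall>\<^sub>F n in sequentially. norm (of_nat (Suc n) * g (of_real (r n) * w) ^ n) \<le> real n * q ^ n + q ^ n"
        using ev
      proof eventually_elim
        case (elim n)
        have "norm (of_nat (Suc n) * g (of_real (r n) * w) ^ n) = real (Suc n) * norm (g (of_real (r n) * w)) ^ n"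
          by (simp only: norm_mult norm_power norm_of_nat)
        also have "\<dots> \<le> real (Suc n) * q ^ n" using elim by (intro mult_left_mono power_mono) auto
        also have "\<dots> = real n * q ^ n + q ^ n" by (simp add: algebra_simps)
        finally show ?case .
      qed
      have "(\<lambda>n. real n * q ^ n + q ^ n) \<longlonglongrightarrow> 0 + 0"
        using q \<open>0 < q\<close> by (intro tendsto_add powser_times_n_limit_0 LIMSEQ_power_zero) auto
      then show "(\<lambda>n. real n * q ^ n + q ^ n) \<longlonglongrightarrow> 0" by simp
    qed
    ultimately have "(\<lambda>n. of_nat (Suc n) * g (of_real (r n) * w) ^ n * (deriv g (of_real (r n) * w) * of_real (r n))) \<longlonglongrightarrow> 0 * (deriv g w * of_real 1)"
      by (rule tendsto_mult[rotated])
    then have "(\<lambda>n. deriv (\<lambda>w. g (of_real (r n) * w) ^ Suc n) w) \<longlonglongrightarrow> 0" unfolding d by simp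
    with 1 show ?thesis by blast
  qed
  with bdd show "vanishing_seq (\<lambda>n w. g (of_real (r n) * w) ^ Suc n)"
    unfolding vanishing_seq_def by blast
qed

lemma holomorphic_near_cball_disc_aut:
  assumes z0: "norm z0 < 1" and g: "g holomorphic_on ball 0 1" and r: "0 < r" "r < 1"
  shows "holomorphic_near (\<lambda>\<zeta>. (of_real r * disc_aut z0 \<zeta>, g (of_real r * disc_aut z0 \<zeta>) ^ k)) (cball 0 1)"
proof -
  let ?D = "{w. 1 - cnj z0 * w \<noteq> 0}"
  let ?\<phi> = "\<lambda>\<zeta>. of_real r * disc_aut z0 \<zeta>"
  define U where "U = ?D \<inter> ?\<phi> -` ball 0 1"
  have \<phi>: "?\<phi> holomorphic_on ?D" by (intro holomorphic_intros holomorphic_on_disc_aut z0)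
  have "open U"
    unfolding U_def using holomorphic_on_imp_continuous_on[OF \<phi>] open_disc_aut_domain
    by (intro continuous_open_preimage open_ball)
  moreover have "cball 0 1 \<subseteq> U"
  proof
    fix w :: complex assume "w \<in> cball 0 1"
    then have w: "norm w \<le> 1" by simp
    have "r * norm (disc_aut z0 w) \<le> r * 1"
      using norm_disc_aut_le[OF z0 w] r by (intro mult_left_mono) auto
    then have "norm (?\<phi> w) < 1"
      using r unfolding norm_mult norm_of_real by (simp only: abs_of_pos)
    then show "w \<in> U"
      using one_minus_cnj_mult_nonzero[OF z0 w] by (simp add: U_def)
  qed
  moreover have "?\<phi> holomorphic_on U" by (rule holomorphic_on_subset[OF \<phi>]) (auto simp: U_def)
  moreover from this have "(\<lambda>\<zeta>. g (?\<phi> \<zeta>)) holomorphic_on U"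
    by (rule holomorphic_on_compose_gen[of ?\<phi> _ g "ball 0 1", unfolded o_def, OF _ g]) (auto simp: U_def)
  then have "(\<lambda>\<zeta>. g (?\<phi> \<zeta>) ^ k) holomorphic_on U" by (rule holomorphic_on_power)
  ultimately show ?thesis
    unfolding holomorphic_near_def by (intro exI[of _ U]) (simp add: o_def)
qed

text \<open>The four coefficients contribute separately: \<open>a11\<close> gives the horizontal disc, \<open>a22\<close> the vertical discs
over \<open>I\<close>, and the mixed ones nothing.\<close>

lemma (in asymptotically_inner_seq) weak_limit:
  assumes z0: "norm z0 < 1"
    and a: "\<And>S. continuous_on S a11" "\<And>S. continuous_on S a12" "\<And>S. continuous_on S a21" "\<And>S. continuous_on S a22"
    and r: "r \<longlonglongrightarrow> 1" "\<And>n. 0 < r n" "\<And>n. r n < 1"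
  shows "(\<lambda>n. pushforward (\<lambda>\<zeta>. (of_real (r n) * disc_aut z0 \<zeta>, h n (disc_aut z0 \<zeta>))) (green_current 0) (form11 a11 a12 a21 a22))
     \<longlonglongrightarrow> pushforward (\<lambda>\<xi>. (\<xi>, 0)) (green_current z0) (form11 a11 a12 a21 a22) +
        (LINT \<zeta>:I|harmonic_measure z0. pushforward (\<lambda>\<xi>. (\<zeta>, \<xi>)) (green_current 0) (form11 a11 a12 a21 a22))"
proof -
  let ?f = "\<lambda>n \<zeta>. (of_real (r n) * disc_aut z0 \<zeta>, h n (disc_aut z0 \<zeta>))"
  let ?\<alpha> = "form11 a11 a12 a21 a22"
  have rw: "norm (of_real (r n) * w) \<le> 1" if "norm w \<le> 1" for n and w :: complex
    using that r(2)[of n] r(3)[of n] by (simp add: norm_mult mult_le_one)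
  have r_lim: "(\<lambda>n. complex_of_real (r n)) \<longlonglongrightarrow> 1" using tendsto_of_real[OF r(1)] by simp
  have r_norm: "norm (complex_of_real (r n)) \<le> 1" for n using r(2)[of n] r(3)[of n] by simp
  let ?x = "\<lambda>n w. (of_real (r n) * w, h n w)"
  let ?h' = "\<lambda>n. deriv (h n)"
  let ?G = "\<lambda>f. LINT w:ball 0 1|lborel. of_real (green z0 w) * f w"
  let ?m11 = "\<lambda>n w. a11 (?x n w) * (of_real (r n) * cnj (of_real (r n)))"
  let ?m12 = "\<lambda>n w. a12 (?x n w) * (of_real (r n) * cnj (?h' n w))"
  let ?m21 = "\<lambda>n w. a21 (?x n w) * (?h' n w * cnj (of_real (r n)))"
  let ?m22 = "\<lambda>n w. a22 (?x n w) * (?h' n w * cnj (?h' n w))"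
  have ax: "continuous_on (cball 0 1) (\<lambda>w. b (?x n w))" if "\<And>S. continuous_on S b" for b :: "complex \<times> complex \<Rightarrow> complex" and n
    by (rule continuous_on_compose2[OF that[of UNIV]]) (auto intro!: continuous_intros continuous)
  note cont = ax[OF a(1)] ax[OF a(2)] ax[OF a(3)] ax[OF a(4)] continuous[OF order_refl]
  have push: "pushforward (?f n) (green_current 0) ?\<alpha> =
      - 2 * \<i> * (?G (?m11 n) + ?G (?m12 n) + ?G (?m21 n) + ?G (?m22 n))" for n
  proof -
    have "pushforward (?f n) (green_current 0) ?\<alpha> =
      - 2 * \<i> * ?G (\<lambda>w. ?m11 n w + ?m12 n w + ?m21 n w + ?m22 n w)"
      by (intro pushforward_green_current_disc_aut z0 a continuous order_refl
          bounded_holomorphic_seq_field_derivative[OF bounded_holo] less_imp_le)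
    also have "?G (\<lambda>w. ?m11 n w + ?m12 n w + ?m21 n w + ?m22 n w) = ?G (?m11 n) + ?G (?m12 n) + ?G (?m21 n) + ?G (?m22 n)"
    proof -
      have i: "set_integrable lborel (ball 0 1) (\<lambda>w. of_real (green z0 w) * ?m11 n w)"
        "set_integrable lborel (ball 0 1) (\<lambda>w. of_real (green z0 w) * ?m12 n w)"
        "set_integrable lborel (ball 0 1) (\<lambda>w. of_real (green z0 w) * ?m21 n w)"
        "set_integrable lborel (ball 0 1) (\<lambda>w. of_real (green z0 w) * ?m22 n w)"
        by (intro set_integrable_green_mult z0 continuous_intros cont)+
      show ?thesis unfolding distrib_left[of "of_real (green z0 _)"] by (simp only: set_integral_add i)
    qed
    finally show ?thesis .
  qed
  have bd: "\<exists>M\<ge>0. \<forall>n w. norm w \<le> 1 \<longrightarrow> norm (b (?x n w)) \<le> M" if b: "\<And>S. continuous_on S b" for b :: "complex \<times> complex \<Rightarrow> complex"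
  proof -
    obtain M where M: "0 \<le> M" "\<And>w \<xi>. norm w \<le> 1 \<Longrightarrow> norm \<xi> \<le> 1 \<Longrightarrow> norm (b (w, \<xi>)) \<le> M"
      by (rule bounded_on_bidisc[OF b]) (rule that)
    have "norm (b (?x n w)) \<le> M" if "norm w \<le> 1" for n w
      using M(2)[OF rw[OF that] norm_le_1[OF that]] .
    then show ?thesis using M(1) by blast
  qed
  have 11: "(\<lambda>n. ?G (?m11 n)) \<longlonglongrightarrow> ?G (\<lambda>w. a11 (w, 0))"
  proof -
    obtain M where M: "0 \<le> M" "\<And>n w. norm w \<le> 1 \<Longrightarrow> norm (a11 (?x n w)) \<le> M" using bd[OF a(1)] by blast
    show ?thesis
    proof (rule LINT_green_mult_tendsto[OF z0])
      show "continuous_on (cball 0 1) (?m11 n)" for n by (intro continuous_intros cont)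
      show "norm (?m11 n w) \<le> M" if "norm w < 1" for n w
      proof -
        have "norm (?m11 n w) \<le> M * (1 * 1)"
          unfolding norm_mult complex_mod_cnj using M r_norm that by (intro mult_mono mult_nonneg_nonneg) auto
        then show ?thesis by simp
      qed
      show "(\<lambda>n. ?m11 n w) \<longlonglongrightarrow> a11 (w, 0)" if "norm w < 1" for w
      proof -
        have "(\<lambda>n. ?x n w) \<longlonglongrightarrow> (1 * w, 0)"
          using vanishing that by (intro tendsto_Pair tendsto_mult r_lim tendsto_const) (auto simp: vanishing_seq_def)
        moreover have "isCont a11 (1 * w, 0)" using a(1)[of UNIV] by (simp add: continuous_on_eq_continuous_at)
        ultimately have "(\<lambda>n. a11 (?x n w)) \<longlonglongrightarrow> a11 (1 * w, 0)" by (rule isCont_tendsto_compose[rotated])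
        then have "(\<lambda>n. ?m11 n w) \<longlonglongrightarrow> a11 (1 * w, 0) * (1 * cnj 1)"
          by (intro tendsto_mult tendsto_cnj r_lim)
        then show ?thesis by simp
      qed
    qed
  qed
  have 12: "(\<lambda>n. ?G (?m12 n)) \<longlonglongrightarrow> 0"
  proof -
    obtain M where M: "0 \<le> M" "\<And>n w. norm w \<le> 1 \<Longrightarrow> norm (a12 (?x n w)) \<le> M" using bd[OF a(2)] by blast
    show ?thesis
    proof (rule LINT_green_deriv_tendsto_0[OF z0 _ M(1)])
      show "continuous_on (cball 0 1) (?m12 n)" for n by (intro continuous_intros cont)
      show "norm (?m12 n w) \<le> M * norm (?h' n w)" if "norm w < 1" for n w
      proof -
        have "norm (?m12 n w) \<le> M * (1 * norm (?h' n w))"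
          unfolding norm_mult complex_mod_cnj using M r_norm that by (intro mult_mono mult_nonneg_nonneg) auto
        then show ?thesis by simp
      qed
    qed
  qed
  have 21: "(\<lambda>n. ?G (?m21 n)) \<longlonglongrightarrow> 0"
  proof -
    obtain M where M: "0 \<le> M" "\<And>n w. norm w \<le> 1 \<Longrightarrow> norm (a21 (?x n w)) \<le> M" using bd[OF a(3)] by blast
    show ?thesis
    proof (rule LINT_green_deriv_tendsto_0[OF z0 _ M(1)])
      show "continuous_on (cball 0 1) (?m21 n)" for n by (intro continuous_intros cont)
      show "norm (?m21 n w) \<le> M * norm (?h' n w)" if "norm w < 1" for n w
      proof -
        have "norm (?m21 n w) \<le> M * (norm (?h' n w) * 1)"
          unfolding norm_mult complex_mod_cnj using M r_norm that by (intro mult_mono mult_nonneg_nonneg) auto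
        then show ?thesis by simp
      qed
    qed
  qed
  have 22: "(\<lambda>n. ?G (?m22 n)) \<longlonglongrightarrow> (LINT w:I|arclength. of_real (poisson_factor z0 w) * green_fibre a22 w)"
    by (rule LINT_green_energy_tendsto[OF z0 a(4) r])
  have "(\<lambda>n. - 2 * \<i> * (?G (?m11 n) + ?G (?m12 n) + ?G (?m21 n) + ?G (?m22 n))) \<longlonglongrightarrow>
     - 2 * \<i> * (?G (\<lambda>w. a11 (w, 0)) + 0 + 0 + (LINT w:I|arclength. of_real (poisson_factor z0 w) * green_fibre a22 w))"
    by (intro tendsto_mult_left tendsto_add 11 12 21 22)
  also have "- 2 * \<i> * (?G (\<lambda>w. a11 (w, 0)) + 0 + 0 + (LINT w:I|arclength. of_real (poisson_factor z0 w) * green_fibre a22 w)) =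
     pushforward (\<lambda>\<xi>. (\<xi>, 0)) (green_current z0) ?\<alpha> +
        (LINT \<zeta>:I|harmonic_measure z0. pushforward (\<lambda>\<xi>. (\<zeta>, \<xi>)) (green_current 0) ?\<alpha>)"
  proof -
    have "pushforward (\<lambda>\<xi>. (\<xi>, 0)) (green_current z0) ?\<alpha> = - 2 * \<i> * ?G (\<lambda>w. a11 (w, 0))"
      unfolding pushforward_green_current_horizontal mult.left_commute[of _ "- 2 * \<i>"] by (rule set_integral_mult_right)
    moreover have "(LINT \<zeta>:I|harmonic_measure z0. pushforward (\<lambda>\<xi>. (\<zeta>, \<xi>)) (green_current 0) ?\<alpha>) =
       - 2 * \<i> * (LINT w:I|arclength. of_real (poisson_factor z0 w) * green_fibre a22 w)"
      unfolding pushforward_green_current_vertical set_integral_mult_right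
      using LINT_harmonic_measure[OF z0 I_sets continuous_on_green_fibre[OF a(4)]] by simp
    ultimately show ?thesis by (simp only: distrib_left add_0_right)
  qed
  finally show ?thesis unfolding push .
qed

text \<open>For each \<open>\<nu>\<close> the radius is taken so close to \<open>1\<close> that on the circle \<open>\<bar>g(r w)\<bar>\<^sup>2\<^sup>\<nu>\<close> is within \<open>1/\<nu>\<close> of
\<open>\<bar>g_ext\<bar>\<^sup>2\<^sup>\<nu>\<close> in \<open>L\<^sup>1\<close>; the latter tends to the indicator of \<open>I\<close>. Sequences are shifted by one, because
nothing is known about \<open>r 0\<close>.\<close>

theorem proposition6:
  fixes I E :: "complex set" and z0 :: complex and g g_ext :: "complex \<Rightarrow> complex"
  assumes "openin (top_of_set (sphere 0 1)) I" and "I \<noteq> {}"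
    and "measure arclength (closure I) < 1"
    and "E = (top_of_set (sphere 0 1)) frontier_of I" and "measure arclength E = 0"
    and "z0 \<in> ball 0 1"
    and "g holomorphic_on ball 0 1" and "g ` ball 0 1 \<subseteq> ball 0 1"
    and "continuous_on (cball 0 1 - E) g_ext" and "\<forall>\<zeta>\<in>ball 0 1. g_ext \<zeta> = g \<zeta>"
    and "\<forall>\<zeta>\<in>I. norm (g_ext \<zeta>) = 1"
    and "\<forall>\<zeta>\<in>sphere 0 1 - closure I. norm (g_ext \<zeta>) < 1"
  shows "\<exists>\<delta> :: nat \<Rightarrow> real. (\<forall>\<nu>\<ge>1. \<delta> \<nu> \<in> {0<..<1}) \<and>
    (\<forall>(r :: nat \<Rightarrow> real) (f :: nat \<Rightarrow> complex \<Rightarrow> complex \<times> complex).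
      (\<forall>\<nu>\<ge>1. r \<nu> \<in> {0<..<1} \<and> 1 - \<delta> \<nu> < r \<nu>) \<longrightarrow> r \<longlonglongrightarrow> 1 \<longrightarrow>
      f = (\<lambda>\<nu>. (\<lambda>\<zeta>. (\<zeta>, g \<zeta> ^ \<nu>)) \<circ> (\<lambda>\<zeta>. complex_of_real (r \<nu>) * \<zeta>) \<circ> disc_aut z0) \<longrightarrow>
      (\<forall>\<nu>\<ge>1. holomorphic_near (f \<nu>) (cball 0 1)) \<and>
      weakly_converges (\<lambda>\<nu>. pushforward (f \<nu>) (green_current 0))
        (\<lambda>\<alpha>. pushforward (\<lambda>\<xi>. (\<xi>, 0)) (green_current z0) \<alpha> +
          (LINT \<zeta>:I|harmonic_measure z0. pushforward (\<lambda>\<xi>. (\<zeta>, \<xi>)) (green_current 0) \<alpha>)))"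
proof -
  note fr = relative_frontier_open_circle[OF assms(1,4)]
  have z0: "norm z0 < 1" using assms(6) by simp
  have I_sets: "I \<in> sets arclength" by (rule sets_arclengthI[OF fr(5,6)])
  have off_I: "norm (g_ext w) < 1" if "w \<in> sphere 0 1 - E - I" for w
    using that fr(4) assms(12) by blast
  have le_1: "norm (g_ext w) \<le> 1" if "w \<in> sphere 0 1 - E" for w
    using that off_I[of w] assms(11) by (cases "w \<in> I") (auto intro: less_imp_le)
  define v where "v = (\<lambda>w. norm (indicator (sphere 0 1 - E) w *\<^sub>R g_ext w))"
  define F where "F k s = (LINT w|arclength. \<bar>norm (g (of_real s * w)) ^ k - v w ^ k\<bar>)" for k s
  note dil = LINT_dilation_modulus_tendsto[OF fr(1,2) assms(5) holomorphic_on_imp_continuous_on[OF assms(7)] assms(8,9,10) le_1]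
  have v_meas: "v \<in> borel_measurable arclength" unfolding v_def by (rule dil(1))
  have F_lim: "(F k \<longlongrightarrow> 0) (at_left 1)" for k
    using dil(2)[of k] unfolding F_def[abs_def] v_def .
  have "\<exists>d. d \<in> {0<..<1} \<and> (\<forall>s. 1 - d < s \<longrightarrow> s < 1 \<longrightarrow> F (2 * \<nu>) s < 1 / real \<nu>)" if "\<nu> \<ge> 1" for \<nu>
  proof -
    have "\<forall>\<^sub>F s in at_left 1. F (2 * \<nu>) s < 1 / real \<nu>"
      using that by (intro order_tendstoD(2)[OF F_lim]) auto
    then obtain b where b: "b < 1" "\<And>s. b < s \<Longrightarrow> s < 1 \<Longrightarrow> F (2 * \<nu>) s < 1 / real \<nu>"
      using eventually_at_left[of 0 "1::real"] by auto
    show ?thesis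
      using b by (intro exI[of _ "1 - max b (1 / 2)"]) auto
  qed
  then have "\<forall>\<nu>. \<exists>d. \<nu> \<ge> 1 \<longrightarrow> d \<in> {0<..<1} \<and> (\<forall>s. 1 - d < s \<longrightarrow> s < 1 \<longrightarrow> F (2 * \<nu>) s < 1 / real \<nu>)"
    by blast
  then obtain \<delta> where \<delta>: "\<And>\<nu>. \<nu> \<ge> 1 \<Longrightarrow> \<delta> \<nu> \<in> {0<..<1}"
    "\<And>\<nu> s. \<nu> \<ge> 1 \<Longrightarrow> 1 - \<delta> \<nu> < s \<Longrightarrow> s < 1 \<Longrightarrow> F (2 * \<nu>) s < 1 / real \<nu>"
    unfolding choice_iff by blast
  show ?thesis
  proof (intro exI[of _ \<delta>] conjI allI impI)
    show "\<delta> \<nu> \<in> {0<..<1}" if "1 \<le> \<nu>" for \<nu> by (rule \<delta>(1)[OF that])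
    fix r :: "nat \<Rightarrow> real" and f :: "nat \<Rightarrow> complex \<Rightarrow> complex \<times> complex"
    assume r: "\<forall>\<nu>\<ge>1. r \<nu> \<in> {0<..<1} \<and> 1 - \<delta> \<nu> < r \<nu>" and r_lim: "r \<longlonglongrightarrow> 1"
      and "f = (\<lambda>\<nu>. (\<lambda>\<zeta>. (\<zeta>, g \<zeta> ^ \<nu>)) \<circ> (\<lambda>\<zeta>. complex_of_real (r \<nu>) * \<zeta>) \<circ> disc_aut z0)"
    then have f: "f \<nu> = (\<lambda>\<zeta>. (of_real (r \<nu>) * disc_aut z0 \<zeta>, g (of_real (r \<nu>) * disc_aut z0 \<zeta>) ^ \<nu>))" for \<nu>
      by (simp add: o_def)
    show "holomorphic_near (f \<nu>) (cball 0 1)" if "1 \<le> \<nu>" for \<nu>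
      unfolding f using r that by (intro holomorphic_near_cball_disc_aut z0 assms(7)) auto
    define s where "s n = r (Suc n)" for n
    have s: "s \<longlonglongrightarrow> 1" "\<And>n. 0 < s n" "\<And>n. s n < 1" "\<And>n. 1 - \<delta> (Suc n) < s n"
      using r LIMSEQ_Suc[OF r_lim] unfolding s_def[abs_def] by auto
    define h where "h n w = g (of_real (s n) * w) ^ Suc n" for n w
    have van: "vanishing_seq h" and h1: "\<And>n w. norm w \<le> 1 \<Longrightarrow> norm (h n w) \<le> 1"
      unfolding h_def using vanishing_seq_dilated_powers[OF assms(7,8) s(1-3)] by auto
    note hc = bounded_holomorphic_seq_continuous[OF vanishing_seq_bounded[OF van]]
    have mod: "(\<lambda>n. LINT w|arclength. \<bar>(norm (h n w))\<^sup>2 - indicator I w\<bar>) \<longlonglongrightarrow> 0"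
    proof (rule tendsto_sandwich[where f = "\<lambda>_. 0"])
      let ?V = "\<lambda>n. LINT w|arclength. \<bar>v w ^ (2 * Suc n) - indicator I w\<bar>"
      have "AE w in arclength. (w \<in> I \<and> v w = 1) \<or> (w \<notin> I \<and> 0 \<le> v w \<and> v w < 1)"
        using AE_arclength_not_in_null[OF fr(1,2) assms(5)] AE_space
      proof eventually_elim
        case (elim w)
        then have "v w = norm (g_ext w)" by (simp add: v_def)
        then show ?case using elim off_I[of w] assms(11) by auto
      qed
      then have "?V \<longlonglongrightarrow> 0" by (rule LINT_power_minus_indicator_tendsto_0[OF v_meas I_sets])
      from tendsto_add[OF LIMSEQ_Suc[OF lim_1_over_n] this]
      show "(\<lambda>n. 1 / real (Suc n) + ?V n) \<longlonglongrightarrow> 0" by simp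
      have v01: "0 \<le> v w" "v w \<le> 1" for w using le_1 by (auto simp: v_def split: split_indicator)
      have "(LINT w|arclength. \<bar>(norm (h n w))\<^sup>2 - indicator I w\<bar>) \<le> 1 / real (Suc n) + ?V n" for n
      proof -
        have hk: "(norm (h n w))\<^sup>2 = norm (g (of_real (s n) * w)) ^ (2 * Suc n)" for w
          unfolding h_def norm_power power_mult[symmetric] by (simp only: mult.commute)
        have m: "(\<lambda>w. (norm (h n w))\<^sup>2) \<in> borel_measurable arclength"
          by (intro borel_measurable_arclength_continuous continuous_intros hc) auto
        have mi: "(indicator I :: complex \<Rightarrow> real) \<in> borel_measurable arclength"
          using I_sets by (rule borel_measurable_indicator)
        have i1: "integrable arclength (\<lambda>w. \<bar>(norm (h n w))\<^sup>2 - v w ^ (2 * Suc n)\<bar>)"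
        proof (rule arclength.integrable_const_bound[where B = 1])
          show "AE w in arclength. norm \<bar>(norm (h n w))\<^sup>2 - v w ^ (2 * Suc n)\<bar> \<le> 1"
          proof (rule AE_I2)
            fix w assume "w \<in> space arclength"
            then have "(norm (h n w))\<^sup>2 \<le> 1" using h1[of w n] by (simp add: power_le_one)
            moreover have "0 \<le> v w ^ (2 * Suc n)" "v w ^ (2 * Suc n) \<le> 1" using v01[of w] by (auto simp: power_le_one simp del: power_Suc)
            moreover have "0 \<le> (norm (h n w))\<^sup>2" by simp
            ultimately show "norm \<bar>(norm (h n w))\<^sup>2 - v w ^ (2 * Suc n)\<bar> \<le> 1"
              unfolding real_norm_def abs_idempotent by linarith
          qed
          show "(\<lambda>w. \<bar>(norm (h n w))\<^sup>2 - v w ^ (2 * Suc n)\<bar>) \<in> borel_measurable arclength"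
            using m v_meas by measurable
        qed
        have i2: "integrable arclength (\<lambda>w. \<bar>v w ^ (2 * Suc n) - indicator I w\<bar>)"
        proof (rule arclength.integrable_const_bound[where B = 1])
          show "AE w in arclength. norm \<bar>v w ^ (2 * Suc n) - indicator I w\<bar> \<le> 1"
          proof (rule AE_I2)
            fix w
            have "0 \<le> v w ^ (2 * Suc n)" "v w ^ (2 * Suc n) \<le> 1" using v01[of w] by (auto simp: power_le_one simp del: power_Suc)
            then show "norm \<bar>v w ^ (2 * Suc n) - indicator I w\<bar> \<le> 1" by (cases "w \<in> I") auto
          qed
          show "(\<lambda>w. \<bar>v w ^ (2 * Suc n) - indicator I w\<bar>) \<in> borel_measurable arclength"
            using mi v_meas by measurable
        qed
        have "(LINT w|arclength. \<bar>(norm (h n w))\<^sup>2 - indicator I w\<bar>) \<le>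
          (LINT w|arclength. \<bar>(norm (h n w))\<^sup>2 - v w ^ (2 * Suc n)\<bar> + \<bar>v w ^ (2 * Suc n) - indicator I w\<bar>)"
        proof (rule Bochner_Integration.integral_mono)
          show "integrable arclength (\<lambda>w. \<bar>(norm (h n w))\<^sup>2 - v w ^ (2 * Suc n)\<bar> + \<bar>v w ^ (2 * Suc n) - indicator I w\<bar>)"
            using i1 i2 by (rule Bochner_Integration.integrable_add)
          then show "integrable arclength (\<lambda>w. \<bar>(norm (h n w))\<^sup>2 - indicator I w\<bar>)"
            by (rule Bochner_Integration.integrable_bound) (use m mi in \<open>auto intro!: AE_I2\<close>)
        qed auto
        also have "\<dots> = F (2 * Suc n) (s n) + ?V n"
          unfolding F_def hk[symmetric] using i1 i2 by (rule Bochner_Integration.integral_add)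
        also have "\<dots> \<le> 1 / real (Suc n) + ?V n"
          using \<delta>(2)[OF _ s(4,3)] by (simp add: less_imp_le)
        finally show ?thesis .
      qed
      then show "\<forall>\<^sub>F n in sequentially. (LINT w|arclength. \<bar>(norm (h n w))\<^sup>2 - indicator I w\<bar>) \<le> 1 / real (Suc n) + ?V n"
        by simp
      show "\<forall>\<^sub>F n in sequentially. 0 \<le> (LINT w|arclength. \<bar>(norm (h n w))\<^sup>2 - indicator I w\<bar>)"
        by (simp add: Bochner_Integration.integral_nonneg)
    qed auto
    interpret asymptotically_inner_seq h I
      by standard (use van h1 I_sets mod in auto)
    show "weakly_converges (\<lambda>\<nu>. pushforward (f \<nu>) (green_current 0))
        (\<lambda>\<alpha>. pushforward (\<lambda>\<xi>. (\<xi>, 0)) (green_current z0) \<alpha> +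
          (LINT \<zeta>:I|harmonic_measure z0. pushforward (\<lambda>\<xi>. (\<zeta>, \<xi>)) (green_current 0) \<alpha>))"
      unfolding weakly_converges_def
    proof
      fix \<alpha> assume "\<alpha> \<in> smooth_forms11"
      then obtain a11 a12 a21 a22 where sm: "smooth a11" "smooth a12" "smooth a21" "smooth a22"
        and \<alpha>: "\<alpha> = form11 a11 a12 a21 a22"
        unfolding smooth_forms11_def form11_def by blast
      have "(\<lambda>n. pushforward (f (Suc n)) (green_current 0) \<alpha>) \<longlonglongrightarrow>
        pushforward (\<lambda>\<xi>. (\<xi>, 0)) (green_current z0) \<alpha> +
          (LINT \<zeta>:I|harmonic_measure z0. pushforward (\<lambda>\<xi>. (\<zeta>, \<xi>)) (green_current 0) \<alpha>)"
        using weak_limit[OF z0 sm[THEN smooth_imp_continuous_on] s(1-3)]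
        unfolding f \<alpha> h_def s_def .
      then show "(\<lambda>\<nu>. pushforward (f \<nu>) (green_current 0) \<alpha>) \<longlonglongrightarrow>
        pushforward (\<lambda>\<xi>. (\<xi>, 0)) (green_current z0) \<alpha> +
          (LINT \<zeta>:I|harmonic_measure z0. pushforward (\<lambda>\<xi>. (\<zeta>, \<xi>)) (green_current 0) \<alpha>)"
        by (rule LIMSEQ_imp_Suc)
    qed
  qed
qed

end
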